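(* Let $K$ be an imaginary quadratic number field and let $D\in\mathbb{N}-\{0\}$. The set of $\Gamma_K$-conjugacy classes of maximal nonelementary $\mathbb{C}$-Fuchsian subgroups of $\Gamma_K$ with discriminant $D$ is finite and nonempty. Moreover, every maximal nonelementary $\mathbb{C}$-Fuchsian subgroup of $\Gamma_K$ with discriminant $D$ is commensurable up to conjugacy in $\mathrm{PSU}_h$ with $\Gamma_{K,2D}$.
   Context: Let $h$ be the Hermitian form $h(z_0,z_1,z_2)=-z_0\overline{z_2}-z_2\overline{z_0}+|z_1|^2$ on $\mathbb{C}^3$ (signature $(1,2)$), with associated Hermitian product $\langle\cdot,\cdot\rangle$. Let $\mathrm{SU}_h=\{g\in\mathrm{SL}_3(\mathbb{C}): h\circ g=h\}$ and $\mathrm{PSU}_h=\mathrm{SU}_h/(\mathbb{U}_3\,\mathrm{Id})$ where $\mathbb{U}_3$ is the group of cube roots of unity; it acts projectively on $\mathbb{P}_2(\mathbb{C})$. A point $[z]\in\mathbb{P}_2(\mathbb{C})$ is negative/null/positive if $h(z)<0$, $=0$, $>0$. The complex hyperbolic plane $\mathbb{H}^2_\mathbb{C}$ is the set of negative points. A complex geodesic is the intersection of $\mathbb{H}^2_\mathbb{C}$ with a complex projective line meeting it. Let $K$ be an imaginary quadratic field with ring of integers $\mathcal{O}_K$; the Picard modular group $\Gamma_K=\mathrm{PSU}_h(\mathcal{O}_K)$ is the image in $\mathrm{PSU}_h$ of the matrices of $\mathrm{SU}_h$ with entries in $\mathcal{O}_K$. A $\mathbb{C}$-Fuchsian subgroup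 of $\Gamma_K$ is the intersection of $\Gamma_K$ with the image of a Lie group embedding of $\mathrm{PSL}_2(\mathbb{R})$ into $\mathrm{PSU}_h$ preserving a complex projective line meeting $\mathbb{H}^2_\mathbb{C}$ (equivalently, a discrete subgroup preserving a complex geodesic and inducing parallel transport on its unit normal bundle). It is nonelementary if it is not virtually cyclic; "maximal" means maximal for inclusion among nonelementary $\mathbb{C}$-Fuchsian subgroups of $\Gamma_K$. A nonelementary $\mathbb{C}$-Fuchsian subgroup $\Gamma'$ of $\Gamma_K$ fixes a unique point of $\mathbb{P}_2(K)$; write it $[z_0:z_1:z_2]$ with $z_0,z_1,z_2\in\mathcal{O}_K$ relatively prime; the discriminant of $\Gamma'$ is the positive integer $\Delta_{\Gamma'}=h(z_0,z_1,z_2)$ (independent of choices). For $D\in\mathbb{N}-\{0\}$, $\Gamma_{K,D}=\mathrm{Stab}_{\Gamma_K}[-D:0:1]$. Two subgroups $\Gamma,\Gamma'$ are commensurable if $\Gamma\cap\Gamma'$ has finite index in both, and commensurable up to conjugacy in $\mathrm{PSU}_h$ if there is $g\in\mathrm{PSU}_h$ with $g\Gamma g^{-1}$ and $\Gamma'$ commensurable.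
   Formalization: C-Fuchsian subgroups use embeddings of SL_2(R), since PSL_2(R) has no embedding preserving such a line; "has discriminant D" means some representative of the fixed point with only unit common divisors has h = D, as the value can depend on the choice when the class number exceeds 1. *)

theory Defs
  imports
    "HOL-Analysis.Analysis"
    "HOL-Algebra.Coset"
    "HOL-Algebra.Generated_Groups"
    "HOL-Computational_Algebra.Polynomial"
begin

section \<open>Imaginary quadratic fields, as subfields of the complex numbers\<close>

lemma rat_vector_space_complex: "vector_space (\<lambda>(q::rat) (z::complex). of_rat q * z)"
  by unfold_locales (simp_all add: algebra_simps of_rat_add of_rat_mult)

definition imaginary_quadratic_field :: "complex set \<Rightarrow> bool" where
  "imaginary_quadratic_field K \<longleftrightarrow>
     0 \<in> K \<and> 1 \<in> K \<and>
     (\<forall>x\<in>K. \<forall>y\<in>K. x + y \<in> K \<and> x - y \<in> K \<and> x * y \<in> K) \<and>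
     (\<forall>x\<in>K. inverse x \<in> K) \<and>
     vector_space.dim (\<lambda>(q::rat) (z::complex). of_rat q * z) K = 2 \<and>
     \<not> K \<subseteq> \<real>"

definition ring_of_integers :: "complex set \<Rightarrow> complex set" where
  "ring_of_integers K = {x \<in> K. algebraic_int x}"

text \<open>
  Relatively prime: every common divisor in the ring of integers is a unit of it.
\<close>

definition relatively_prime :: "complex set \<Rightarrow> complex^3 \<Rightarrow> bool" where
  "relatively_prime K z \<longleftrightarrow>
     (\<forall>c \<in> ring_of_integers K.
        (\<forall>i. \<exists>w \<in> ring_of_integers K. z $ i = c * w) \<longrightarrow>
        (\<exists>u \<in> ring_of_integers K. c * u = 1))"


section \<open>The Hermitian form and the projective unitary group\<close>

text \<open>
  The coordinates \<open>z\<^sub>0, z\<^sub>1, z\<^sub>2\<close> of the mathematics are \<open>z $ 1, z $ 2, z $ 3\<close>.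
  The sum under \<^term>\<open>Re\<close> is a real number, so taking the real part only changes the type.
\<close>

definition herm :: "complex^3 \<Rightarrow> real" where
  "herm z = Re (- (z $ 1) * cnj (z $ 3) - (z $ 3) * cnj (z $ 1)) + (cmod (z $ 2))\<^sup>2"

definition SU_h :: "(complex^3^3) monoid" where
  "SU_h = \<lparr>carrier = {A. det A = 1 \<and> (\<forall>z. herm (A *v z) = herm z)},
           monoid.mult = (**), one = mat 1\<rparr>"

definition U3 :: "(complex^3^3) set" where
  "U3 = {mat \<omega> | \<omega>. \<omega> ^ 3 = 1}"

definition PSU_h :: "(complex^3^3) set monoid" where
  "PSU_h = SU_h Mod U3"

text \<open>
  The quotient topology. The union of a set of cosets is its preimage under the canonical
  projection.
\<close>

definition PSU_h_topology :: "(complex^3^3) set topology" where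
  "PSU_h_topology =
     topology (\<lambda>U. U \<subseteq> carrier PSU_h \<and> openin (top_of_set (carrier SU_h)) (\<Union>U))"


section \<open>The projective plane and the complex hyperbolic plane\<close>

text \<open>
  A point of the projective plane is the set of its homogeneous coordinate vectors.
\<close>

definition proj :: "complex^3 \<Rightarrow> (complex^3) set" where
  "proj z = {c *s z | c. c \<noteq> 0}"

definition P2 :: "complex set \<Rightarrow> (complex^3) set set" where
  "P2 K = {proj z | z. z \<noteq> 0 \<and> (\<forall>i. z $ i \<in> K)}"

definition H2C :: "(complex^3) set set" where
  "H2C = {proj z | z. herm z < 0}"

definition projective_line :: "(complex^3) set set \<Rightarrow> bool" where
  "projective_line L \<longleftrightarrow> (\<exists>V. vec.subspace V \<and> vec.dim V = 2 \<and> L = proj ` (V - {0}))"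

text \<open>
  The projective action. All representatives of an element of \<^term>\<open>PSU_h\<close> differ by scalars,
  hence act in the same way on points.
\<close>

definition act :: "(complex^3^3) set \<Rightarrow> (complex^3) set \<Rightarrow> (complex^3) set" where
  "act g p = {A *v v | A v. A \<in> g \<and> v \<in> p}"


section \<open>Picard modular groups\<close>

definition Picard :: "complex set \<Rightarrow> (complex^3^3) set set" where
  "Picard K = {U3 #>\<^bsub>SU_h\<^esub> A | A. A \<in> carrier SU_h \<and> (\<forall>i j. A $ i $ j \<in> ring_of_integers K)}"

definition Picard_stab :: "complex set \<Rightarrow> nat \<Rightarrow> (complex^3^3) set set" where
  "Picard_stab K D =
     {g \<in> Picard K. act g (proj (vector [- of_nat D, 0, 1])) = proj (vector [- of_nat D, 0, 1])}"


section \<open>Subgroups up to finite index and conjugacy\<close>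

definition finite_index :: "('a, 'b) monoid_scheme \<Rightarrow> 'a set \<Rightarrow> 'a set \<Rightarrow> bool" where
  "finite_index G H A \<longleftrightarrow> subgroup H (G\<lparr>carrier := A\<rparr>) \<and> finite (rcosets\<^bsub>G\<lparr>carrier := A\<rparr>\<^esub> H)"

definition virtually_cyclic :: "('a, 'b) monoid_scheme \<Rightarrow> 'a set \<Rightarrow> bool" where
  "virtually_cyclic G A \<longleftrightarrow> (\<exists>a\<in>A. finite_index G (generate G {a}) A)"

definition conjugate :: "('a, 'b) monoid_scheme \<Rightarrow> 'a \<Rightarrow> 'a set \<Rightarrow> 'a set" where
  "conjugate G g A = (\<lambda>x. g \<otimes>\<^bsub>G\<^esub> x \<otimes>\<^bsub>G\<^esub> inv\<^bsub>G\<^esub> g) ` A"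

definition commensurable :: "('a, 'b) monoid_scheme \<Rightarrow> 'a set \<Rightarrow> 'a set \<Rightarrow> bool" where
  "commensurable G A B \<longleftrightarrow> finite_index G (A \<inter> B) A \<and> finite_index G (A \<inter> B) B"

definition commensurable_up_to_conjugacy ::
    "('a, 'b) monoid_scheme \<Rightarrow> 'a set \<Rightarrow> 'a set \<Rightarrow> bool" where
  "commensurable_up_to_conjugacy G A B \<longleftrightarrow>
     (\<exists>g \<in> carrier G. commensurable G (conjugate G g A) B)"


section \<open>C-Fuchsian subgroups\<close>

text \<open>
  The source group of the embeddings is \<open>SL\<^sub>2(\<real>)\<close>. The three-dimensional simple Lie
  subgroups of \<^term>\<open>PSU_h\<close> preserving a complex projective line that meets the complex hyperbolic
  plane are the images of the groups \<open>SU(1,1)\<close> fixing a positive vector. The element of such a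
  group acting as \<open>-1\<close> on the orthogonal plane and as \<open>1\<close> on the fixed vector is not a scalar,
  so the group is a copy of \<open>SL\<^sub>2(\<real>)\<close>, and there is no embedding of the quotient
  \<open>PSL\<^sub>2(\<real>)\<close> preserving such a line.

  Continuous homomorphisms of Lie groups are smooth, and injective ones are immersions, so a
  Lie group embedding is a homomorphism that is a homeomorphism onto its image.
\<close>

definition SL2R :: "(real^2^2) monoid" where
  "SL2R = \<lparr>carrier = {A. det A = 1}, monoid.mult = (**), one = mat 1\<rparr>"

definition Lie_group_embedding :: "(real^2^2 \<Rightarrow> (complex^3^3) set) \<Rightarrow> bool" where
  "Lie_group_embedding \<phi> \<longleftrightarrow>
     \<phi> \<in> hom SL2R PSU_h \<and> embedding_map (top_of_set (carrier SL2R)) PSU_h_topology \<phi>"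

definition C_Fuchsian :: "complex set \<Rightarrow> (complex^3^3) set set \<Rightarrow> bool" where
  "C_Fuchsian K \<Gamma> \<longleftrightarrow>
     (\<exists>\<phi> L. Lie_group_embedding \<phi> \<and> projective_line L \<and> L \<inter> H2C \<noteq> {} \<and>
            (\<forall>g \<in> \<phi> ` carrier SL2R. act g ` L = L) \<and>
            \<Gamma> = Picard K \<inter> \<phi> ` carrier SL2R)"

definition nonelementary_C_Fuchsian :: "complex set \<Rightarrow> (complex^3^3) set set \<Rightarrow> bool" where
  "nonelementary_C_Fuchsian K \<Gamma> \<longleftrightarrow> C_Fuchsian K \<Gamma> \<and> \<not> virtually_cyclic PSU_h \<Gamma>"

definition maximal_nonelementary_C_Fuchsian ::
    "complex set \<Rightarrow> (complex^3^3) set set \<Rightarrow> bool" where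
  "maximal_nonelementary_C_Fuchsian K \<Gamma> \<longleftrightarrow>
     nonelementary_C_Fuchsian K \<Gamma> \<and>
     (\<forall>\<Gamma>'. nonelementary_C_Fuchsian K \<Gamma>' \<and> \<Gamma> \<subseteq> \<Gamma>' \<longrightarrow> \<Gamma>' = \<Gamma>)"

text \<open>
  The discriminant, as a relation: \<open>z\<close> is a relatively prime integral representative of the
  unique fixed point in the projective plane over \<open>K\<close>. When \<open>K\<close> has class number one, \<open>z\<close> is
  unique up to units and the relation is single-valued. In general every point has such a
  representative, but representatives of one point may differ by more than a unit.
\<close>

definition has_discriminant :: "complex set \<Rightarrow> (complex^3^3) set set \<Rightarrow> nat \<Rightarrow> bool" where
  "has_discriminant K \<Gamma> D \<longleftrightarrow>
     (\<exists>z. (\<forall>i. z $ i \<in> ring_of_integers K) \<and> relatively_prime K z \<and>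
          {p \<in> P2 K. \<forall>g\<in>\<Gamma>. act g p = p} = {proj z} \<and> herm z = real D)"

definition max_C_Fuchsian_of_discriminant ::
    "complex set \<Rightarrow> nat \<Rightarrow> (complex^3^3) set set set" where
  "max_C_Fuchsian_of_discriminant K D =
     {\<Gamma>. maximal_nonelementary_C_Fuchsian K \<Gamma> \<and> has_discriminant K \<Gamma> D}"

definition Picard_conjugacy :: "complex set \<Rightarrow> (complex^3^3) set set rel" where
  "Picard_conjugacy K = {(\<Gamma>, \<Gamma>'). \<exists>g \<in> Picard K. \<Gamma>' = conjugate PSU_h g \<Gamma>}"


section \<open>Well-formedness of the groups and of the topology\<close>

lemma matrix_inv_det_1:
  fixes A :: "'a::field^'n^'n"
  assumes "det A = 1"
  shows "matrix_inv A ** A = mat 1" "A ** matrix_inv A = mat 1" "det (matrix_inv A) = 1"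
proof -
  have "invertible A" using assms by (simp add: invertible_det_nz)
  then have "A ** matrix_inv A = mat 1 \<and> matrix_inv A ** A = mat 1"
    unfolding invertible_def matrix_inv_def by (rule someI_ex)
  then show 1: "matrix_inv A ** A = mat 1" and "A ** matrix_inv A = mat 1"
    by simp_all
  have "det (matrix_inv A) * det A = 1"
    by (metis 1 det_I det_mul)
  then show "det (matrix_inv A) = 1" using assms by simp
qed

lemma group_SL2R: "group SL2R"
proof (rule groupI)
  fix A assume "A \<in> carrier SL2R"
  then show "\<exists>B\<in>carrier SL2R. B \<otimes>\<^bsub>SL2R\<^esub> A = \<one>\<^bsub>SL2R\<^esub>"
    using matrix_inv_det_1[of A] by (auto simp: SL2R_def)
qed (auto simp: SL2R_def det_mul matrix_mul_assoc)

lemma group_SU_h: "group SU_h"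
proof (rule groupI)
  fix A assume A: "A \<in> carrier SU_h"
  then have d: "det A = 1" and p: "\<And>z. herm (A *v z) = herm z" by (auto simp: SU_h_def)
  have "herm (matrix_inv A *v z) = herm z" for z
    using p[of "matrix_inv A *v z"] matrix_inv_det_1(2)[OF d]
    by (simp add: matrix_vector_mul_assoc)
  then have "matrix_inv A \<in> carrier SU_h"
    using matrix_inv_det_1[OF d] by (simp add: SU_h_def)
  then show "\<exists>B\<in>carrier SU_h. B \<otimes>\<^bsub>SU_h\<^esub> A = \<one>\<^bsub>SU_h\<^esub>"
    using matrix_inv_det_1(1)[OF d] by (auto simp: SU_h_def)
qed (auto simp: SU_h_def det_mul matrix_mul_assoc simp flip: matrix_vector_mul_assoc)

lemma mat_mult_vec: "mat c *v (v::complex^3) = c *s v"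
  by (simp add: vec_eq_iff matrix_vector_mult_def mat_def if_distrib[of "\<lambda>x. x * _"] cong: if_cong)

lemma mat_mult_mat: "mat c ** (mat d :: complex^3^3) = mat (c * d)"
  by (simp add: vec_eq_iff matrix_matrix_mult_def mat_def if_distrib[of "\<lambda>x. x * _"] cong: if_cong)

lemma mat_commute: "mat c ** (A :: complex^3^3) = A ** mat c"
  by (simp add: vec_eq_iff matrix_matrix_mult_def mat_def if_distrib[of "\<lambda>x. x * _"]
      if_distrib[of "\<lambda>x. _ * x"] mult.commute cong: if_cong)

lemma herm_scale: "herm (c *s z) = (cmod c)\<^sup>2 * herm z"
  unfolding herm_def cmod_power2 by (simp add: power2_eq_square algebra_simps)

lemma U3_subset: "U3 \<subseteq> carrier SU_h"
proof
  fix A assume "A \<in> U3"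
  then obtain w where w: "A = mat w" "w ^ 3 = 1" by (auto simp: U3_def)
  have "cmod w ^ 3 = 1" using w(2) by (metis norm_one norm_power)
  then have "cmod w = 1"
    using power_eq_imp_eq_base[of "cmod w" 3 1] by simp
  moreover have "det A = 1"
    using w by (simp add: det_3 mat_def power3_eq_cube)
  ultimately show "A \<in> carrier SU_h"
    by (simp add: SU_h_def w(1) mat_mult_vec herm_scale)
qed

lemma U3_normal: "U3 \<lhd> SU_h"
proof -
  interpret group SU_h by (rule group_SU_h)
  have one: "\<one>\<^bsub>SU_h\<^esub> \<in> U3" by (auto simp: U3_def SU_h_def intro: exI[of _ 1])
  have sg: "subgroup U3 SU_h"
  proof (rule subgroupI)
    show "U3 \<noteq> {}" using one by auto
    show "a \<otimes>\<^bsub>SU_h\<^esub> b \<in> U3" if "a \<in> U3" "b \<in> U3" for a b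
      using that by (fastforce simp: U3_def SU_h_def mat_mult_mat power_mult_distrib)
    fix a assume a: "a \<in> U3"
    then obtain w where w: "a = mat w" "w ^ 3 = 1" by (auto simp: U3_def)
    then have "mat (w ^ 2) \<in> U3" by (auto simp: U3_def simp flip: power_mult)
         (metis (no_types) mult.commute power_mult power_one w(2))
    moreover have "mat (w ^ 2) \<otimes>\<^bsub>SU_h\<^esub> a = \<one>\<^bsub>SU_h\<^esub>"
      using w by (simp add: SU_h_def mat_mult_mat power2_eq_square power3_eq_cube)
    ultimately show "inv\<^bsub>SU_h\<^esub> a \<in> U3"
      using a U3_subset inv_equality[of "mat (w ^ 2)" a] by (simp add: subset_iff)
  qed (rule U3_subset)
  show ?thesis
  proof (rule normalI[OF sg], rule ballI)
    fix A assume "A \<in> carrier SU_h"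
    show "U3 #>\<^bsub>SU_h\<^esub> A = A <#\<^bsub>SU_h\<^esub> U3"
      unfolding r_coset_def l_coset_def by (auto simp: SU_h_def U3_def mat_commute)
  qed
qed

lemma group_PSU_h: "group PSU_h"
  unfolding PSU_h_def by (rule normal.factorgroup_is_group[OF U3_normal])

lemma openin_PSU_h_topology:
  "openin PSU_h_topology U \<longleftrightarrow>
     U \<subseteq> carrier PSU_h \<and> openin (top_of_set (carrier SU_h)) (\<Union>U)"
proof -
  interpret normal U3 SU_h by (rule U3_normal)
  have "istopology (\<lambda>U. U \<subseteq> carrier PSU_h \<and> openin (top_of_set (carrier SU_h)) (\<Union>U))"
    unfolding istopology_def
  proof (intro conjI allI impI)
    fix S T
    assume S: "S \<subseteq> carrier PSU_h \<and> openin (top_of_set (carrier SU_h)) (\<Union>S)"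
      and T: "T \<subseteq> carrier PSU_h \<and> openin (top_of_set (carrier SU_h)) (\<Union>T)"
    show "S \<inter> T \<subseteq> carrier PSU_h" using S by blast
    have "\<Union>(S \<inter> T) = \<Union>S \<inter> \<Union>T"
    proof
      show "\<Union>S \<inter> \<Union>T \<subseteq> \<Union>(S \<inter> T)"
      proof
        fix x assume "x \<in> \<Union>S \<inter> \<Union>T"
        then obtain X Y where XY: "X \<in> S" "Y \<in> T" "x \<in> X" "x \<in> Y" by blast
        then have "X \<in> rcosets\<^bsub>SU_h\<^esub> U3" "Y \<in> rcosets\<^bsub>SU_h\<^esub> U3"
          using S T by (auto simp: PSU_h_def FactGroup_def)
        then have "X = Y"
          using XY rcos_disjoint[OF is_subgroup] by (auto simp: pairwise_def disjnt_def)
        then show "x \<in> \<Union>(S \<inter> T)" using XY by blast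
      qed
    qed blast
    then show "openin (top_of_set (carrier SU_h)) (\<Union>(S \<inter> T))"
      using S T by (metis openin_Int)
  next
    fix F assume F: "\<forall>S\<in>F. S \<subseteq> carrier PSU_h \<and> openin (top_of_set (carrier SU_h)) (\<Union>S)"
    show "\<Union>F \<subseteq> carrier PSU_h" using F by blast
    have "\<Union>(\<Union>F) = \<Union>(Union ` F)" by blast
    then show "openin (top_of_set (carrier SU_h)) (\<Union>(\<Union>F))"
      using F by (metis (mono_tags, lifting) imageE openin_Union)
  qed
  then show ?thesis by (simp add: PSU_h_topology_def topology_inverse')
qed

end

theory Submission
  imports Defs "HOL-Analysis.Kronecker_Approximation_Theorem"
begin

text \<open>
  A homomorphic image of \<open>SL\<^sub>2(\<real>)\<close> preserving a complex geodesic fixes the positive vector \<open>v\<close> polar to it: the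
  cube of the eigenvalue on \<open>v\<close> is a character of a perfect group. Conversely the group of all elements fixing
  \<open>v\<close> is such an image. Hence the maximal subgroups of discriminant \<open>D\<close> are the stabilizers in the Picard modular
  group of integral vectors \<open>z\<close> of norm \<open>D\<close>.

  Commensurability: a quasi-reflection with entries in \<open>K\<close> maps \<open>2 z\<close> to \<open>\<plusminus> (- 2 D, 0, 1)\<close>, and
  conjugation by it preserves integrality on a congruence subgroup.

  Nonemptiness: solutions of a Pell equation give two hyperbolic elements of the stabilizer of \<open>z\<close> whose powers do
  not commute and whose only common fixed point is \<open>z\<close>.

  Finiteness: an integral \<open>z\<close> of norm \<open>D\<close> is completed by an orthogonal integral \<open>x\<close> of bounded nonzero norm and
  by their cross product to a frame, and there are finitely many such frames up to integral isometries.
\<close>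


section \<open>Relations with finitely many classes\<close>

text \<open>The relation need not be an equivalence: it only has to hold between elements with the same label.\<close>

definition finitely_many_classes :: "'a set \<Rightarrow> ('a \<Rightarrow> 'a \<Rightarrow> bool) \<Rightarrow> bool" where
  "finitely_many_classes S R \<longleftrightarrow>
     (\<exists>f :: 'a \<Rightarrow> nat. finite (f ` S) \<and> (\<forall>x\<in>S. \<forall>y\<in>S. f x = f y \<longrightarrow> R x y))"

lemma finitely_many_classesI:
  fixes f :: "'a \<Rightarrow> 'b"
  assumes "finite (f ` S)" "\<And>x y. x \<in> S \<Longrightarrow> y \<in> S \<Longrightarrow> f x = f y \<Longrightarrow> R x y"
  shows "finitely_many_classes S R"
proof -
  obtain g :: "'b \<Rightarrow> nat" where "inj_on g (f ` S)"
    using finite_imp_inj_to_nat_seg[OF assms(1)] by metis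
  then have "\<forall>x\<in>S. \<forall>y\<in>S. (g \<circ> f) x = (g \<circ> f) y \<longrightarrow> R x y"
    using assms(2) by (auto simp: inj_on_def)
  moreover have "finite ((g \<circ> f) ` S)"
    using assms(1) by (metis finite_imageI image_comp)
  ultimately show ?thesis unfolding finitely_many_classes_def by blast
qed

lemma finitely_many_classesE:
  assumes "finitely_many_classes S R"
  obtains f :: "'a \<Rightarrow> nat" where "finite (f ` S)" "\<And>x y. x \<in> S \<Longrightarrow> y \<in> S \<Longrightarrow> f x = f y \<Longrightarrow> R x y"
  using assms unfolding finitely_many_classes_def by blast

lemma finitely_many_classes_map:
  assumes "finitely_many_classes T Q" "\<And>x. x \<in> S \<Longrightarrow> f x \<in> T"
    and "\<And>x y. x \<in> S \<Longrightarrow> y \<in> S \<Longrightarrow> Q (f x) (f y) \<Longrightarrow> R x y"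
  shows "finitely_many_classes S R"
proof -
  obtain l :: "_ \<Rightarrow> nat" where l: "finite (l ` T)" "\<And>x y. x \<in> T \<Longrightarrow> y \<in> T \<Longrightarrow> l x = l y \<Longrightarrow> Q x y"
    using finitely_many_classesE[OF assms(1)] by blast
  have "finite ((l \<circ> f) ` S)"
    using l(1) assms(2) by (auto intro: finite_subset[of _ "l ` T"])
  then show ?thesis
    using l(2) assms(2,3) by (auto intro: finitely_many_classesI)
qed

lemma finitely_many_classes_image:
  assumes "finitely_many_classes S (\<lambda>x y. R (h x) (h y))"
  shows "finitely_many_classes (h ` S) R"
  using assms by (rule finitely_many_classes_map[where f = "inv_into S h"])
    (auto simp: inv_into_into f_inv_into_f)

lemma finitely_many_classes_conj:
  assumes "finitely_many_classes S R" "finitely_many_classes S Q"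
  shows "finitely_many_classes S (\<lambda>x y. R x y \<and> Q x y)"
proof -
  obtain l :: "_ \<Rightarrow> nat" where l: "finite (l ` S)" "\<And>x y. x \<in> S \<Longrightarrow> y \<in> S \<Longrightarrow> l x = l y \<Longrightarrow> R x y"
    using finitely_many_classesE[OF assms(1)] by blast
  obtain m :: "_ \<Rightarrow> nat" where m: "finite (m ` S)" "\<And>x y. x \<in> S \<Longrightarrow> y \<in> S \<Longrightarrow> m x = m y \<Longrightarrow> Q x y"
    using finitely_many_classesE[OF assms(2)] by blast
  have "finite ((\<lambda>x. (l x, m x)) ` S)"
    using l(1) m(1) by (auto intro: finite_subset[of _ "l ` S \<times> m ` S"])
  then show ?thesis
    using l(2) m(2) by (auto intro: finitely_many_classesI)
qed

lemma finitely_many_classes_mono: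
  assumes "finitely_many_classes S Q" "\<And>x y. x \<in> S \<Longrightarrow> y \<in> S \<Longrightarrow> Q x y \<Longrightarrow> R x y"
  shows "finitely_many_classes S R"
  by (rule finitely_many_classes_map[OF assms(1), where f = "\<lambda>x. x"]) (use assms(2) in auto)

lemma finite_image_iff_finitely_many_classes:
  "finite (f ` S) \<longleftrightarrow> finitely_many_classes S (\<lambda>x y. f x = f y)"
proof
  assume "finite (f ` S)"
  then show "finitely_many_classes S (\<lambda>x y. f x = f y)" by (rule finitely_many_classesI)
next
  assume "finitely_many_classes S (\<lambda>x y. f x = f y)"
  then obtain l :: "_ \<Rightarrow> nat" where l: "finite (l ` S)" "\<And>x y. x \<in> S \<Longrightarrow> y \<in> S \<Longrightarrow> l x = l y \<Longrightarrow> f x = f y"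
    using finitely_many_classesE by blast
  have "f x = f (inv_into S l (l x))" if "x \<in> S" for x
    using that by (intro l(2)) (auto simp: inv_into_into f_inv_into_f)
  then have "f ` S \<subseteq> (f \<circ> inv_into S l) ` l ` S" by (auto simp: image_iff)
  then show "finite (f ` S)" using l(1) by (meson finite_imageI finite_subset)
qed


section \<open>Vectors and matrices with entries in a set\<close>

definition vecs_over :: "'a set \<Rightarrow> ('a^'n) set" where
  "vecs_over S = {v. \<forall>i. v $ i \<in> S}"

definition mats_over :: "'a set \<Rightarrow> ('a^'n^'m) set" where
  "mats_over S = vecs_over (vecs_over S)"

lemma mem_mats_over: "A \<in> mats_over S \<longleftrightarrow> (\<forall>i j. A $ i $ j \<in> S)"
  by (simp add: mats_over_def vecs_over_def)

lemma finite_vecs_over: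
  assumes "finite S" shows "finite (vecs_over S :: ('a^'n) set)"
proof -
  have "vec_nth ` (vecs_over S :: ('a^'n) set) \<subseteq> UNIV \<rightarrow>\<^sub>E S"
    by (auto simp: vecs_over_def)
  moreover have "finite (UNIV \<rightarrow>\<^sub>E S :: ('n \<Rightarrow> 'a) set)"
    using assms by (intro finite_PiE) auto
  ultimately have "finite (vec_nth ` (vecs_over S :: ('a^'n) set))" by (rule finite_subset)
  then show ?thesis by (rule finite_imageD) (simp add: inj_on_def vec_nth_inject)
qed

lemma finite_mats_over: "finite S \<Longrightarrow> finite (mats_over S :: ('a^'n^'m) set)"
  unfolding mats_over_def by (intro finite_vecs_over)

lemma finitely_many_classes_vecs_over:
  assumes "finitely_many_classes S R"
  shows "finitely_many_classes (vecs_over S :: ('a^'n) set) (\<lambda>v w. \<forall>i. R (v $ i) (w $ i))"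
proof -
  obtain l :: "_ \<Rightarrow> nat" where l: "finite (l ` S)" "\<And>x y. x \<in> S \<Longrightarrow> y \<in> S \<Longrightarrow> l x = l y \<Longrightarrow> R x y"
    using finitely_many_classesE[OF assms] by blast
  show ?thesis
  proof (rule finitely_many_classesI[where f = "\<lambda>v. \<chi> i. l (v $ i)"])
    have "(\<lambda>v. \<chi> i. l (v $ i)) ` vecs_over S \<subseteq> (vecs_over (l ` S) :: (nat^'n) set)"
      by (auto simp: vecs_over_def)
    then show "finite ((\<lambda>v. \<chi> i. l (v $ i)) ` (vecs_over S :: ('a^'n) set) :: (nat^'n) set)"
      using finite_vecs_over[OF l(1)] by (rule finite_subset)
  qed (use l(2) in \<open>auto simp: vecs_over_def vec_eq_iff\<close>)
qed

lemma finitely_many_classes_mats_over: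
  assumes "finitely_many_classes S R"
  shows "finitely_many_classes (mats_over S :: ('a^'n^'m) set)
    (\<lambda>A B. \<forall>i j. R (A $ i $ j) (B $ i $ j))"
  unfolding mats_over_def
  using finitely_many_classes_vecs_over[OF finitely_many_classes_vecs_over[OF assms]] .


section \<open>Finite index, virtually cyclic subgroups and conjugation\<close>

context group
begin

lemma rcoset_eq_iff:
  assumes "subgroup H G" "x \<in> carrier G" "y \<in> carrier G"
  shows "H #> x = H #> y \<longleftrightarrow> x \<otimes> inv y \<in> H"
proof -
  have "H #> x = H #> y \<longleftrightarrow> x \<in> H #> y"
    using rcos_self[OF assms(2,1)] repr_independence[OF _ assms(3,1)] by auto
  then show ?thesis using subgroup.rcos_module[OF assms(1) is_group assms(3,2)] by simp
qed

lemma finite_index_iff_finitely_many_classes: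
  assumes H: "subgroup H G" and A: "subgroup A G" and HA: "H \<subseteq> A"
  shows "finite_index G H A \<longleftrightarrow> finitely_many_classes A (\<lambda>x y. x \<otimes> inv y \<in> H)"
proof -
  have "rcosets\<^bsub>G\<lparr>carrier := A\<rparr>\<^esub> H = (\<lambda>x. H #> x) ` A"
    by (auto simp: RCOSETS_def r_coset_def)
  then have "finite_index G H A \<longleftrightarrow> finite ((\<lambda>x. H #> x) ` A)"
    using subgroup_incl[OF H A HA] by (simp add: finite_index_def)
  also have "\<dots> \<longleftrightarrow> finitely_many_classes A (\<lambda>x y. H #> x = H #> y)"
    by (rule finite_image_iff_finitely_many_classes)
  also have "\<dots> \<longleftrightarrow> finitely_many_classes A (\<lambda>x y. x \<otimes> inv y \<in> H)"
    by (intro iffI; erule finitely_many_classes_mono)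
       (simp_all add: rcoset_eq_iff[OF H] subgroup.mem_carrier[OF A])
  finally show ?thesis .
qed

lemma finite_index_Int_subgroup:
  assumes "finite_index G H A" "subgroup H G" "subgroup A G" "H \<subseteq> A" "subgroup B G"
  shows "finite_index G (H \<inter> B) (A \<inter> B)"
proof -
  have "finitely_many_classes A (\<lambda>x y. x \<otimes> inv y \<in> H)"
    using assms by (simp add: finite_index_iff_finitely_many_classes)
  then have "finitely_many_classes (A \<inter> B) (\<lambda>x y. x \<otimes> inv y \<in> H \<inter> B)"
    by (rule finitely_many_classes_map[where f = "\<lambda>x. x"])
       (use assms(5) in \<open>auto simp: subgroup.m_closed subgroup.m_inv_closed\<close>)
  moreover have "subgroup (H \<inter> B) G" "subgroup (A \<inter> B) G"
    using assms by (auto intro: subgroups_Inter_pair)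
  ultimately show ?thesis
    using assms(4) by (subst finite_index_iff_finitely_many_classes) auto
qed

lemma generate_singleton_subgroup: "a \<in> carrier G \<Longrightarrow> subgroup (generate G {a}) G"
  by (rule generate_is_subgroup) simp

lemma generate_singleton_subset: "subgroup A G \<Longrightarrow> a \<in> A \<Longrightarrow> generate G {a} \<subseteq> A"
  by (rule generate_subgroup_incl) auto

lemma virtually_cyclic_finite:
  assumes A: "subgroup A G" and "finite A"
  shows "virtually_cyclic G A"
proof -
  have one: "\<one> \<in> A" using A by (rule subgroup.one_closed)
  have "finitely_many_classes A (\<lambda>x y. x \<otimes> inv y \<in> generate G {\<one>})"
  proof (rule finitely_many_classesI[where f = "\<lambda>x. x"])
    fix x y assume "x \<in> A" "x = y"
    then have "x \<otimes> inv y = \<one>" using subgroup.mem_carrier[OF A] by simp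
    then show "x \<otimes> inv y \<in> generate G {\<one>}" by (simp add: generate.one)
  qed (use \<open>finite A\<close> in simp)
  then have "finite_index G (generate G {\<one>}) A"
    using finite_index_iff_finitely_many_classes[OF generate_singleton_subgroup[OF one_closed] A
        generate_singleton_subset[OF A one]] by blast
  then show ?thesis using one unfolding virtually_cyclic_def by blast
qed

lemma subgroup_of_cyclic_eq_generate_least_power:
  assumes c: "c \<in> carrier G" and H: "subgroup H G" "H \<subseteq> generate G {c}"
    and n: "n > 0" "c [^] (n::nat) \<in> H" and least: "\<And>m::nat. 0 < m \<Longrightarrow> c [^] m \<in> H \<Longrightarrow> n \<le> m"
  shows "H = generate G {c [^] n}"
proof
  let ?a = "c [^] n"
  have a: "?a \<in> carrier G" using c by simp
  show "generate G {?a} \<subseteq> H" using H(1) n(2) by (rule generate_singleton_subset)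
  show "H \<subseteq> generate G {?a}"
  proof
    fix x assume x: "x \<in> H"
    then obtain k :: int where k: "x = c [^] k" using H(2) generate_pow[OF c] by auto
    define r where "r = nat (k mod int n)"
    have r: "int r = k mod int n" "r < n" using n(1) by (auto simp: r_def nat_less_iff)
    have "k = int r + int n * (k div int n)" by (simp add: r)
    then have division: "x = c [^] r \<otimes> ?a [^] (k div int n)"
      using c k by (metis int_pow_int int_pow_mult int_pow_pow)
    have pow: "?a [^] (k div int n) \<in> H"
      using H(1) n(2) by (rule subgroup_int_pow_closed)
    have "c [^] r = x \<otimes> inv (?a [^] (k div int n))"
      using division c a by (simp add: m_assoc)
    then have "c [^] r \<in> H" using x pow H(1) by (simp add: subgroup.m_closed subgroup.m_inv_closed)
    then have "r = 0" using least[of r] r(2) by fastforce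
    then show "x \<in> generate G {?a}" using division a generate_pow[OF a] by auto
  qed
qed

lemma cyclic_subgroup:
  assumes c: "c \<in> carrier G" and H: "subgroup H G" "H \<subseteq> generate G {c}"
  obtains a where "a \<in> H" "H = generate G {a}"
proof (cases "H = {\<one>}")
  case True
  then show ?thesis using that[of \<one>] generate_one by auto
next
  case False
  then obtain x where x: "x \<in> H" "x \<noteq> \<one>" using subgroup.one_closed[OF H(1)] by blast
  then obtain k :: int where "x = c [^] k" using H(2) generate_pow[OF c] by auto
  then have k: "c [^] k \<in> H" "k \<noteq> 0" using x by auto
  then have "c [^] \<bar>k\<bar> \<in> H"
    using subgroup.m_inv_closed[OF H(1)] c by (auto simp: abs_if int_pow_neg)
  then have "\<exists>n::nat. n > 0 \<and> c [^] n \<in> H"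
    using k(2) int_pow_int[of G c "nat \<bar>k\<bar>"] by (intro exI[of _ "nat \<bar>k\<bar>"]) simp
  then obtain n :: nat where n: "n > 0" "c [^] n \<in> H" and least: "\<And>m. 0 < m \<Longrightarrow> c [^] m \<in> H \<Longrightarrow> n \<le> m"
    using ex_has_least_nat[of "\<lambda>n. n > 0 \<and> c [^] n \<in> H" _ "\<lambda>n. n"] by metis
  then show ?thesis
    using that[OF n(2) subgroup_of_cyclic_eq_generate_least_power[OF c H n least]] by simp
qed

lemma virtually_cyclicE:
  assumes "virtually_cyclic G A" "subgroup A G"
  obtains c where "c \<in> A" "c \<in> carrier G" "finite_index G (generate G {c}) A"
  using assms that by (auto simp: virtually_cyclic_def dest: subgroup.mem_carrier)

lemma virtually_cyclic_subgroup:
  assumes "virtually_cyclic G B" and B: "subgroup B G" and A: "subgroup A G" and "A \<subseteq> B"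
  shows "virtually_cyclic G A"
proof -
  obtain c where c: "c \<in> B" "c \<in> carrier G" "finite_index G (generate G {c}) B"
    using assms(1) B by (rule virtually_cyclicE)
  note C = generate_singleton_subgroup[OF c(2)] generate_singleton_subset[OF B c(1)]
  have fi: "finite_index G (generate G {c} \<inter> A) A"
    using finite_index_Int_subgroup[OF c(3) C(1) B C(2) A] \<open>A \<subseteq> B\<close> by (simp add: Int_absorb1)
  obtain a where "a \<in> generate G {c} \<inter> A" "generate G {c} \<inter> A = generate G {a}"
    using cyclic_subgroup[OF c(2) subgroups_Inter_pair[OF C(1) A]] by blast
  then show ?thesis using fi unfolding virtually_cyclic_def by auto
qed

lemma finite_index_power_mem:
  assumes "finite_index G H A" "subgroup H G" "subgroup A G" "H \<subseteq> A" "x \<in> A"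
  obtains m :: nat where "m > 0" "x [^] m \<in> H"
proof -
  have x: "x \<in> carrier G" "\<And>i::nat. x [^] i \<in> A"
    using assms(3,5) subgroup_int_pow_closed[of A x "int _"] by (auto simp: subgroup.mem_carrier int_pow_int)
  obtain f :: "'a \<Rightarrow> nat" where f: "finite (f ` A)" "\<And>x y. x \<in> A \<Longrightarrow> y \<in> A \<Longrightarrow> f x = f y \<Longrightarrow> x \<otimes> inv y \<in> H"
    using assms by (auto simp: finite_index_iff_finitely_many_classes elim: finitely_many_classesE)
  have "finite (range (\<lambda>i::nat. f (x [^] i)))"
    using f(1) x(2) by (auto intro: finite_subset[of _ "f ` A"])
  then have "\<not> inj (\<lambda>i::nat. f (x [^] i))" using finite_imageD by blast
  then obtain i j :: nat where ij: "i < j" "f (x [^] j) = f (x [^] i)"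
    by (metis injI nat_neq_iff)
  then have "x [^] j \<otimes> inv (x [^] i) \<in> H" using f(2) x(2) by blast
  moreover have "x [^] j = x [^] (j - i) \<otimes> x [^] i" using ij(1) x(1) by (simp add: nat_pow_mult)
  ultimately have "x [^] (j - i) \<in> H" using x(1) by (simp add: m_assoc)
  then show ?thesis using that[of "j - i"] ij(1) by simp
qed

lemma virtually_cyclic_powers_commute:
  assumes "virtually_cyclic G A" and A: "subgroup A G" and "x \<in> A" "y \<in> A"
  obtains m n :: nat where "m > 0" "n > 0" "x [^] m \<otimes> y [^] n = y [^] n \<otimes> x [^] m"
proof -
  obtain c where c: "c \<in> A" "c \<in> carrier G" "finite_index G (generate G {c}) A"
    using assms(1) A by (rule virtually_cyclicE)
  note power_mem = finite_index_power_mem[OF c(3) generate_singleton_subgroup[OF c(2)] A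
      generate_singleton_subset[OF A c(1)]]
  obtain m :: nat where m: "m > 0" "x [^] m \<in> generate G {c}" using power_mem[OF \<open>x \<in> A\<close>] .
  obtain n :: nat where n: "n > 0" "y [^] n \<in> generate G {c}" using power_mem[OF \<open>y \<in> A\<close>] .
  obtain k l :: int where "x [^] m = c [^] k" "y [^] n = c [^] l"
    using m(2) n(2) generate_pow[OF c(2)] by auto
  then have "x [^] m \<otimes> y [^] n = y [^] n \<otimes> x [^] m" using c(2) by (metis int_pow_mult add.commute)
  then show ?thesis using that m(1) n(1) by blast
qed

lemma mem_conjugate_iff:
  assumes "A \<subseteq> carrier G" "g \<in> carrier G" "x \<in> carrier G"
  shows "x \<in> conjugate G g A \<longleftrightarrow> inv g \<otimes> x \<otimes> g \<in> A"
proof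
  assume "x \<in> conjugate G g A"
  then obtain a where a: "a \<in> A" "x = g \<otimes> a \<otimes> inv g" by (auto simp: conjugate_def)
  then have "a \<in> carrier G" using assms(1) by blast
  then have "inv g \<otimes> x \<otimes> g = (inv g \<otimes> g) \<otimes> a \<otimes> (inv g \<otimes> g)"
    using assms(2) unfolding a(2) by (simp only: m_assoc m_closed inv_closed)
  then show "inv g \<otimes> x \<otimes> g \<in> A" using assms(2) a(1) \<open>a \<in> carrier G\<close> by simp
next
  assume mem: "inv g \<otimes> x \<otimes> g \<in> A"
  have "x = (g \<otimes> inv g) \<otimes> x \<otimes> (g \<otimes> inv g)" using assms by simp
  then have "x = g \<otimes> (inv g \<otimes> x \<otimes> g) \<otimes> inv g" using assms(2,3) by (simp only: m_assoc m_closed inv_closed)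
  then show "x \<in> conjugate G g A" using mem unfolding conjugate_def by blast
qed

lemma conjugate_subgroup:
  assumes "subgroup A G" and g: "g \<in> carrier G"
  shows "subgroup (conjugate G g A) G"
proof -
  have "(\<lambda>x. g \<otimes> x \<otimes> inv g) \<in> hom G G"
  proof (rule homI)
    fix x y assume xy: "x \<in> carrier G" "y \<in> carrier G"
    then have "(g \<otimes> x \<otimes> inv g) \<otimes> (g \<otimes> y \<otimes> inv g) = g \<otimes> x \<otimes> (inv g \<otimes> g) \<otimes> (y \<otimes> inv g)"
      using g by (simp only: m_assoc m_closed inv_closed)
    then show "g \<otimes> (x \<otimes> y) \<otimes> inv g = (g \<otimes> x \<otimes> inv g) \<otimes> (g \<otimes> y \<otimes> inv g)"
      using xy g by (simp add: m_assoc)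
  qed (use g in auto)
  then interpret group_hom G G "\<lambda>x. g \<otimes> x \<otimes> inv g" by unfold_locales
  show ?thesis unfolding conjugate_def using assms(1) by (rule subgroup_img_is_subgroup)
qed

lemma conjugate_conjugate:
  assumes "A \<subseteq> carrier G" "g \<in> carrier G" "h \<in> carrier G"
  shows "conjugate G g (conjugate G h A) = conjugate G (g \<otimes> h) A"
  unfolding conjugate_def image_image
proof (rule image_cong)
  fix x assume "x \<in> A"
  then show "g \<otimes> (h \<otimes> x \<otimes> inv h) \<otimes> inv g = g \<otimes> h \<otimes> x \<otimes> inv (g \<otimes> h)"
    using assms by (simp add: subset_iff m_assoc inv_mult_group)
qed simp

lemma conjugate_Int:
  assumes "A \<subseteq> carrier G" "B \<subseteq> carrier G" "g \<in> carrier G"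
  shows "conjugate G g (A \<inter> B) = conjugate G g A \<inter> conjugate G g B"
  unfolding conjugate_def
proof (rule inj_on_image_Int[of _ "carrier G"], rule inj_onI)
  fix x y assume "x \<in> carrier G" "y \<in> carrier G" "g \<otimes> x \<otimes> inv g = g \<otimes> y \<otimes> inv g"
  then show "x = y" using assms(3) by simp
qed (use assms in auto)

end

section \<open>Arithmetic of imaginary quadratic fields\<close>

locale conj_subring =
  fixes R :: "complex set"
  assumes one_closed [simp]: "1 \<in> R"
    and diff_closed [simp, intro]: "x \<in> R \<Longrightarrow> y \<in> R \<Longrightarrow> x - y \<in> R"
    and mult_closed [simp, intro]: "x \<in> R \<Longrightarrow> y \<in> R \<Longrightarrow> x * y \<in> R"
    and cnj_closed [simp, intro]: "x \<in> R \<Longrightarrow> cnj x \<in> R"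
begin

lemma zero_closed [simp]: "0 \<in> R"
  using diff_closed[of 1 1] by simp

lemma minus_closed [simp, intro]: "x \<in> R \<Longrightarrow> - x \<in> R"
  using diff_closed[of 0 x] by simp

lemma minus_closed_iff: "- x \<in> R \<longleftrightarrow> x \<in> R"
  using minus_closed[of x] minus_closed[of "- x"] by auto

lemma add_closed [simp, intro]: "x \<in> R \<Longrightarrow> y \<in> R \<Longrightarrow> x + y \<in> R"
  using diff_closed[of x "- y"] by simp

lemma power_closed [simp, intro]: "x \<in> R \<Longrightarrow> x ^ n \<in> R"
  by (induction n) auto

lemma sum_closed [intro]: "(\<And>i. i \<in> A \<Longrightarrow> f i \<in> R) \<Longrightarrow> sum f A \<in> R"
  by (induction A rule: infinite_finite_induct) auto

lemma of_nat_closed [simp]: "of_nat n \<in> R"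
  by (induction n) auto

lemma of_int_closed [simp]: "of_int n \<in> R"
  by (cases n rule: int_cases2) auto

lemma Ints_closed: "x \<in> \<int> \<Longrightarrow> x \<in> R"
  by (auto elim: Ints_cases)

lemma numeral_closed [simp]: "numeral n \<in> R"
  by (metis of_nat_closed of_nat_numeral)

end

definition adjoin :: "complex set \<Rightarrow> complex \<Rightarrow> complex set" where
  "adjoin R s = {p + q * s | p q. p \<in> R \<and> q \<in> R}"

lemma conj_subring_adjoin:
  assumes "conj_subring R" "s * s \<in> R" "cnj s = - s"
  shows "conj_subring (adjoin R s)"
proof -
  interpret conj_subring R by fact
  show ?thesis
  proof
    show "1 \<in> adjoin R s"
      unfolding adjoin_def by (intro CollectI exI[of _ 1] exI[of _ 0]) simp
    fix x assume "x \<in> adjoin R s"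
    then obtain p q where x: "p \<in> R" "q \<in> R" "x = p + q * s" by (auto simp: adjoin_def)
    have "cnj x = cnj p + - cnj q * s" using assms(3) by (simp add: x(3))
    then show "cnj x \<in> adjoin R s" using x(1,2) unfolding adjoin_def by blast
    fix y assume "y \<in> adjoin R s"
    then obtain p' q' where y: "p' \<in> R" "q' \<in> R" "y = p' + q' * s" by (auto simp: adjoin_def)
    have "x - y = (p - p') + (q - q') * s" by (simp add: x(3) y(3) algebra_simps)
    then show "x - y \<in> adjoin R s" using x(1,2) y(1,2) unfolding adjoin_def by blast
    have "x * y = (p * p' + q * q' * (s * s)) + (p * q' + q * p') * s"
      by (simp add: x(3) y(3) algebra_simps)
    then show "x * y \<in> adjoin R s" using x(1,2) y(1,2) assms(2) unfolding adjoin_def by blast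
  qed
qed

lemma cnj_Rats: "x \<in> \<rat> \<Longrightarrow> cnj x = x"
  by (auto elim!: Rats_cases')

lemma cnj_Ints: "x \<in> \<int> \<Longrightarrow> cnj x = x"
  by (auto elim!: Ints_cases)

lemma conj_subring_Rats: "conj_subring \<rat>"
  by unfold_locales (auto simp: cnj_Rats)

lemma conj_subring_Ints: "conj_subring \<int>"
  by unfold_locales (auto simp: cnj_Ints)

lemma Rats_bounded_denominators_imp_Ints:
  fixes r :: "'a::field_char_0" and c :: nat
  assumes "r \<in> \<rat>" "c > 0" and den: "\<And>k. of_nat c * r ^ k \<in> \<int>"
  shows "r \<in> \<int>"
proof -
  obtain a b where ab: "b > 0" "coprime a b" "r = of_int a / of_int b"
    using assms(1) by (auto elim: Rats_cases')
  have dvd: "b ^ k dvd int c" for k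
  proof -
    obtain m where "of_nat c * r ^ k = of_int m"
      using den[of k] by (auto elim: Ints_cases)
    then have "of_int (int c * a ^ k) = (of_int (m * b ^ k) :: 'a)"
      using ab(1) by (simp add: ab(3) power_divide field_simps)
    then have "int c * a ^ k = m * b ^ k" by (simp only: of_int_eq_iff)
    then have "b ^ k dvd int c * a ^ k" by simp
    moreover have "coprime (b ^ k) (a ^ k)" using ab(2) by (simp add: coprime_commute)
    ultimately show ?thesis by (simp add: coprime_dvd_mult_left_iff)
  qed
  have "b = 1"
  proof (rule ccontr)
    assume "b \<noteq> 1"
    then have "2 ^ c \<le> b ^ c" using ab(1) by (intro power_mono) auto
    also have "\<dots> \<le> int c" using dvd assms(2) by (intro zdvd_imp_le) auto
    finally have "int (2 ^ c) \<le> int c" by simp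
    then show False using less_exp[of c] by linarith
  qed
  then show ?thesis using ab(3) by simp
qed

locale imaginary_quadratic =
  fixes K :: "complex set" and s :: complex and d :: nat
  assumes s_square: "s * s = - of_nat d" and d_pos: "d > 0" and K_eq: "K = adjoin \<rat> s"
begin

lemma Re_s: "Re s = 0" and Im_s: "Im s \<noteq> 0"
proof -
  have sq: "(Re s)\<^sup>2 - (Im s)\<^sup>2 = - real d" "Re s * Im s = 0"
    using s_square by (auto simp: complex_eq_iff power2_eq_square)
  show "Im s \<noteq> 0"
  proof
    assume "Im s = 0"
    then have "(Re s)\<^sup>2 < 0" using sq(1) d_pos by simp
    then show False by (simp add: not_less[symmetric])
  qed
  then show "Re s = 0" using sq(2) by simp
qed

lemma cnj_s: "cnj s = - s"
  by (simp add: complex_eq_iff Re_s)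

lemma s_nonzero: "s \<noteq> 0"
  using Im_s by auto

definition quadratic_order :: "complex set" where
  "quadratic_order = adjoin \<int> s"

sublocale K: conj_subring K
  unfolding K_eq by (rule conj_subring_adjoin[OF conj_subring_Rats]) (auto simp: s_square cnj_s)

sublocale order: conj_subring quadratic_order
  unfolding quadratic_order_def
  by (rule conj_subring_adjoin[OF conj_subring_Ints]) (auto simp: s_square cnj_s)

lemma Rats_subset_K: "\<rat> \<subseteq> K"
proof
  fix x :: complex assume "x \<in> \<rat>"
  then show "x \<in> K" unfolding K_eq adjoin_def by (intro CollectI exI[of _ x] exI[of _ 0]) simp
qed

lemma s_mem_quadratic_order: "s \<in> quadratic_order"
  unfolding quadratic_order_def adjoin_def by (intro CollectI exI[of _ 0] exI[of _ 1]) simp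

lemma quadratic_order_subset_K: "quadratic_order \<subseteq> K"
  using Ints_subset_Rats unfolding quadratic_order_def K_eq adjoin_def by blast

lemma K_trace_norm_Rats:
  assumes "x \<in> K" shows "x + cnj x \<in> \<rat>" "x * cnj x \<in> \<rat>"
proof -
  obtain p q where x: "p \<in> \<rat>" "q \<in> \<rat>" "x = p + q * s" using assms by (auto simp: K_eq adjoin_def)
  have "x + cnj x = p + p" "x * cnj x = p * p - q * q * (s * s)"
    by (simp_all add: x(3) cnj_Rats[OF x(1)] cnj_Rats[OF x(2)] cnj_s algebra_simps)
  then show "x + cnj x \<in> \<rat>" "x * cnj x \<in> \<rat>" using x(1,2) by (simp_all add: s_square)
qed

lemma inverse_mem_K:
  assumes "x \<in> K" shows "inverse x \<in> K"
proof (cases "x = 0")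
  case False
  then have "inverse x = inverse (x * cnj x) * cnj x" by simp
  moreover have "inverse (x * cnj x) \<in> K"
    using K_trace_norm_Rats(2)[OF assms] Rats_inverse Rats_subset_K by blast
  ultimately show ?thesis using assms by (metis K.cnj_closed K.mult_closed)
qed simp

lemma divide_mem_K: "x \<in> K \<Longrightarrow> y \<in> K \<Longrightarrow> x / y \<in> K"
  by (simp add: divide_inverse inverse_mem_K)

lemma denominator_exists:
  assumes "x \<in> K"
  obtains c :: nat where "c > 0" "of_nat c * x \<in> quadratic_order"
proof -
  obtain p q where x: "p \<in> \<rat>" "q \<in> \<rat>" "x = p + q * s" using assms by (auto simp: K_eq adjoin_def)
  obtain a b where p: "b > 0" "p = of_int a / of_int b" using x(1) by (auto elim: Rats_cases')
  obtain a' b' where q: "b' > 0" "q = of_int a' / of_int b'" using x(2) by (auto elim: Rats_cases')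
  have "of_int (b * b') * x = of_int (a * b') + of_int (a' * b) * s"
    using p q by (simp add: x(3) field_simps)
  moreover have "complex_of_int (b * b') = of_nat (nat (b * b'))" using p(1) q(1) by simp
  ultimately have "of_nat (nat (b * b')) * x = of_int (a * b') + of_int (a' * b) * s" by metis
  then have "of_nat (nat (b * b')) * x \<in> quadratic_order"
    unfolding quadratic_order_def adjoin_def using Ints_of_int by blast
  then show ?thesis using that[of "nat (b * b')"] p(1) q(1) by simp
qed

lemma common_denominator_exists:
  assumes "finite F" "F \<subseteq> K"
  shows "\<exists>c::nat. c > 0 \<and> (\<forall>x\<in>F. of_nat c * x \<in> quadratic_order)"
  using assms
proof (induction F rule: finite_induct)
  case empty
  show ?case by (rule exI[of _ 1]) simp
next
  case (insert x F)
  then obtain c :: nat where c: "c > 0" "\<forall>y\<in>F. of_nat c * y \<in> quadratic_order" by auto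
  obtain b :: nat where b: "b > 0" "of_nat b * x \<in> quadratic_order"
    using denominator_exists insert.prems by blast
  have "of_nat (b * c) * x = of_nat c * (of_nat b * x)"
    "of_nat (b * c) * y = of_nat b * (of_nat c * y)" for y :: complex
    by (simp_all add: mult_ac)
  then have "\<forall>y\<in>insert x F. of_nat (b * c) * y \<in> quadratic_order"
    using b(2) c(2) by (metis insert_iff order.mult_closed order.of_nat_closed)
  then show ?case using b(1) c(1) by (intro exI[of _ "b * c"]) simp
qed

text \<open>Almost integrality is visibly stable under sums and products, and this is how the algebraic integers
  of \<open>K\<close> are seen to form a ring.\<close>

definition almost_integral :: "complex \<Rightarrow> bool" where
  "almost_integral x \<longleftrightarrow> (\<exists>c::nat. c > 0 \<and> (\<forall>k. of_nat c * x ^ k \<in> quadratic_order))"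

lemma almost_integralE:
  assumes "almost_integral x"
  obtains c :: nat where "c > 0" "\<And>k. of_nat c * x ^ k \<in> quadratic_order"
  using assms unfolding almost_integral_def by blast

lemma almost_integral_quadratic_order: "x \<in> quadratic_order \<Longrightarrow> almost_integral x"
  unfolding almost_integral_def by (intro exI[of _ 1]) simp

lemma almost_integral_mem_K:
  assumes "almost_integral x" shows "x \<in> K"
proof -
  obtain c :: nat where c: "c > 0" "\<And>k. of_nat c * x ^ k \<in> quadratic_order"
    using almost_integralE[OF assms] by blast
  have "of_nat c * x \<in> K" using c(2)[of 1] quadratic_order_subset_K by auto
  then have "(of_nat c * x) / of_nat c \<in> K" by (intro divide_mem_K K.of_nat_closed)
  then show ?thesis using c(1) by simp
qed

lemma almost_integral_mult:
  assumes "almost_integral x" "almost_integral y" shows "almost_integral (x * y)"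
proof -
  obtain b :: nat where b: "b > 0" "\<And>k. of_nat b * x ^ k \<in> quadratic_order"
    using almost_integralE[OF assms(1)] by blast
  obtain c :: nat where c: "c > 0" "\<And>k. of_nat c * y ^ k \<in> quadratic_order"
    using almost_integralE[OF assms(2)] by blast
  have "of_nat (b * c) * (x * y) ^ k = (of_nat b * x ^ k) * (of_nat c * y ^ k)" for k
    by (simp add: power_mult_distrib)
  then have "of_nat (b * c) * (x * y) ^ k \<in> quadratic_order" for k
    using b(2) c(2) by (metis order.mult_closed)
  then show ?thesis using b(1) c(1) unfolding almost_integral_def by (intro exI[of _ "b * c"]) simp
qed

lemma almost_integral_add:
  assumes "almost_integral x" "almost_integral y" shows "almost_integral (x + y)"
proof -
  obtain b :: nat where b: "b > 0" "\<And>k. of_nat b * x ^ k \<in> quadratic_order"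
    using almost_integralE[OF assms(1)] by blast
  obtain c :: nat where c: "c > 0" "\<And>k. of_nat c * y ^ k \<in> quadratic_order"
    using almost_integralE[OF assms(2)] by blast
  have "of_nat (b * c) * (x + y) ^ k
      = (\<Sum>i\<le>k. of_nat (k choose i) * ((of_nat b * x ^ i) * (of_nat c * y ^ (k - i))))" for k
    unfolding binomial_ring sum_distrib_left by (intro sum.cong) (simp_all add: mult_ac)
  then have "of_nat (b * c) * (x + y) ^ k \<in> quadratic_order" for k
    using b(2) c(2) by (metis (no_types, lifting) order.mult_closed order.of_nat_closed order.sum_closed)
  then show ?thesis using b(1) c(1) unfolding almost_integral_def by (intro exI[of _ "b * c"]) simp
qed

lemma almost_integral_cnj:
  assumes "almost_integral x" shows "almost_integral (cnj x)"
proof -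
  obtain c :: nat where c: "c > 0" "\<And>k. of_nat c * x ^ k \<in> quadratic_order"
    using almost_integralE[OF assms] by blast
  have "of_nat c * cnj x ^ k = cnj (of_nat c * x ^ k)" for k by simp
  then have "of_nat c * cnj x ^ k \<in> quadratic_order" for k using c(2) by (metis order.cnj_closed)
  then show ?thesis using c(1) unfolding almost_integral_def by blast
qed

lemma quadratic_order_Rats_imp_Ints:
  assumes "x \<in> quadratic_order" "x \<in> \<rat>" shows "x \<in> \<int>"
proof -
  obtain i j where x: "i \<in> \<int>" "j \<in> \<int>" "x = i + j * s"
    using assms(1) by (auto simp: quadratic_order_def adjoin_def)
  have "Im x = 0" using cnj_Rats[OF assms(2)] by (simp add: complex_eq_iff)
  moreover have "Im i = 0" "Im j = 0" using x(1,2) by (auto elim!: Ints_cases)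
  ultimately have "j = 0" using Im_s by (simp add: x(3) complex_eq_iff)
  then show ?thesis using x by simp
qed

lemma almost_integral_Rats_imp_Ints:
  assumes "almost_integral x" "x \<in> \<rat>" shows "x \<in> \<int>"
proof -
  obtain c :: nat where c: "c > 0" "\<And>k. of_nat c * x ^ k \<in> quadratic_order"
    using almost_integralE[OF assms(1)] by blast
  show ?thesis
    by (rule Rats_bounded_denominators_imp_Ints[OF assms(2) c(1)])
       (intro quadratic_order_Rats_imp_Ints c(2) Rats_mult Rats_of_nat Rats_power assms(2))
qed

lemma almost_integral_imp_algebraic_int:
  assumes "almost_integral x" shows "algebraic_int x"
proof -
  have K: "x \<in> K" using assms by (rule almost_integral_mem_K)
  have "x + cnj x \<in> \<int>" "x * cnj x \<in> \<int>"
    by (intro almost_integral_Rats_imp_Ints almost_integral_add almost_integral_mult almost_integral_cnj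
        assms K_trace_norm_Rats[OF K])+
  then show ?thesis
    by (intro algebraic_int.intros[of "[:x * cnj x, - (x + cnj x), 1:]"])
       (auto simp: coeff_pCons algebra_simps simp del: minus_add_distrib split: nat.splits intro: Ints_minus)
qed

lemma algebraic_int_imp_almost_integral:
  assumes "x \<in> K" "algebraic_int x" shows "almost_integral x"
proof -
  obtain p where p: "lead_coeff p = 1" "\<And>i. coeff p i \<in> \<int>" "poly p x = 0"
    using assms(2) by (auto simp: algebraic_int.simps)
  let ?n = "degree p"
  have "(\<Sum>i\<le>?n. coeff p i * x ^ i) = 0" using p(3) by (simp add: poly_altdef)
  then have x_power: "x ^ ?n = - (\<Sum>i<?n. coeff p i * x ^ i)"
    using p(1) by (simp add: lessThan_Suc_atMost[symmetric] add_eq_0_iff)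
  obtain c :: nat where c: "c > 0" "\<And>i. i < ?n \<Longrightarrow> of_nat c * x ^ i \<in> quadratic_order"
    using common_denominator_exists[of "(\<lambda>i. x ^ i) ` {..<?n}"] assms(1) by auto
  have "of_nat c * x ^ k \<in> quadratic_order" for k
  proof (induction k rule: less_induct)
    case (less k)
    show ?case
    proof (cases "k < ?n")
      case False
      then have "x ^ k = x ^ ?n * x ^ (k - ?n)" by (metis le_add_diff_inverse not_less power_add)
      then have "of_nat c * x ^ k = - (\<Sum>i<?n. coeff p i * (of_nat c * x ^ (i + (k - ?n))))"
        by (simp add: x_power sum_distrib_left sum_distrib_right power_add mult_ac)
      also have "\<dots> \<in> quadratic_order"
        using False by
          (intro order.minus_closed order.sum_closed order.mult_closed[OF order.Ints_closed[OF p(2)]] less) auto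
      finally show ?thesis .
    qed (rule c(2))
  qed
  then show ?thesis using c(1) unfolding almost_integral_def by blast
qed

abbreviation integers :: "complex set" (\<open>\<O>\<close>) where
  "\<O> \<equiv> ring_of_integers K"

lemma integers_iff_almost_integral: "x \<in> \<O> \<longleftrightarrow> almost_integral x"
  using almost_integral_mem_K almost_integral_imp_algebraic_int algebraic_int_imp_almost_integral
  unfolding ring_of_integers_def by blast

sublocale integers: conj_subring \<O>
proof
  fix x y assume xy: "x \<in> \<O>" "y \<in> \<O>"
  have "almost_integral (- 1)" by (intro almost_integral_quadratic_order order.minus_closed order.one_closed)
  then have "almost_integral (x + (- 1) * y)"
    using xy by (intro almost_integral_add almost_integral_mult) (simp_all add: integers_iff_almost_integral)
  then show "x - y \<in> \<O>" by (simp add: integers_iff_almost_integral)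
qed (auto simp: integers_iff_almost_integral almost_integral_quadratic_order almost_integral_mult
    almost_integral_cnj)

lemma integers_subset_K: "\<O> \<subseteq> K"
  by (auto simp: ring_of_integers_def)

lemma quadratic_order_subset_integers: "quadratic_order \<subseteq> \<O>"
  by (auto simp: integers_iff_almost_integral almost_integral_quadratic_order)

lemma integers_Rats_imp_Ints: "x \<in> \<O> \<Longrightarrow> x \<in> \<rat> \<Longrightarrow> x \<in> \<int>"
  by (simp add: integers_iff_almost_integral almost_integral_Rats_imp_Ints)

lemma s_mem_integers: "s \<in> \<O>"
  using s_mem_quadratic_order quadratic_order_subset_integers by blast

lemma integers_trace_norm_Ints:
  assumes "x \<in> \<O>" shows "x + cnj x \<in> \<int>" "x * cnj x \<in> \<int>"
  using assms integers_subset_K by (auto intro!: integers_Rats_imp_Ints K_trace_norm_Rats)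

lemma integers_norm_nat:
  assumes "x \<in> \<O>" obtains n :: nat where "(cmod x)\<^sup>2 = real n"
proof -
  have "complex_of_real ((cmod x)\<^sup>2) \<in> \<int>"
    using integers_trace_norm_Ints(2)[OF assms] by (simp add: complex_norm_square del: of_real_power)
  then have "(cmod x)\<^sup>2 \<in> \<int>" by (simp only: of_real_in_Ints_iff)
  then have "(cmod x)\<^sup>2 \<in> \<nat>" by (simp add: Nats_altdef2)
  then show ?thesis using that by (auto elim: Nats_cases)
qed

text \<open>The integer \<open>s (x - cnj x)\<close> is rational.\<close>

lemma integers_denominator:
  assumes "x \<in> \<O>" shows "of_nat (2 * d) * x \<in> quadratic_order"
proof -
  obtain p q where x: "p \<in> \<rat>" "q \<in> \<rat>" "x = p + q * s"
    using assms integers_subset_K by (auto simp: K_eq adjoin_def)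
  have "s * (x - cnj x) = 2 * q * (s * s)"
    by (simp add: x(3) cnj_Rats[OF x(1)] cnj_Rats[OF x(2)] cnj_s algebra_simps)
  then have "s * (x - cnj x) \<in> \<rat>" using x(2) by (simp add: s_square)
  then have "s * (x - cnj x) \<in> \<int>"
    using assms s_mem_integers by (intro integers_Rats_imp_Ints) auto
  moreover have "(s * (x - cnj x)) * s = - of_nat d * (x - cnj x)"
    unfolding s_square[symmetric] by simp
  then have "of_nat (2 * d) * x = of_nat d * (x + cnj x) - (s * (x - cnj x)) * s"
    by (simp add: algebra_simps)
  moreover have "x + cnj x \<in> \<int>" by (rule integers_trace_norm_Ints(1)[OF assms])
  ultimately show ?thesis
    using order.Ints_closed s_mem_quadratic_order by (metis order.diff_closed order.mult_closed order.of_nat_closed)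
qed

lemma finite_quadratic_order_disc: "finite {x \<in> quadratic_order. cmod x \<le> r}"
proof -
  define b where "b = r + r / \<bar>Im s\<bar>"
  have "{x \<in> quadratic_order. cmod x \<le> r}
      \<subseteq> (\<lambda>(i, j). of_int i + of_int j * s) ` ({-\<lceil>b\<rceil>..\<lceil>b\<rceil>} \<times> {-\<lceil>b\<rceil>..\<lceil>b\<rceil>})"
  proof
    fix x assume "x \<in> {x \<in> quadratic_order. cmod x \<le> r}"
    then obtain i j where x: "x = of_int i + of_int j * s" "cmod x \<le> r"
      by (auto simp: quadratic_order_def adjoin_def elim!: Ints_cases)
    have r: "0 \<le> r" using x(2) norm_ge_zero order_trans by blast
    have "\<bar>real_of_int i\<bar> \<le> r" using abs_Re_le_cmod[of x] x Re_s by simp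
    moreover have "\<bar>real_of_int j\<bar> * \<bar>Im s\<bar> \<le> r" using abs_Im_le_cmod[of x] x by (simp add: abs_mult)
    then have "\<bar>real_of_int j\<bar> \<le> r / \<bar>Im s\<bar>" using Im_s by (simp add: field_simps)
    ultimately have "\<bar>real_of_int i\<bar> \<le> b" "\<bar>real_of_int j\<bar> \<le> b" using r by (auto simp: b_def)
    then have "i \<in> {-\<lceil>b\<rceil>..\<lceil>b\<rceil>}" "j \<in> {-\<lceil>b\<rceil>..\<lceil>b\<rceil>}" by (auto simp: abs_le_iff) linarith+
    then show "x \<in> (\<lambda>(i, j). of_int i + of_int j * s) ` ({-\<lceil>b\<rceil>..\<lceil>b\<rceil>} \<times> {-\<lceil>b\<rceil>..\<lceil>b\<rceil>})"
      using x(1) by force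
  qed
  then show ?thesis by (rule finite_subset) simp
qed

lemma finite_integers_disc: "finite {x \<in> \<O>. cmod x \<le> r}"
proof (rule finite_imageD)
  have "(\<lambda>x. of_nat (2 * d) * x) ` {x \<in> \<O>. cmod x \<le> r}
      \<subseteq> {x \<in> quadratic_order. cmod x \<le> real (2 * d) * r}"
  proof (rule image_subsetI)
    fix x assume x: "x \<in> {x \<in> \<O>. cmod x \<le> r}"
    then have "cmod (of_nat (2 * d) * x) \<le> real (2 * d) * r"
      unfolding norm_mult norm_of_nat by (intro mult_left_mono) auto
    then show "of_nat (2 * d) * x \<in> {x \<in> quadratic_order. cmod x \<le> real (2 * d) * r}"
      using x integers_denominator by blast
  qed
  then show "finite ((\<lambda>x. of_nat (2 * d) * x) ` {x \<in> \<O>. cmod x \<le> r})"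
    using finite_quadratic_order_disc by (rule finite_subset)
  show "inj_on (\<lambda>x. of_nat (2 * d) * x) {x \<in> \<O>. cmod x \<le> r}"
    using d_pos by (auto simp: inj_on_def)
qed

definition integers_cong :: "nat \<Rightarrow> complex \<Rightarrow> complex \<Rightarrow> bool" where
  "integers_cong m x y \<longleftrightarrow> (\<exists>w\<in>\<O>. x - y = of_nat m * w)"

lemma finitely_many_quadratic_order_residues:
  assumes "m > 0"
  shows "finitely_many_classes quadratic_order (\<lambda>x y. \<exists>w\<in>quadratic_order. x - y = of_nat m * w)"
proof (rule finitely_many_classesI)
  let ?i = "\<lambda>x. \<lfloor>Re x\<rfloor>" and ?j = "\<lambda>x. \<lfloor>Im x / Im s\<rfloor>"
  let ?f = "\<lambda>x. (?i x mod int m, ?j x mod int m)"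
  have coords: "x = of_int (?i x) + of_int (?j x) * s" if "x \<in> quadratic_order" for x
    using that Re_s Im_s by (auto simp: quadratic_order_def adjoin_def elim!: Ints_cases)
  have "?f ` quadratic_order \<subseteq> {0..int m} \<times> {0..int m}" using assms by (auto simp: less_imp_le)
  then show "finite (?f ` quadratic_order)" by (rule finite_subset) simp
  fix x y assume xy: "x \<in> quadratic_order" "y \<in> quadratic_order" and "?f x = ?f y"
  then obtain a b where ab: "?i x - ?i y = int m * a" "?j x - ?j y = int m * b"
    by (auto simp: mod_eq_dvd_iff dvd_def)
  have "x - y = of_int (?i x - ?i y) + of_int (?j x - ?j y) * s"
    using coords[OF xy(1)] coords[OF xy(2)] by (simp add: algebra_simps)
  also have "\<dots> = of_nat m * (of_int a + of_int b * s)" unfolding ab by (simp add: algebra_simps)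
  finally have "x - y = of_nat m * (of_int a + of_int b * s)" .
  then show "\<exists>w\<in>quadratic_order. x - y = of_nat m * w"
    using s_mem_quadratic_order by (intro bexI[of _ "of_int a + of_int b * s"]) auto
qed

lemma finitely_many_integers_residues:
  assumes "m > 0" shows "finitely_many_classes \<O> (integers_cong m)"
proof (rule finitely_many_classes_map[where f = "\<lambda>x. of_nat (2 * d) * x"])
  show "finitely_many_classes quadratic_order (\<lambda>x y. \<exists>w\<in>quadratic_order. x - y = of_nat (2 * d * m) * w)"
    using assms d_pos by (intro finitely_many_quadratic_order_residues) simp
  fix x y assume "\<exists>w\<in>quadratic_order. of_nat (2 * d) * x - of_nat (2 * d) * y = of_nat (2 * d * m) * w"
  then obtain w where w: "w \<in> quadratic_order" "of_nat (2 * d) * (x - y) = of_nat (2 * d) * (of_nat m * w)"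
    by (auto simp: algebra_simps)
  then have "x - y = of_nat m * w" using d_pos by simp
  then show "integers_cong m x y"
    using w(1) quadratic_order_subset_integers by (auto simp: integers_cong_def)
qed (rule integers_denominator)

definition dirichlet_bound :: nat where
  "dirichlet_bound = (nat \<lceil>2 * (1 + cmod s)\<rceil>)\<^sup>2"

lemma dirichlet_approximation:
  obtains j \<beta> where "j \<in> {1..dirichlet_bound}" "\<beta> \<in> \<O>" "cmod (of_nat j * \<theta> - \<beta>) \<le> 1/2"
proof -
  define k where "k = nat \<lceil>2 * (1 + cmod s)\<rceil>"
  have k: "real k \<ge> 2 * (1 + cmod s)" by (simp add: k_def)
  moreover have "0 < 2 * (1 + cmod s)" by (simp add: add_pos_nonneg)
  ultimately have "real k > 0" by (rule less_le_trans[rotated])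
  then have k_pos: "k > 0" "real k > 0" by simp_all
  define t where "t = (\<lambda>i::nat. if i = 0 then Re \<theta> else Im \<theta> / Im s)"
  obtain q p where q: "0 < q" "q \<le> int (k\<^sup>2)"
    and p: "\<And>i. i < 2 \<Longrightarrow> \<bar>of_int q * t i - of_int (p i)\<bar> < 1 / real k"
    using Dirichlet_approx_simult[OF k_pos(1)] by metis
  define \<beta> where "\<beta> = of_int (p 0) + of_int (p 1) * s"
  let ?r = "\<lambda>i. of_int q * t i - of_int (p i)"
  have "of_nat (nat q) * \<theta> - \<beta> = of_real (?r 0) + of_real (?r 1) * s"
    using q(1) Re_s Im_s by (simp add: complex_eq_iff \<beta>_def t_def algebra_simps)
  then have "cmod (of_nat (nat q) * \<theta> - \<beta>) \<le> \<bar>?r 0\<bar> + \<bar>?r 1\<bar> * cmod s"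
    by (metis norm_mult norm_of_real norm_triangle_ineq)
  also have "\<dots> \<le> 1 / real k + 1 / real k * cmod s"
    using p[of 0] p[of 1] by (intro add_mono mult_right_mono) auto
  also have "\<dots> = (1 + cmod s) / real k" by (simp add: add_divide_distrib)
  also have "\<dots> \<le> 1/2" using k k_pos by (simp add: field_simps)
  finally have "cmod (of_nat (nat q) * \<theta> - \<beta>) \<le> 1/2" .
  moreover have "\<beta> \<in> \<O>" unfolding \<beta>_def using s_mem_integers by auto
  moreover have "nat q \<in> {1..dirichlet_bound}" using q by (simp add: dirichlet_bound_def k_def nat_le_iff)
  ultimately show ?thesis using that by blast
qed

end

lemma (in vector_space) independent_subset_dim_eq_spans:
  assumes "independent B" "B \<subseteq> V" "finite B" "card B = dim V" "dim V > 0"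
  shows "V \<subseteq> span B"
proof
  fix y assume y: "y \<in> V"
  obtain C where C: "V \<subseteq> span C" "card C = dim V" using basis_exists[of V] by metis
  have "finite C" using C(2) assms(5) card_ge_0_finite by metis
  show "y \<in> span B"
  proof (rule ccontr)
    assume "y \<notin> span B"
    then have "y \<notin> B" "independent (insert y B)"
      using span_superset assms(1) by (auto simp: independent_insert)
    moreover have "insert y B \<subseteq> span C" using y assms(2) C(1) by auto
    ultimately have "Suc (card B) \<le> card C"
      using independent_span_bound[OF \<open>finite C\<close>, of "insert y B"] assms(3) by simp
    then show False using C(2) assms(4) by simp
  qed
qed

lemma imaginary_quadratic_field_Rats:
  assumes "imaginary_quadratic_field K" shows "\<rat> \<subseteq> K"
proof
  have one: "0 \<in> K" "1 \<in> K" and add: "\<And>x y. x \<in> K \<Longrightarrow> y \<in> K \<Longrightarrow> x + y \<in> K"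
    and diff: "\<And>x y. x \<in> K \<Longrightarrow> y \<in> K \<Longrightarrow> x - y \<in> K" and mult: "\<And>x y. x \<in> K \<Longrightarrow> y \<in> K \<Longrightarrow> x * y \<in> K"
    and inv: "\<And>x. x \<in> K \<Longrightarrow> inverse x \<in> K"
    using assms by (auto simp: imaginary_quadratic_field_def)
  have nat: "of_nat n \<in> K" for n by (induction n) (auto intro: one add)
  have int: "of_int n \<in> K" for n
    by (cases n rule: int_cases2) (use diff[OF one(1) nat] nat in auto)
  fix r :: complex assume "r \<in> \<rat>"
  then show "r \<in> K" using mult[OF int inv[OF int]] by (auto elim!: Rats_cases' simp: divide_inverse)
qed

lemma Rats_subset_Reals: "(\<rat> :: complex set) \<subseteq> \<real>"
  by (auto elim!: Rats_cases')

lemma imaginary_quadratic_field_adjoin: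
  assumes K: "imaginary_quadratic_field K" and x: "x \<in> K" "x \<notin> \<real>"
  shows "K = adjoin \<rat> x"
proof
  interpret Q: vector_space "\<lambda>(q::rat) (z::complex). of_rat q * z" by (rule rat_vector_space_complex)
  have span_one: "Q.span {1} = \<rat>" unfolding Q.span_singleton by (auto simp: Rats_def)
  have "x \<notin> Q.span {1}" using x(2) Rats_subset_Reals unfolding span_one by blast
  then have ind: "Q.independent {x, 1}" using x(2) by (subst Q.independent_insert) auto
  have "x \<noteq> 1" using x(2) by auto
  then have "K \<subseteq> Q.span {x, 1}"
    using K x(1) by (intro Q.independent_subset_dim_eq_spans[OF ind]) (auto simp: imaginary_quadratic_field_def)
  moreover have "Q.span {x, 1} \<subseteq> adjoin \<rat> x"
  proof
    fix y assume "y \<in> Q.span {x, 1}"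
    then obtain k where "y - of_rat k * x \<in> \<rat>" by (auto simp: Q.span_breakdown_eq span_one)
    then show "y \<in> adjoin \<rat> x"
      unfolding adjoin_def by (intro CollectI exI[of _ "y - of_rat k * x"] exI[of _ "of_rat k"]) auto
  qed
  ultimately show "K \<subseteq> adjoin \<rat> x" by blast
  show "adjoin \<rat> x \<subseteq> K"
    using K x(1) imaginary_quadratic_field_Rats[OF K]
    unfolding adjoin_def imaginary_quadratic_field_def by blast
qed

lemma nonreal_square_neg:
  fixes s :: complex
  assumes "s \<notin> \<real>" "s * s = of_int a" shows "a < 0"
proof -
  have "Im s \<noteq> 0" using assms(1) complex_is_Real_iff by blast
  moreover have "Re s * Im s = 0" "Re s * Re s - Im s * Im s = real_of_int a"
    using assms(2) by (auto simp: complex_eq_iff)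
  ultimately have "real_of_int a = - (Im s * Im s)" "Im s * Im s > 0"
    by (auto simp: zero_less_mult_iff)
  then show ?thesis by linarith
qed

lemma imaginary_quadratic_field_generator:
  assumes K: "imaginary_quadratic_field K"
  obtains s d where "imaginary_quadratic K s d"
proof -
  obtain x where x: "x \<in> K" "x \<notin> \<real>" using K by (auto simp: imaginary_quadratic_field_def)
  have "x * x \<in> adjoin \<rat> x"
    using K x(1) imaginary_quadratic_field_adjoin[OF K x] by (auto simp: imaginary_quadratic_field_def)
  then obtain p q where pq: "p \<in> \<rat>" "q \<in> \<rat>" "x * x = p + q * x" by (auto simp: adjoin_def)
  have "p + q * q / 4 \<in> \<rat>" using pq(1,2) by auto
  then obtain a b where ab: "b > 0" "p + q * q / 4 = of_int a / of_int b" by (metis Rats_cases')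
  define s where "s = of_int b * (x - q / 2)"
  have "(x - q / 2) * (x - q / 2) = of_int a / of_int b"
    using pq(3) unfolding ab(2)[symmetric] by (simp add: algebra_simps)
  then have "s * s = of_int b * of_int b * (of_int a / of_int b)"
    by (simp only: s_def mult_ac)
  then have s_square: "s * s = of_int (a * b)" using ab(1) by simp
  have x_eq: "x = s / of_int b + q / 2" using ab(1) by (simp add: s_def)
  have q_half: "q / 2 \<in> \<rat>" using pq(2) by auto
  have s: "s \<notin> \<real>"
  proof
    assume "s \<in> \<real>"
    then have "s / of_int b \<in> \<real>" by auto
    moreover have "q / 2 \<in> \<real>" using q_half Rats_subset_Reals by blast
    ultimately show False using x(2) x_eq Reals_add by metis
  qed
  have "of_int b \<in> K" "q / 2 \<in> K" using q_half imaginary_quadratic_field_Rats[OF K] by auto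
  then have "s \<in> K" using K x(1) unfolding s_def imaginary_quadratic_field_def by blast
  then have "K = adjoin \<rat> s" using imaginary_quadratic_field_adjoin[OF K _ s] by blast
  moreover have "a * b < 0" using s s_square by (rule nonreal_square_neg)
  ultimately have "imaginary_quadratic K s (nat (- (a * b)))"
    by unfold_locales (use s_square in \<open>auto simp del: of_int_mult\<close>)
  then show ?thesis using that by blast
qed

section \<open>The Hermitian product\<close>

lemma matrix_vector_mult_3:
  "(A *v x) $ i = A $ i $ 1 * x $ 1 + A $ i $ 2 * x $ 2 + A $ i $ 3 * x $ (3::3)"
  by (simp add: matrix_vector_mult_def sum_3)

lemma matrix_matrix_mult_3:
  "(A ** B) $ i $ j = A $ i $ 1 * B $ 1 $ j + A $ i $ 2 * B $ 2 $ j + A $ i $ (3::3) * B $ 3 $ j"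
  by (simp add: matrix_matrix_mult_def sum_3)

lemma vec_3_eq_iff:
  fixes x y :: "'a^3"
  shows "x = y \<longleftrightarrow> x $ 1 = y $ 1 \<and> x $ 2 = y $ 2 \<and> x $ 3 = y $ 3"
  by (simp add: vec_eq_iff forall_3)

lemma mat_mult_nth:
  fixes A :: "'a::semiring_1^'n^'m"
  shows "(mat c ** A) $ i $ j = c * A $ i $ j"
  by (simp add: matrix_matrix_mult_def mat_def if_distrib[of "\<lambda>x. x * _"] cong: if_cong)

lemma mat_mult_mult_vec: "(mat c ** (A :: complex^3^3)) *v v = c *s (A *v v)"
  by (simp add: mat_mult_vec flip: matrix_vector_mul_assoc)

lemma mult_mat_mult: "(A :: complex^3^3) ** (mat c ** B) = mat c ** (A ** B)"
  by (metis mat_commute matrix_mul_assoc)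

lemma mat_mult_mat_mult: "mat b ** (mat c ** (A :: complex^3^3)) = mat (b * c) ** A"
  by (simp add: matrix_mul_assoc mat_mult_mat)

lemma det_mat_mult: "det (mat c ** (A :: complex^3^3)) = c ^ 3 * det A"
  by (simp add: det_mul) (simp add: det_3 mat_def power3_eq_cube)

definition hprod :: "complex^3 \<Rightarrow> complex^3 \<Rightarrow> complex" (\<open>\<langle>_,/ _\<rangle>\<close>) where
  "\<langle>x, y\<rangle> = - (x $ 1) * cnj (y $ 3) - (x $ 3) * cnj (y $ 1) + (x $ 2) * cnj (y $ 2)"

lemma hprod_left_simps [simp]:
  "\<langle>x + x', y\<rangle> = \<langle>x, y\<rangle> + \<langle>x', y\<rangle>" "\<langle>x - x', y\<rangle> = \<langle>x, y\<rangle> - \<langle>x', y\<rangle>" "\<langle>c *s x, y\<rangle> = c * \<langle>x, y\<rangle>" "\<langle>0, y\<rangle> = 0"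
  by (simp_all add: hprod_def algebra_simps)

lemma hprod_right_simps [simp]:
  "\<langle>x, y + y'\<rangle> = \<langle>x, y\<rangle> + \<langle>x, y'\<rangle>" "\<langle>x, y - y'\<rangle> = \<langle>x, y\<rangle> - \<langle>x, y'\<rangle>" "\<langle>x, c *s y\<rangle> = cnj c * \<langle>x, y\<rangle>" "\<langle>x, 0\<rangle> = 0"
  by (simp_all add: hprod_def algebra_simps)

lemma cnj_hprod: "cnj \<langle>x, y\<rangle> = \<langle>y, x\<rangle>"
  by (simp add: hprod_def algebra_simps)

lemma hprod_eq_0_commute: "\<langle>x, y\<rangle> = 0 \<longleftrightarrow> \<langle>y, x\<rangle> = 0"
  by (metis cnj_hprod complex_cnj_zero)

lemma hprod_self: "\<langle>x, x\<rangle> = of_real (herm x)"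
  unfolding herm_def cmod_power2 by (simp add: hprod_def complex_eq_iff power2_eq_square algebra_simps)

lemma herm_eqI: "\<langle>x, x\<rangle> = of_real r \<Longrightarrow> herm x = r"
  by (simp add: hprod_self)

lemma hprod_mult_swap: "\<langle>x, y\<rangle> * \<langle>y, x\<rangle> = of_real ((cmod \<langle>x, y\<rangle>)\<^sup>2)"
  by (metis cnj_hprod complex_norm_square)

lemma herm_nonzero_imp_nonzero: "herm x \<noteq> 0 \<Longrightarrow> x \<noteq> 0"
  by (auto simp: herm_def)

lemma hprod_axis: "\<langle>axis 1 1, y\<rangle> = - cnj (y $ 3)" "\<langle>axis 2 1, y\<rangle> = cnj (y $ 2)" "\<langle>axis 3 1, y\<rangle> = - cnj (y $ 1)"
  by (simp_all add: hprod_def axis_def)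

lemma hprod_eq_sum_axis: "\<langle>u, b\<rangle> = (\<Sum>j\<in>UNIV. \<langle>axis j 1, b\<rangle> * u $ j)"
  by (simp add: sum_3 hprod_axis) (simp add: hprod_def)

lemma hprod_nondegenerate:
  assumes "\<And>w. \<langle>w, x\<rangle> = \<langle>w, y\<rangle>" shows "x = y"
  using assms[of "axis 1 1"] assms[of "axis 2 1"] assms[of "axis 3 1"]
  by (simp add: hprod_axis vec_3_eq_iff)

lemma herm_add_scale:
  "herm (x + c *s y) = herm x + 2 * Re (cnj c * \<langle>x, y\<rangle>) + (cmod c)\<^sup>2 * herm y"
proof (rule herm_eqI)
  have "\<langle>x + c *s y, x + c *s y\<rangle> = \<langle>x, x\<rangle> + (cnj c * \<langle>x, y\<rangle> + cnj (cnj c * \<langle>x, y\<rangle>)) + (c * cnj c) * \<langle>y, y\<rangle>"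
    by (simp add: cnj_hprod algebra_simps)
  also have "\<dots> = of_real (herm x + 2 * Re (cnj c * \<langle>x, y\<rangle>) + (cmod c)\<^sup>2 * herm y)"
    by (simp only: complex_add_cnj complex_norm_square[symmetric] hprod_self of_real_add of_real_mult)
  finally show "\<langle>x + c *s y, x + c *s y\<rangle> = \<dots>" .
qed

lemma herm_orthogonal_projection:
  assumes "herm z = real D"
  defines "x \<equiv> \<lambda>w. of_nat D *s w - \<langle>w, z\<rangle> *s z"
  shows "\<langle>x w, z\<rangle> = 0" "herm (x w) = real D * (real D * herm w - (cmod \<langle>w, z\<rangle>)\<^sup>2)"
proof -
  have zz: "\<langle>z, z\<rangle> = of_nat D" using assms by (simp add: hprod_self)
  show orth: "\<langle>x w, z\<rangle> = 0" by (simp add: x_def zz)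
  show "herm (x w) = real D * (real D * herm w - (cmod \<langle>w, z\<rangle>)\<^sup>2)"
  proof (rule herm_eqI)
    have "\<langle>x w, x w\<rangle> = \<langle>x w, of_nat D *s w\<rangle> - \<langle>x w, \<langle>w, z\<rangle> *s z\<rangle>" by (simp add: x_def)
    also have "\<dots> = of_nat D * \<langle>x w, w\<rangle>" by (simp add: orth)
    also have "\<langle>x w, w\<rangle> = of_nat D * \<langle>w, w\<rangle> - \<langle>w, z\<rangle> * \<langle>z, w\<rangle>" by (simp add: x_def)
    finally show "\<langle>x w, x w\<rangle> = of_real (real D * (real D * herm w - (cmod \<langle>w, z\<rangle>)\<^sup>2))"
      by (simp add: hprod_mult_swap hprod_self)
  qed
qed

lemma hprod_polarization:
  "\<langle>x, y\<rangle> = (of_real (herm (x + y)) - of_real (herm (x - y))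
           + \<i> * of_real (herm (x + \<i> *s y)) - \<i> * of_real (herm (x - \<i> *s y))) / 4"
  unfolding hprod_self[symmetric] by (simp add: algebra_simps)


subsection \<open>Isometries\<close>

definition herm_isometry :: "complex^3^3 \<Rightarrow> bool" where
  "herm_isometry A \<longleftrightarrow> (\<forall>z. herm (A *v z) = herm z)"

lemma herm_isometry_herm: "herm_isometry A \<Longrightarrow> herm (A *v z) = herm z"
  by (simp add: herm_isometry_def)

lemma herm_isometry_mult: "herm_isometry A \<Longrightarrow> herm_isometry B \<Longrightarrow> herm_isometry (A ** B)"
  by (simp add: herm_isometry_def flip: matrix_vector_mul_assoc)

lemma herm_isometry_hprod:
  assumes "herm_isometry A" shows "\<langle>A *v x, A *v y\<rangle> = \<langle>x, y\<rangle>"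
proof -
  have "A *v x + A *v y = A *v (x + y)" "A *v x - A *v y = A *v (x - y)"
    "A *v x + \<i> *s (A *v y) = A *v (x + \<i> *s y)" "A *v x - \<i> *s (A *v y) = A *v (x - \<i> *s y)"
    by (simp_all add: matrix_vector_right_distrib matrix_vector_mult_diff_distrib vector_scalar_commute)
  then show ?thesis
    by (subst (1 2) hprod_polarization) (simp only: herm_isometry_herm[OF assms])
qed

text \<open>The adjoint is \<open>J A\<^sup>* J\<close>, where \<open>J = J\<inverse>\<close> is the Gram matrix of the Hermitian product.\<close>

definition herm_adjoint :: "complex^3^3 \<Rightarrow> complex^3^3" where
  "herm_adjoint A = vector [vector [cnj (A$3$3), - cnj (A$2$3), cnj (A$1$3)],
                            vector [- cnj (A$3$2), cnj (A$2$2), - cnj (A$1$2)],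
                            vector [cnj (A$3$1), - cnj (A$2$1), cnj (A$1$1)]]"

lemma hprod_herm_adjoint: "\<langle>A *v x, y\<rangle> = \<langle>x, herm_adjoint A *v y\<rangle>"
  by (simp add: hprod_def herm_adjoint_def matrix_vector_mult_3 algebra_simps)

lemma det_herm_adjoint: "det (herm_adjoint A) = cnj (det A)"
  by (simp add: det_3 herm_adjoint_def algebra_simps)

lemma herm_adjoint_mat_mult: "herm_adjoint (mat c ** A) = mat (cnj c) ** herm_adjoint A"
  by (simp add: vec_3_eq_iff mat_mult_nth) (simp add: herm_adjoint_def mat_mult_nth)

lemma herm_isometry_adjoint:
  assumes "herm_isometry A"
  shows "herm_adjoint A ** A = mat 1" "A ** herm_adjoint A = mat 1" "herm_isometry (herm_adjoint A)"
proof -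
  have "herm_adjoint A *v (A *v y) = y" for y
    by (rule hprod_nondegenerate) (simp flip: hprod_herm_adjoint add: herm_isometry_hprod[OF assms])
  then show "herm_adjoint A ** A = mat 1"
    by (simp add: matrix_eq matrix_vector_mul_assoc)
  then show right: "A ** herm_adjoint A = mat 1" by (simp add: matrix_left_right_inverse)
  have "herm (herm_adjoint A *v z) = herm z" for z
    using herm_isometry_herm[OF assms, of "herm_adjoint A *v z"] right
    by (simp add: matrix_vector_mul_assoc)
  then show "herm_isometry (herm_adjoint A)" by (simp add: herm_isometry_def)
qed

lemma herm_isometry_adjoint_mult_vec:
  assumes "herm_isometry A"
  shows "herm_adjoint A *v (A *v x) = x" "A *v (herm_adjoint A *v x) = x"
  using herm_isometry_adjoint[OF assms] by (simp_all add: matrix_vector_mul_assoc)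

lemma herm_isometry_adjoint_mult_mat:
  assumes "herm_isometry A"
  shows "herm_adjoint A ** (A ** B) = B" "A ** (herm_adjoint A ** B) = B"
  using herm_isometry_adjoint[OF assms] by (simp_all add: matrix_mul_assoc)

lemma herm_isometry_cmod_det: assumes "herm_isometry A" shows "cmod (det A) = 1"
proof -
  have "cnj (det A) * det A = 1"
    using herm_isometry_adjoint(1)[OF assms] by (metis det_I det_herm_adjoint det_mul)
  then have "complex_of_real ((cmod (det A))\<^sup>2) = 1"
    by (simp add: complex_norm_square mult.commute del: of_real_power)
  then have "(cmod (det A))\<^sup>2 = 1" by (simp only: of_real_eq_1_iff)
  then show ?thesis by (simp add: power2_eq_1_iff) (use norm_ge_zero[of "det A"] in linarith)
qed

lemma herm_isometry_eigenvalue: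
  assumes "herm_isometry A" "A *v x = c *s x" "herm x \<noteq> 0" shows "cmod c = 1"
proof -
  have "(cmod c)\<^sup>2 = 1"
    using herm_isometry_herm[OF assms(1), of x] assms(2,3) by (simp add: herm_scale)
  then show ?thesis using power2_eq_iff_nonneg[of "cmod c" 1] by simp
qed

text \<open>The map \<open>u \<mapsto> u - \<langle>u, a\<rangle> / c a\<close> is unitary as soon as \<open>2 Re c = h(a)\<close>, even when \<open>a\<close> is isotropic.\<close>

definition quasi_reflection :: "complex^3 \<Rightarrow> complex \<Rightarrow> complex^3^3" where
  "quasi_reflection a c = (\<chi> i j. (if i = j then 1 else 0) - \<langle>axis j 1, a\<rangle> / c * a $ i)"

lemma quasi_reflection_mult_vec: "quasi_reflection a c *v u = u - (\<langle>u, a\<rangle> / c) *s a"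
  unfolding vec_3_eq_iff matrix_vector_mult_3 quasi_reflection_def
  by (simp add: hprod_axis) (simp add: hprod_def diff_divide_distrib add_divide_distrib algebra_simps)

lemma det_quasi_reflection: "c \<noteq> 0 \<Longrightarrow> det (quasi_reflection a c) = 1 - \<langle>a, a\<rangle> / c"
  by (simp add: det_3 quasi_reflection_def hprod_axis) (simp add: hprod_def field_simps)

lemma herm_isometry_quasi_reflection:
  assumes "c \<noteq> 0" "2 * Re c = herm a"
  shows "herm_isometry (quasi_reflection a c)"
  unfolding herm_isometry_def
proof
  fix u
  define k where "k = \<langle>u, a\<rangle> / c"
  have "cnj (- k) * \<langle>u, a\<rangle> = - (k * cnj k) * c" using assms(1) by (simp add: k_def)
  also have "\<dots> = - of_real ((cmod k)\<^sup>2) * c" by (simp only: complex_norm_square)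
  finally have "Re (cnj (- k) * \<langle>u, a\<rangle>) = - (cmod k)\<^sup>2 * Re c" by simp
  then have "herm (u + (- k) *s a) = herm u" unfolding herm_add_scale assms(2)[symmetric] by simp
  then show "herm (quasi_reflection a c *v u) = herm u" by (simp add: quasi_reflection_mult_vec k_def)
qed

lemma isometry_up_to_sign:
  assumes "herm x = herm y" "herm x \<noteq> 0"
  obtains \<epsilon> :: complex where "\<epsilon> = 1 \<or> \<epsilon> = -1"
    "herm_isometry (quasi_reflection (x - \<epsilon> *s y) \<langle>x, x - \<epsilon> *s y\<rangle>)"
    "quasi_reflection (x - \<epsilon> *s y) \<langle>x, x - \<epsilon> *s y\<rangle> *v x = \<epsilon> *s y"
proof -
  have reflection: "herm_isometry (quasi_reflection (x - y') \<langle>x, x - y'\<rangle>) \<and>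
      quasi_reflection (x - y') \<langle>x, x - y'\<rangle> *v x = y'"
    if "herm x = herm y'" "\<langle>x, x - y'\<rangle> \<noteq> 0" for y'
  proof
    have "2 * Re \<langle>x, x - y'\<rangle> = herm (x + (- 1) *s y')"
      using that(1) unfolding herm_add_scale by (simp add: hprod_self)
    then have "2 * Re \<langle>x, x - y'\<rangle> = herm (x - y')" by simp
    then show "herm_isometry (quasi_reflection (x - y') \<langle>x, x - y'\<rangle>)"
      using that(2) by (rule herm_isometry_quasi_reflection[rotated])
    show "quasi_reflection (x - y') \<langle>x, x - y'\<rangle> *v x = y'"
      by (simp only: quasi_reflection_mult_vec divide_self[OF that(2)]) simp
  qed
  show ?thesis
  proof (cases "\<langle>x, x - y\<rangle> = 0")
    case False
    then show ?thesis using that[of 1] reflection[of y] assms(1) by simp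
  next
    case True
    then have "\<langle>x, x - (-1) *s y\<rangle> = 2 * of_real (herm x)" by (simp add: hprod_self)
    then have "\<langle>x, x - (-1) *s y\<rangle> \<noteq> 0" using assms(2) by simp
    moreover have "herm x = herm ((-1) *s y)" using assms(1) by (simp only: herm_scale) simp
    ultimately show ?thesis using that[of "-1"] reflection[of "(-1) *s y"] by blast
  qed
qed


subsection \<open>Orthogonal frames\<close>

definition orthogonal_frame :: "complex^3 \<Rightarrow> complex^3 \<Rightarrow> complex^3 \<Rightarrow> bool" where
  "orthogonal_frame a b c \<longleftrightarrow> \<langle>a, b\<rangle> = 0 \<and> \<langle>a, c\<rangle> = 0 \<and> \<langle>b, c\<rangle> = 0 \<and> herm a \<noteq> 0 \<and> herm b \<noteq> 0 \<and> herm c \<noteq> 0"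

lemma orthogonal_frameD:
  assumes "orthogonal_frame a b c"
  shows "\<langle>a, b\<rangle> = 0" "\<langle>a, c\<rangle> = 0" "\<langle>b, c\<rangle> = 0" "\<langle>b, a\<rangle> = 0" "\<langle>c, a\<rangle> = 0" "\<langle>c, b\<rangle> = 0"
    "herm a \<noteq> 0" "herm b \<noteq> 0" "herm c \<noteq> 0"
  using assms by (auto simp: orthogonal_frame_def hprod_eq_0_commute[of b a]
      hprod_eq_0_commute[of c a] hprod_eq_0_commute[of c b])

lemma orthogonal_frame_reverse:
  assumes "orthogonal_frame a b c" shows "orthogonal_frame c b a"
  using orthogonal_frameD[OF assms] by (simp add: orthogonal_frame_def)

definition frame_mat :: "complex^3 \<Rightarrow> complex^3 \<Rightarrow> complex^3 \<Rightarrow> complex^3^3" where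
  "frame_mat a b c = transpose (vector [a, b, c])"

definition coframe_mat :: "complex^3 \<Rightarrow> complex^3 \<Rightarrow> complex^3 \<Rightarrow> complex^3^3" where
  "coframe_mat a b c = vector [\<chi> j. \<langle>axis j 1, a\<rangle> / of_real (herm a),
     \<chi> j. \<langle>axis j 1, b\<rangle> / of_real (herm b), \<chi> j. \<langle>axis j 1, c\<rangle> / of_real (herm c)]"

lemma frame_mat_mult_vec: "frame_mat a b c *v u = u $ 1 *s a + u $ 2 *s b + u $ 3 *s c"
  by (simp add: frame_mat_def vec_eq_iff matrix_vector_mult_3 transpose_def mult.commute)

lemma coframe_mat_mult_vec:
  "coframe_mat a b c *v u = vector [\<langle>u, a\<rangle> / of_real (herm a), \<langle>u, b\<rangle> / of_real (herm b), \<langle>u, c\<rangle> / of_real (herm c)]"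
  by (simp add: vec_3_eq_iff matrix_vector_mult_def coframe_mat_def hprod_eq_sum_axis[of u] sum_divide_distrib)

lemma coframe_mat_frame_mat:
  assumes "orthogonal_frame a b c"
  shows "coframe_mat a b c ** frame_mat a b c = mat 1" "frame_mat a b c ** coframe_mat a b c = mat 1"
proof -
  have "coframe_mat a b c *v (frame_mat a b c *v u) = u" for u
    unfolding frame_mat_mult_vec coframe_mat_mult_vec
    using orthogonal_frameD[OF assms] by (simp add: vec_3_eq_iff hprod_self)
  then show "coframe_mat a b c ** frame_mat a b c = mat 1"
    by (simp add: matrix_eq matrix_vector_mul_assoc)
  then show "frame_mat a b c ** coframe_mat a b c = mat 1" by (simp add: matrix_left_right_inverse)
qed

lemma orthogonal_frame_expansion:
  assumes "orthogonal_frame a b c"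
  shows "u = (\<langle>u, a\<rangle> / of_real (herm a)) *s a + (\<langle>u, b\<rangle> / of_real (herm b)) *s b
    + (\<langle>u, c\<rangle> / of_real (herm c)) *s c"
proof -
  have "u = frame_mat a b c *v (coframe_mat a b c *v u)"
    using coframe_mat_frame_mat(2)[OF assms] by (simp add: matrix_vector_mul_assoc)
  then show ?thesis by (simp add: frame_mat_mult_vec coframe_mat_mult_vec)
qed

lemma herm_frame_mat_mult_vec:
  assumes "orthogonal_frame a b c"
  shows "herm (frame_mat a b c *v u)
    = (cmod (u $ 1))\<^sup>2 * herm a + (cmod (u $ 2))\<^sup>2 * herm b + (cmod (u $ 3))\<^sup>2 * herm c"
proof (rule herm_eqI)
  have "\<langle>frame_mat a b c *v u, frame_mat a b c *v u\<rangle>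
    = (u $ 1 * cnj (u $ 1)) * \<langle>a, a\<rangle> + (u $ 2 * cnj (u $ 2)) * \<langle>b, b\<rangle> + (u $ 3 * cnj (u $ 3)) * \<langle>c, c\<rangle>"
    unfolding frame_mat_mult_vec using orthogonal_frameD[OF assms] by (simp add: algebra_simps)
  then show "\<langle>frame_mat a b c *v u, frame_mat a b c *v u\<rangle>
    = of_real ((cmod (u $ 1))\<^sup>2 * herm a + (cmod (u $ 2))\<^sup>2 * herm b + (cmod (u $ 3))\<^sup>2 * herm c)"
    by (simp only: complex_norm_square hprod_self of_real_add of_real_mult)
qed

lemma herm_orthogonal_frame_expansion:
  assumes "orthogonal_frame a b c"
  shows "herm u = (cmod \<langle>u, a\<rangle>)\<^sup>2 / herm a + (cmod \<langle>u, b\<rangle>)\<^sup>2 / herm b + (cmod \<langle>u, c\<rangle>)\<^sup>2 / herm c"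
proof -
  have "u = frame_mat a b c *v (coframe_mat a b c *v u)"
    using coframe_mat_frame_mat(2)[OF assms] by (simp add: matrix_vector_mul_assoc)
  then have "herm u = (cmod (\<langle>u, a\<rangle> / of_real (herm a)))\<^sup>2 * herm a + (cmod (\<langle>u, b\<rangle> / of_real (herm b)))\<^sup>2 * herm b
      + (cmod (\<langle>u, c\<rangle> / of_real (herm c)))\<^sup>2 * herm c"
    using herm_frame_mat_mult_vec[OF assms, of "coframe_mat a b c *v u"]
    by (simp only: coframe_mat_mult_vec vector_3)
  moreover have "(cmod (z / of_real r))\<^sup>2 * r = (cmod z)\<^sup>2 / r" for z r
    by (simp add: norm_divide power_divide power2_eq_square)
  ultimately show ?thesis by (simp only:)
qed

lemma frame_change_isometry:
  assumes F: "orthogonal_frame a b c" and F': "orthogonal_frame a' b' c'"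
    and "herm a' = herm a" "herm b' = herm b" "herm c' = herm c"
  shows "herm_isometry (frame_mat a' b' c' ** coframe_mat a b c)"
  unfolding herm_isometry_def
proof
  fix u
  have "herm (frame_mat a' b' c' *v (coframe_mat a b c *v u)) = herm (frame_mat a b c *v (coframe_mat a b c *v u))"
    using assms(3-5) by (simp add: herm_frame_mat_mult_vec[OF F] herm_frame_mat_mult_vec[OF F'])
  then show "herm ((frame_mat a' b' c' ** coframe_mat a b c) *v u) = herm u"
    using coframe_mat_frame_mat(2)[OF F] by (simp add: matrix_vector_mul_assoc)
qed

lemma orthogonal_frame_complement:
  assumes "orthogonal_frame a b c"
  shows "{x. \<langle>x, c\<rangle> = 0} = vec.span {a, b}" "vec.dim {x. \<langle>x, c\<rangle> = 0} = 2"
proof -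
  note frame = orthogonal_frameD[OF assms]
  show span: "{x. \<langle>x, c\<rangle> = 0} = vec.span {a, b}"
  proof
    show "{x. \<langle>x, c\<rangle> = 0} \<subseteq> vec.span {a, b}"
    proof
      fix x assume "x \<in> {x. \<langle>x, c\<rangle> = 0}"
      then have "x = (\<langle>x, a\<rangle> / of_real (herm a)) *s a + (\<langle>x, b\<rangle> / of_real (herm b)) *s b"
        using orthogonal_frame_expansion[OF assms, of x] by simp
      then show "x \<in> vec.span {a, b}"
        by (metis insertI1 insertI2 vec.span_add vec.span_base vec.span_scale)
    qed
    show "vec.span {a, b} \<subseteq> {x. \<langle>x, c\<rangle> = 0}"
      by (rule vec.span_minimal) (use frame in \<open>auto simp: vec.subspace_def\<close>)
  qed
  have "a \<notin> vec.span {b}"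
  proof
    assume "a \<in> vec.span {b}"
    then obtain k where "a = k *s b" by (auto simp: vec.span_singleton)
    moreover have "a \<noteq> 0" using frame(7) by (rule herm_nonzero_imp_nonzero)
    ultimately show False using frame(4,8) by (simp add: hprod_self)
  qed
  moreover from this have "a \<noteq> b" using vec.span_base[of b "{b}"] by auto
  ultimately have "vec.independent {a, b}"
    using herm_nonzero_imp_nonzero[OF frame(8)] by (simp add: vec.independent_insert)
  then show "vec.dim {x. \<langle>x, c\<rangle> = 0} = 2"
    unfolding span by (subst vec.dim_span_eq_card_independent) (use \<open>a \<noteq> b\<close> in simp_all)
qed

definition herm_cross :: "complex^3 \<Rightarrow> complex^3 \<Rightarrow> complex^3" where
  "herm_cross x y =
     vector [- cnj (x$1 * y$2 - x$2 * y$1), - cnj (x$1 * y$3 - x$3 * y$1), - cnj (x$2 * y$3 - x$3 * y$2)]"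

lemma hprod_herm_cross: "\<langle>w, herm_cross x y\<rangle> = det (vector [w, x, y])"
  by (simp add: hprod_def herm_cross_def det_3 algebra_simps)

lemma hprod_herm_cross_self [simp]: "\<langle>x, herm_cross x y\<rangle> = 0" "\<langle>y, herm_cross x y\<rangle> = 0"
  by (simp_all add: hprod_def herm_cross_def algebra_simps)

lemma herm_herm_cross: "herm (herm_cross x y) = (cmod \<langle>x, y\<rangle>)\<^sup>2 - herm x * herm y"
proof (rule herm_eqI)
  have "\<langle>herm_cross x y, herm_cross x y\<rangle> = \<langle>x, y\<rangle> * \<langle>y, x\<rangle> - \<langle>x, x\<rangle> * \<langle>y, y\<rangle>"
    by (simp add: hprod_def herm_cross_def algebra_simps)
  then show "\<langle>herm_cross x y, herm_cross x y\<rangle> = of_real ((cmod \<langle>x, y\<rangle>)\<^sup>2 - herm x * herm y)"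
    by (simp add: hprod_mult_swap hprod_self)
qed

lemma orthogonal_frame_herm_cross:
  assumes "\<langle>x, y\<rangle> = 0" "herm x \<noteq> 0" "herm y \<noteq> 0"
  shows "orthogonal_frame x y (herm_cross x y)"
  using assms by (simp add: orthogonal_frame_def herm_herm_cross)

lemma det_frame_mat_herm_cross:
  "det (frame_mat x y (herm_cross x y)) = of_real (herm (herm_cross x y))"
proof -
  let ?n = "herm_cross x y"
  have "det (frame_mat x y ?n) = det (vector [?n, x, y] :: complex^3^3)"
    by (simp add: frame_mat_def) (simp add: det_3 algebra_simps)
  then show ?thesis by (simp add: hprod_self flip: hprod_herm_cross)
qed

lemma herm_pos_if_orthogonal_to_negative:
  assumes x: "herm x < 0" and v: "\<langle>v, x\<rangle> = 0" "v \<noteq> 0" shows "herm v > 0"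
proof -
  have third_nonzero: "x $ 3 \<noteq> 0" using x by (auto simp: herm_def)
  define t where "t = v $ 3 / x $ 3"
  define y where "y = v + (- t) *s x"
  have "herm y = herm v + (cmod t)\<^sup>2 * herm x" unfolding y_def herm_add_scale v(1) by simp
  moreover have "y $ 3 = 0" using third_nonzero by (simp add: y_def t_def)
  then have "herm y = (cmod (y $ 2))\<^sup>2" by (simp add: herm_def)
  ultimately have herm_v: "herm v = (cmod (y $ 2))\<^sup>2 + (cmod t)\<^sup>2 * - herm x" by simp
  have "y $ 2 \<noteq> 0 \<or> t \<noteq> 0"
  proof (rule ccontr)
    assume "\<not> (y $ 2 \<noteq> 0 \<or> t \<noteq> 0)"
    then have "t = 0" "v $ 2 = 0" by (auto simp: y_def)
    then have "v $ 3 = 0" "v $ 1 * cnj (x $ 3) = 0" using third_nonzero v(1) by (auto simp: t_def hprod_def)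
    then show False using \<open>v $ 2 = 0\<close> third_nonzero v(2) by (simp add: vec_3_eq_iff)
  qed
  then have "0 < (cmod (y $ 2))\<^sup>2 \<or> 0 < (cmod t)\<^sup>2 * - herm x" using x by (simp add: mult_pos_neg)
  moreover have "0 \<le> (cmod (y $ 2))\<^sup>2" "0 \<le> (cmod t)\<^sup>2 * - herm x"
    using x by (simp_all add: mult_nonneg_nonpos)
  ultimately show ?thesis unfolding herm_v by linarith
qed

lemma positive_vector_frame:
  assumes "herm v > 0"
  obtains x y where "orthogonal_frame x y v" "herm x < 0"
proof -
  have "herm (vector [1, 0, 1]) = -2" by (simp add: herm_def)
  then have "herm (herm_cross v (vector [1, 0, 1])) > 0"
    using assms by (simp add: herm_herm_cross add_nonneg_pos)
  then obtain y where y: "\<langle>v, y\<rangle> = 0" "herm y > 0" using hprod_herm_cross_self(1) by blast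
  then have "orthogonal_frame v y (herm_cross v y)"
    using assms by (intro orthogonal_frame_herm_cross) auto
  then have "orthogonal_frame (herm_cross v y) y v" by (rule orthogonal_frame_reverse)
  moreover have "herm (herm_cross v y) < 0" using y assms by (simp add: herm_herm_cross)
  ultimately show ?thesis using that by blast
qed


subsection \<open>Hermitian operations over a subring\<close>

context conj_subring
begin

lemma vecs_over_closed [intro]:
  shows vecs_over_add: "x \<in> vecs_over R \<Longrightarrow> y \<in> vecs_over R \<Longrightarrow> x + y \<in> vecs_over R"
    and vecs_over_diff: "x \<in> vecs_over R \<Longrightarrow> y \<in> vecs_over R \<Longrightarrow> x - y \<in> vecs_over R"
    and vecs_over_scale: "c \<in> R \<Longrightarrow> x \<in> vecs_over R \<Longrightarrow> c *s x \<in> vecs_over R"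
  by (auto simp: vecs_over_def)

lemma axis_mem_vecs_over: "axis i 1 \<in> vecs_over R"
  by (simp add: vecs_over_def axis_def)

lemma mat_one_mem_mats_over: "mat 1 \<in> mats_over R"
  by (simp add: mem_mats_over mat_def)

lemma mats_over_add: "A \<in> mats_over R \<Longrightarrow> B \<in> mats_over R \<Longrightarrow> A + B \<in> mats_over R"
  by (simp add: mem_mats_over)

lemma mats_over_scale: "c \<in> R \<Longrightarrow> A \<in> mats_over R \<Longrightarrow> mat c ** A \<in> mats_over R"
  by (simp add: mem_mats_over mat_mult_nth)

lemma mats_over_mult: "A \<in> mats_over R \<Longrightarrow> B \<in> mats_over R \<Longrightarrow> A ** B \<in> mats_over R"
  by (auto simp: mem_mats_over matrix_matrix_mult_def)

lemma mats_over_mult_vec: "A \<in> mats_over R \<Longrightarrow> v \<in> vecs_over R \<Longrightarrow> A *v v \<in> vecs_over R"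
  by (auto simp: mem_mats_over vecs_over_def matrix_vector_mult_def)

lemma hprod_mem: "x \<in> vecs_over R \<Longrightarrow> y \<in> vecs_over R \<Longrightarrow> \<langle>x, y\<rangle> \<in> R"
  by (simp add: hprod_def vecs_over_def)

lemma vecs_over_if_hprod_axis:
  assumes "\<And>i. \<langle>axis i 1, y\<rangle> \<in> R" shows "y \<in> vecs_over R"
proof -
  have "- cnj (y $ 3) \<in> R" "cnj (y $ 2) \<in> R" "- cnj (y $ 1) \<in> R"
    using assms[of 1] assms[of 2] assms[of 3] by (simp_all add: hprod_axis)
  then have "y $ 1 \<in> R" "y $ 2 \<in> R" "y $ 3 \<in> R"
    using cnj_closed[of "cnj (y $ 1)"] cnj_closed[of "cnj (y $ 2)"] cnj_closed[of "cnj (y $ 3)"]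
    by (simp_all add: minus_closed_iff)
  then show ?thesis by (simp add: vecs_over_def forall_3)
qed

lemma herm_adjoint_mem_mats_over: "A \<in> mats_over R \<Longrightarrow> herm_adjoint A \<in> mats_over R"
  unfolding mem_mats_over forall_3 by (simp add: herm_adjoint_def)

lemma herm_cross_mem_vecs_over: "x \<in> vecs_over R \<Longrightarrow> y \<in> vecs_over R \<Longrightarrow> herm_cross x y \<in> vecs_over R"
  by (simp add: vecs_over_def forall_3 herm_cross_def)

lemma quasi_reflection_mem_mats_over:
  assumes "a \<in> vecs_over R" "inverse c \<in> R" shows "quasi_reflection a c \<in> mats_over R"
proof -
  have "\<langle>axis j 1, a\<rangle> / c * a $ i \<in> R" for i j
    using assms hprod_mem[OF axis_mem_vecs_over assms(1)] by (simp add: divide_inverse vecs_over_def)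
  then show ?thesis unfolding mem_mats_over quasi_reflection_def by simp
qed

lemma frame_mat_mem_mats_over:
  "a \<in> vecs_over R \<Longrightarrow> b \<in> vecs_over R \<Longrightarrow> c \<in> vecs_over R \<Longrightarrow> frame_mat a b c \<in> mats_over R"
  unfolding mem_mats_over forall_3 by (simp add: frame_mat_def transpose_def vecs_over_def)

end

section \<open>The projective unitary group\<close>

lemma carrier_SU_h: "A \<in> carrier SU_h \<longleftrightarrow> det A = 1 \<and> herm_isometry A"
  by (simp add: SU_h_def herm_isometry_def)

lemma SU_h_isometry: "A \<in> carrier SU_h \<Longrightarrow> herm_isometry A"
  by (simp add: carrier_SU_h)

lemma SU_h_one: "mat 1 \<in> carrier SU_h"
  by (simp add: carrier_SU_h herm_isometry_def)

lemma SU_h_mult: "A \<in> carrier SU_h \<Longrightarrow> B \<in> carrier SU_h \<Longrightarrow> A ** B \<in> carrier SU_h"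
  by (simp add: carrier_SU_h det_mul herm_isometry_mult)

lemma SU_h_adjoint: "A \<in> carrier SU_h \<Longrightarrow> herm_adjoint A \<in> carrier SU_h"
  by (simp add: carrier_SU_h det_herm_adjoint herm_isometry_adjoint)

lemma SU_h_cube_root: "\<omega> ^ 3 = 1 \<Longrightarrow> mat \<omega> \<in> carrier SU_h"
  using U3_subset by (auto simp: U3_def)

lemma cmod_cube_eq_1_imp: "cmod \<omega> ^ 3 = 1 \<Longrightarrow> cmod \<omega> = 1"
  using power_eq_imp_eq_base[of "cmod \<omega>" 3 1] by simp

lemma isometry_scaled_SU_h:
  assumes "herm_isometry A"
  obtains c where "c \<noteq> 0" "mat c ** A \<in> carrier SU_h"
proof -
  have det: "cmod (det A) = 1" by (rule herm_isometry_cmod_det[OF assms])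
  then have nonzero: "det A \<noteq> 0" by auto
  define c where "c = exp (- Ln (det A) / 3)"
  have "c ^ 3 = exp (3 * (- Ln (det A) / 3))"
    unfolding c_def by (subst exp_of_nat_mult[symmetric]) simp
  also have "\<dots> = inverse (det A)" using nonzero by (simp add: exp_minus)
  finally have cube: "c ^ 3 = inverse (det A)" .
  then have "cmod c = 1" using det by (metis cmod_cube_eq_1_imp inverse_1 norm_inverse norm_power)
  then have "mat c ** A \<in> carrier SU_h"
    using cube nonzero assms by (simp add: carrier_SU_h herm_isometry_def det_mat_mult mat_mult_mult_vec herm_scale)
  moreover have "c \<noteq> 0" by (simp add: c_def)
  ultimately show ?thesis using that by blast
qed

lemma isometry_mult_vec_nonzero: "herm_isometry A \<Longrightarrow> x \<noteq> 0 \<Longrightarrow> A *v x \<noteq> 0"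
  using herm_isometry_adjoint_mult_vec(1)[of A x] by auto

lemma isometry_adjoint_eigenvector:
  assumes "herm_isometry A" "A *v v = c *s v" "c \<noteq> 0"
  shows "herm_adjoint A *v v = inverse c *s v"
proof -
  have "c *s (herm_adjoint A *v v) = v"
    using herm_isometry_adjoint_mult_vec(1)[OF assms(1), of v] by (simp add: assms(2) vector_scalar_commute)
  then show ?thesis using assms(3) by (metis left_inverse vector_smult_assoc vector_smult_lid)
qed

lemma isometry_eigenvalue_nonzero:
  assumes "herm_isometry A" "A *v v = c *s v" "v \<noteq> 0" shows "c \<noteq> 0"
  using isometry_mult_vec_nonzero[OF assms(1,3)] assms(2) by auto

definition PSU_class :: "complex^3^3 \<Rightarrow> (complex^3^3) set" where
  "PSU_class A = U3 #>\<^bsub>SU_h\<^esub> A"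

lemma PSU_class_eq: "PSU_class A = {mat \<omega> ** A | \<omega>. \<omega> ^ 3 = 1}"
  unfolding PSU_class_def r_coset_def U3_def by (auto simp: SU_h_def)

lemma mem_PSU_class_self: "A \<in> PSU_class A"
  unfolding PSU_class_eq by (auto intro!: exI[of _ 1])

lemma PSU_class_mat_mult:
  assumes "\<omega> ^ 3 = 1" shows "PSU_class (mat \<omega> ** A) = PSU_class A"
proof -
  have subset: "PSU_class (mat \<omega> ** A) \<subseteq> PSU_class A" if "\<omega> ^ 3 = 1" for \<omega> A
    unfolding PSU_class_eq using that by (auto simp: mat_mult_mat_mult) (metis mult.right_neutral power_mult_distrib)
  have "\<omega> \<noteq> 0" using assms by auto
  then have "mat (inverse \<omega>) ** (mat \<omega> ** A) = A" by (simp add: mat_mult_mat_mult)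
  then have "PSU_class A \<subseteq> PSU_class (mat \<omega> ** A)"
    using subset[of "inverse \<omega>" "mat \<omega> ** A"] assms by (simp add: power_inverse)
  then show ?thesis using subset[OF assms] by blast
qed

lemma PSU_class_eq_iff: "PSU_class A = PSU_class B \<longleftrightarrow> (\<exists>\<omega>. \<omega> ^ 3 = 1 \<and> A = mat \<omega> ** B)"
proof
  assume "PSU_class A = PSU_class B"
  then have "A \<in> PSU_class B" using mem_PSU_class_self by blast
  then show "\<exists>\<omega>. \<omega> ^ 3 = 1 \<and> A = mat \<omega> ** B" by (auto simp: PSU_class_eq)
qed (auto simp: PSU_class_mat_mult)

lemma carrier_PSU_h: "carrier PSU_h = PSU_class ` carrier SU_h"
  unfolding PSU_h_def carrier_FactGroup PSU_class_def by simp

lemma PSU_class_mem_carrier_iff: "PSU_class A \<in> carrier PSU_h \<longleftrightarrow> A \<in> carrier SU_h"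
proof
  assume "PSU_class A \<in> carrier PSU_h"
  then obtain B where B: "B \<in> carrier SU_h" "PSU_class A = PSU_class B" unfolding carrier_PSU_h by blast
  then obtain \<omega> where "\<omega> ^ 3 = 1" "A = mat \<omega> ** B" by (auto simp: PSU_class_eq_iff)
  then show "A \<in> carrier SU_h" using SU_h_mult[OF SU_h_cube_root B(1)] by blast
qed (simp add: carrier_PSU_h)

lemma PSU_class_mult:
  assumes "A \<in> carrier SU_h" "B \<in> carrier SU_h"
  shows "PSU_class A \<otimes>\<^bsub>PSU_h\<^esub> PSU_class B = PSU_class (A ** B)"
  using normal.rcos_sum[OF U3_normal assms] by (simp add: PSU_h_def PSU_class_def) (simp add: SU_h_def)

lemma PSU_class_one: "\<one>\<^bsub>PSU_h\<^esub> = PSU_class (mat 1)"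
  unfolding PSU_h_def PSU_class_eq U3_def by simp

lemma PSU_class_inv:
  assumes "A \<in> carrier SU_h" shows "inv\<^bsub>PSU_h\<^esub> (PSU_class A) = PSU_class (herm_adjoint A)"
  using assms SU_h_adjoint[OF assms] herm_isometry_adjoint(1)[OF SU_h_isometry[OF assms]]
  by (intro group.inv_equality[OF group_PSU_h]) (simp_all add: PSU_class_mult PSU_class_one PSU_class_mem_carrier_iff)

lemma PSU_class_conjugate_scaled:
  assumes T: "herm_isometry T" and c: "mat c ** T \<in> carrier SU_h" and X: "X \<in> carrier SU_h"
  shows "PSU_class (mat c ** T) \<otimes>\<^bsub>PSU_h\<^esub> PSU_class X \<otimes>\<^bsub>PSU_h\<^esub> inv\<^bsub>PSU_h\<^esub> PSU_class (mat c ** T)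
    = PSU_class (T ** (X ** herm_adjoint T))"
proof -
  have "(mat c ** T) ** herm_adjoint (mat c ** T) = mat 1"
    using c by (intro herm_isometry_adjoint SU_h_isometry)
  then have "mat (c * cnj c) = (mat 1 :: complex^3^3)"
    using herm_isometry_adjoint(2)[OF T]
    by (simp add: herm_adjoint_mat_mult mult_mat_mult[of T] mat_mult_mat_mult mat_mult_mat flip: matrix_mul_assoc)
  moreover have "((mat c ** T) ** X) ** herm_adjoint (mat c ** T)
      = mat (c * cnj c) ** (T ** (X ** herm_adjoint T))"
    by (simp add: herm_adjoint_mat_mult mult_mat_mult[of T] mult_mat_mult[of X] mat_mult_mat_mult flip: matrix_mul_assoc)
  ultimately show ?thesis
    using c X by (simp add: PSU_class_inv PSU_class_mult SU_h_mult SU_h_adjoint)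
qed

lemma mem_proj: "x \<in> proj v \<longleftrightarrow> (\<exists>c. c \<noteq> 0 \<and> x = c *s v)"
  by (auto simp: proj_def)

lemma proj_scale:
  assumes "c \<noteq> 0" shows "proj (c *s v) = proj v"
proof -
  have subset: "proj (c *s v) \<subseteq> proj v" if "c \<noteq> 0" for c v
    using that by (auto simp: proj_def)
  have "v = inverse c *s (c *s v)" using assms by simp
  then have "proj v \<subseteq> proj (c *s v)" using subset[of "inverse c" "c *s v"] assms by simp
  then show ?thesis using subset[OF assms] by blast
qed

lemma proj_eq_iff: "proj x = proj y \<longleftrightarrow> (\<exists>c. c \<noteq> 0 \<and> x = c *s y)"
proof
  assume "proj x = proj y"
  moreover have "x \<in> proj x" by (auto simp: mem_proj intro!: exI[of _ 1])
  ultimately show "\<exists>c. c \<noteq> 0 \<and> x = c *s y" by (simp add: mem_proj)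
qed (auto simp: proj_scale)

lemma act_PSU_class: "act (PSU_class A) (proj v) = proj (A *v v)"
proof
  show "act (PSU_class A) (proj v) \<subseteq> proj (A *v v)"
  proof
    fix u assume "u \<in> act (PSU_class A) (proj v)"
    then obtain \<omega> c where "\<omega> ^ 3 = 1" "c \<noteq> 0" "u = (mat \<omega> ** A) *v (c *s v)"
      by (auto simp: act_def PSU_class_eq mem_proj)
    moreover from this have "\<omega> \<noteq> 0" by auto
    ultimately show "u \<in> proj (A *v v)" unfolding mem_proj
      by (intro exI[of _ "\<omega> * c"]) (simp add: mat_mult_mult_vec vector_scalar_commute)
  qed
  show "proj (A *v v) \<subseteq> act (PSU_class A) (proj v)"
    unfolding act_def proj_def using mem_PSU_class_self[of A] by (auto simp flip: vector_scalar_commute)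
qed

lemma act_PSU_class_fixes_iff:
  assumes "A \<in> carrier SU_h" "v \<noteq> 0"
  shows "act (PSU_class A) (proj v) = proj v \<longleftrightarrow> (\<exists>c. A *v v = c *s v)"
  unfolding act_PSU_class proj_eq_iff
  using isometry_eigenvalue_nonzero[OF SU_h_isometry[OF assms(1)] _ assms(2)] by auto


subsection \<open>The quotient topology\<close>

lemma continuous_on_matrix_mult [continuous_intros]:
  fixes f :: "'a::topological_space \<Rightarrow> 'b::real_normed_algebra_1^'n^'m" and g :: "'a \<Rightarrow> 'b^'k^'n"
  assumes "continuous_on S f" "continuous_on S g"
  shows "continuous_on S (\<lambda>x. f x ** g x)"
  unfolding matrix_matrix_mult_def by (intro continuous_intros assms)

lemma continuous_on_matrix_entries:
  fixes f :: "'a::topological_space \<Rightarrow> 'b::topological_space^'n^'m"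
  assumes "\<And>i j. continuous_on S (\<lambda>x. f x $ i $ j)" shows "continuous_on S f"
proof -
  have "continuous_on S (\<lambda>x. \<chi> i j. f x $ i $ j)" by (intro continuous_on_vec_lambda assms)
  then show ?thesis by simp
qed

lemma mem_Union_PSU_class_iff:
  assumes "U \<subseteq> carrier PSU_h" shows "A \<in> \<Union>U \<longleftrightarrow> PSU_class A \<in> U"
proof
  assume "A \<in> \<Union>U"
  then obtain B where "PSU_class B \<in> U" "A \<in> PSU_class B" using assms by (auto simp: carrier_PSU_h)
  then show "PSU_class A \<in> U" using PSU_class_mat_mult by (auto simp: PSU_class_eq[of B])
qed (use mem_PSU_class_self in blast)

lemma topspace_PSU_h: "topspace PSU_h_topology = carrier PSU_h"
proof
  show "topspace PSU_h_topology \<subseteq> carrier PSU_h"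
    using openin_PSU_h_topology openin_topspace by blast
  have "\<Union>(carrier PSU_h) = carrier SU_h"
    using mem_Union_PSU_class_iff[OF order_refl] PSU_class_mem_carrier_iff by blast
  then have "openin PSU_h_topology (carrier PSU_h)" by (simp add: openin_PSU_h_topology)
  then show "carrier PSU_h \<subseteq> topspace PSU_h_topology" by (rule openin_subset)
qed

lemma quotient_map_PSU_class: "quotient_map (top_of_set (carrier SU_h)) PSU_h_topology PSU_class"
  unfolding quotient_map_def
proof (intro conjI allI impI)
  show "PSU_class ` topspace (top_of_set (carrier SU_h)) = topspace PSU_h_topology"
    by (simp add: topspace_PSU_h carrier_PSU_h)
  fix U assume "U \<subseteq> topspace PSU_h_topology"
  then have U: "U \<subseteq> carrier PSU_h" by (simp add: topspace_PSU_h)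
  then have "{A \<in> topspace (top_of_set (carrier SU_h)). PSU_class A \<in> U} = \<Union>U"
    using mem_Union_PSU_class_iff[OF U] PSU_class_mem_carrier_iff by auto
  then show "openin (top_of_set (carrier SU_h)) {A \<in> topspace (top_of_set (carrier SU_h)). PSU_class A \<in> U}
      = openin PSU_h_topology U"
    using U by (simp add: openin_PSU_h_topology)
qed

lemma closed_map_PSU_class: "closed_map (top_of_set (carrier SU_h)) PSU_h_topology PSU_class"
  unfolding closed_map_def
proof (intro allI impI)
  fix C assume C: "closedin (top_of_set (carrier SU_h)) C"
  let ?scaled = "\<lambda>\<omega>. {A \<in> carrier SU_h. mat \<omega> ** A \<in> C}"
  have closed: "closedin (top_of_set (carrier SU_h)) (?scaled \<omega>)" if "\<omega> ^ 3 = 1" for \<omega>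
  proof -
    have "continuous_map (top_of_set (carrier SU_h)) (top_of_set (carrier SU_h)) (\<lambda>A. mat \<omega> ** A)"
      using SU_h_mult[OF SU_h_cube_root[OF that]] by (auto intro!: continuous_intros)
    from closedin_continuous_map_preimage[OF this C] show ?thesis by simp
  qed
  have "{A \<in> topspace (top_of_set (carrier SU_h)). PSU_class A \<in> PSU_class ` C} = (\<Union>\<omega>\<in>{\<omega>. \<omega> ^ 3 = 1}. ?scaled \<omega>)"
  proof (intro equalityI subsetI)
    fix A assume "A \<in> {A \<in> topspace (top_of_set (carrier SU_h)). PSU_class A \<in> PSU_class ` C}"
    then obtain B where B: "A \<in> carrier SU_h" "B \<in> C" "PSU_class B = PSU_class A" by auto
    then obtain \<omega> where "\<omega> ^ 3 = 1" "B = mat \<omega> ** A" by (auto simp: PSU_class_eq_iff)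
    then show "A \<in> (\<Union>\<omega>\<in>{\<omega>. \<omega> ^ 3 = 1}. ?scaled \<omega>)" using B by blast
  next
    fix A assume "A \<in> (\<Union>\<omega>\<in>{\<omega>. \<omega> ^ 3 = 1}. ?scaled \<omega>)"
    then obtain \<omega> where "\<omega> ^ 3 = 1" "A \<in> carrier SU_h" "mat \<omega> ** A \<in> C" by blast
    then show "A \<in> {A \<in> topspace (top_of_set (carrier SU_h)). PSU_class A \<in> PSU_class ` C}"
      using PSU_class_mat_mult by (auto intro: rev_image_eqI)
  qed
  moreover have "closedin (top_of_set (carrier SU_h)) (\<Union>\<omega>\<in>{\<omega>. \<omega> ^ 3 = 1}. ?scaled \<omega>)"
    using closed finite_roots_unity[of 3] by (intro closedin_Union finite_imageI) auto
  moreover have "PSU_class ` C \<subseteq> topspace PSU_h_topology"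
    using closedin_subset[OF C] by (auto simp: topspace_PSU_h carrier_PSU_h)
  then have "closedin (top_of_set (carrier SU_h)) {A \<in> topspace (top_of_set (carrier SU_h)). PSU_class A \<in> PSU_class ` C}
      \<longleftrightarrow> closedin PSU_h_topology (PSU_class ` C)"
    using quotient_map_PSU_class unfolding quotient_map_closedin by blast
  ultimately show "closedin PSU_h_topology (PSU_class ` C)" by (simp only:)
qed

section \<open>Complex geodesics and copies of \<open>SL\<^sub>2(\<real>)\<close>\<close>

subsection \<open>Complex geodesics are polar to positive vectors\<close>

definition polar_line :: "complex^3 \<Rightarrow> (complex^3) set set" where
  "polar_line v = proj ` ({x. \<langle>x, v\<rangle> = 0} - {0})"

lemma proj_mem_polar_line: "x \<noteq> 0 \<Longrightarrow> proj x \<in> polar_line v \<longleftrightarrow> \<langle>x, v\<rangle> = 0"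
  unfolding polar_line_def by (auto simp: proj_eq_iff)

lemma projective_line_polar_line:
  assumes "herm v > 0" shows "projective_line (polar_line v)"
proof -
  obtain x y where "orthogonal_frame x y v" using positive_vector_frame[OF assms] by blast
  then have "vec.dim {x. \<langle>x, v\<rangle> = 0} = 2" by (rule orthogonal_frame_complement)
  moreover have "vec.subspace {x. \<langle>x, v\<rangle> = 0}" by (auto simp: vec.subspace_def)
  ultimately show ?thesis unfolding projective_line_def polar_line_def by blast
qed

lemma polar_line_meets_H2C:
  assumes "herm v > 0" shows "polar_line v \<inter> H2C \<noteq> {}"
proof -
  obtain x y where frame: "orthogonal_frame x y v" "herm x < 0" using positive_vector_frame[OF assms] by blast
  then have "proj x \<in> polar_line v"
    using herm_nonzero_imp_nonzero[of x] by (simp add: proj_mem_polar_line orthogonal_frameD)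
  moreover have "proj x \<in> H2C" using frame(2) by (auto simp: H2C_def)
  ultimately show ?thesis by blast
qed

lemma plane_eq_orthogonal_complement:
  assumes V: "vec.subspace V" "vec.dim V = 2" and x: "x \<in> V" "herm x < 0"
  obtains v where "herm v > 0" "V = {y. \<langle>y, v\<rangle> = 0}"
proof -
  have "x \<noteq> 0" using herm_nonzero_imp_nonzero[of x] x(2) by simp
  have "\<not> V \<subseteq> vec.span {x}"
  proof
    assume "V \<subseteq> vec.span {x}"
    then have "vec.dim V \<le> card {x}" by (rule vec.dim_le_card) simp
    then show False using V(2) by simp
  qed
  then obtain b where b: "b \<in> V" "b \<notin> vec.span {x}" by blast
  define k where "k = \<langle>b, x\<rangle> / of_real (herm x)"
  define y where "y = b - k *s x"
  have y: "y \<in> V" "\<langle>y, x\<rangle> = 0" "y \<noteq> 0"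
  proof -
    show "y \<in> V" using V(1) x(1) b(1) unfolding y_def by (intro vec.subspace_diff vec.subspace_scale)
    show "\<langle>y, x\<rangle> = 0" using x(2) by (simp add: y_def k_def hprod_self)
    show "y \<noteq> 0" using b(2) vec.span_scale[OF vec.span_base[of x "{x}"], of k] by (auto simp: y_def)
  qed
  have "herm y > 0" using herm_pos_if_orthogonal_to_negative[OF x(2) y(2,3)] .
  then have frame: "orthogonal_frame x y (herm_cross x y)"
    using x(2) y(2) by (intro orthogonal_frame_herm_cross) (auto simp: hprod_eq_0_commute[of x])
  have "herm (herm_cross x y) > 0"
    using x(2) \<open>herm y > 0\<close> orthogonal_frameD(1)[OF frame] by (simp add: herm_herm_cross mult_neg_pos)
  moreover have "{z. \<langle>z, herm_cross x y\<rangle> = 0} \<subseteq> V"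
    unfolding orthogonal_frame_complement(1)[OF frame]
    using x(1) y(1) V(1) by (intro vec.span_minimal) auto
  then have "V = {z. \<langle>z, herm_cross x y\<rangle> = 0}"
    using orthogonal_frame_complement(2)[OF frame] V
    by (intro vec.subspace_dim_equal[symmetric]) (auto simp: vec.subspace_def)
  ultimately show ?thesis using that by blast
qed

lemma projective_line_meeting_H2C_is_polar:
  assumes "projective_line L" "L \<inter> H2C \<noteq> {}"
  obtains v where "herm v > 0" "L = polar_line v"
proof -
  obtain V where V: "vec.subspace V" "vec.dim V = 2" "L = proj ` (V - {0})"
    using assms(1) by (auto simp: projective_line_def)
  obtain x y where xy: "herm x < 0" "y \<in> V" "proj x = proj y" using assms(2) V(3) by (auto simp: H2C_def)
  then have "x \<in> V" using V(1) by (auto simp: proj_eq_iff vec.subspace_scale)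
  then obtain v where "herm v > 0" "V = {y. \<langle>y, v\<rangle> = 0}"
    using plane_eq_orthogonal_complement[OF V(1,2)] xy(1) by blast
  then show ?thesis using that V(3) by (simp add: polar_line_def)
qed

lemma act_polar_line_subset:
  assumes "A \<in> carrier SU_h"
  shows "act (PSU_class A) ` polar_line v \<subseteq> polar_line (A *v v)"
proof (rule image_subsetI)
  fix p assume "p \<in> polar_line v"
  then obtain x where x: "x \<noteq> 0" "\<langle>x, v\<rangle> = 0" "p = proj x" by (auto simp: polar_line_def)
  then show "act (PSU_class A) p \<in> polar_line (A *v v)"
    using isometry_mult_vec_nonzero[OF SU_h_isometry[OF assms]] herm_isometry_hprod[OF SU_h_isometry[OF assms]]
    by (simp add: act_PSU_class proj_mem_polar_line)
qed

lemma act_polar_line: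
  assumes A: "A \<in> carrier SU_h"
  shows "act (PSU_class A) ` polar_line v = polar_line (A *v v)"
proof (rule equalityI[OF act_polar_line_subset[OF A]])
  show "polar_line (A *v v) \<subseteq> act (PSU_class A) ` polar_line v"
  proof
    fix p assume p: "p \<in> polar_line (A *v v)"
    then obtain x where x: "p = proj x" by (auto simp: polar_line_def)
    have inv: "A *v (herm_adjoint A *v x) = x" "herm_adjoint A *v (A *v v) = v"
      using herm_isometry_adjoint_mult_vec[OF SU_h_isometry[OF A]] by auto
    have "act (PSU_class (herm_adjoint A)) p \<in> polar_line v"
      using act_polar_line_subset[OF SU_h_adjoint[OF A], of "A *v v"] p inv(2) by auto
    moreover have "act (PSU_class A) (act (PSU_class (herm_adjoint A)) p) = p"
      by (simp add: x act_PSU_class inv(1))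
    ultimately show "p \<in> act (PSU_class A) ` polar_line v" by force
  qed
qed

lemma polar_line_eq_imp_proportional:
  assumes v: "herm v > 0" and eq: "polar_line v = polar_line w"
  obtains c where "w = c *s v"
proof -
  obtain x y where frame: "orthogonal_frame x y v" using positive_vector_frame[OF v] by blast
  have "\<langle>u, w\<rangle> = 0" if "\<langle>u, v\<rangle> = 0" for u
    using that proj_mem_polar_line[of u v] proj_mem_polar_line[of u w] eq by (cases "u = 0") auto
  then have "\<langle>w, x\<rangle> = 0" "\<langle>w, y\<rangle> = 0"
    using orthogonal_frameD[OF frame] by (simp_all add: hprod_eq_0_commute[of w])
  then have "w = (\<langle>w, v\<rangle> / of_real (herm v)) *s v"
    using orthogonal_frame_expansion[OF frame, of w] by simp
  then show ?thesis by (rule that)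
qed


subsection \<open>Homomorphisms from \<open>SL\<^sub>2(\<real>)\<close> preserving a complex geodesic\<close>

lemma carrier_SL2R: "X \<in> carrier SL2R \<longleftrightarrow> det X = 1"
  by (simp add: SL2R_def)

lemma SL2R_mult: "X \<otimes>\<^bsub>SL2R\<^esub> Y = X ** Y"
  by (simp add: SL2R_def)

lemma matrix_matrix_mult_2:
  "(A ** B) $ i $ j = A $ i $ 1 * B $ 1 $ j + A $ i $ (2::2) * B $ 2 $ j"
  by (simp add: matrix_matrix_mult_def sum_2)

lemma mat_2_eq_iff:
  fixes A B :: "'a^2^2"
  shows "A = B \<longleftrightarrow> A$1$1 = B$1$1 \<and> A$1$2 = B$1$2 \<and> A$2$1 = B$2$1 \<and> A$2$2 = B$2$2"
  by (auto simp: vec_eq_iff forall_2)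

definition mat2 :: "'a \<Rightarrow> 'a \<Rightarrow> 'a \<Rightarrow> 'a \<Rightarrow> 'a::zero^2^2" where
  "mat2 a b c d = vector [vector [a, b], vector [c, d]]"

lemma mat2_nth [simp]:
  "mat2 a b c d $ 1 $ 1 = a" "mat2 a b c d $ 1 $ 2 = b" "mat2 a b c d $ 2 $ 1 = c" "mat2 a b c d $ 2 $ 2 = d"
  by (simp_all add: mat2_def)

lemma mat2_mult:
  fixes a :: "'a::semiring_1"
  shows "mat2 a b c d ** mat2 a' b' c' d'
    = mat2 (a*a' + b*c') (a*b' + b*d') (c*a' + d*c') (c*b' + d*d')"
  by (simp add: mat_2_eq_iff matrix_matrix_mult_2)

lemma det_mat2: "det (mat2 a b c d) = a * d - b * c"
  by (simp add: det_2)

text \<open>Elementary matrices are commutators with a diagonal matrix, and they generate.\<close>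

lemma SL2R_character_trivial:
  fixes f :: "real^2^2 \<Rightarrow> 'a::field"
  assumes mult: "\<And>X Y. det X = 1 \<Longrightarrow> det Y = 1 \<Longrightarrow> f (X ** Y) = f X * f Y"
    and nonzero: "\<And>X. det X = 1 \<Longrightarrow> f X \<noteq> 0" and X: "det X = 1"
  shows "f X = 1"
proof -
  have commutator: "f T = 1" if "X ** Y = T ** (Y ** X)" "det X = 1" "det Y = 1" "det T = 1" for X Y T
  proof -
    have "f X * f Y = f (T ** (Y ** X))" using mult[OF that(2,3)] that(1) by simp
    also have "\<dots> = f T * (f Y * f X)" using that by (simp add: mult det_mul)
    finally have "f X * f Y = f T * (f Y * f X)" .
    then show ?thesis using nonzero[OF that(2)] nonzero[OF that(3)] by simp
  qed
  have upper: "f (mat2 1 t 0 1) = 1" for t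
    by (rule commutator[of "mat2 2 0 0 (1/2)" "mat2 1 (t/3) 0 1"]) (simp_all add: mat2_mult det_mat2)
  have lower: "f (mat2 1 0 t 1) = 1" for t
    by (rule commutator[of "mat2 (1/2) 0 0 2" "mat2 1 0 (t/3) 1"]) (simp_all add: mat2_mult det_mat2)
  have generic: "f Y = 1" if Y: "det Y = 1" "Y $ 2 $ 1 \<noteq> 0" for Y
  proof -
    obtain p q r s where entries: "Y = mat2 p q r s"
      using mat_2_eq_iff[of Y "mat2 (Y$1$1) (Y$1$2) (Y$2$1) (Y$2$2)"] by auto
    have r: "r \<noteq> 0" and det: "p * s - q * r = 1" using Y by (auto simp: entries det_mat2)
    have "q = p * ((s - 1) / r) + (p - 1) / r" using det r by (simp add: field_simps)
    then have "Y = mat2 1 ((p - 1) / r) 0 1 ** (mat2 1 0 r 1 ** mat2 1 ((s - 1) / r) 0 1)"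
      using r by (simp add: entries mat2_mult mat_2_eq_iff field_simps)
    then show ?thesis using mult upper lower by (simp add: det_mul det_mat2)
  qed
  show ?thesis
  proof (cases "X $ 2 $ 1 = 0")
    case False
    then show ?thesis using generic X by blast
  next
    case True
    then have "(mat2 1 0 1 1 ** X) $ 2 $ 1 \<noteq> 0" using X by (auto simp: matrix_matrix_mult_2 det_2)
    then have "f (mat2 1 0 1 1 ** X) = 1" using X by (intro generic) (simp_all add: det_mul det_mat2)
    then show ?thesis using mult[of "mat2 1 0 1 1" X] X lower[of 1] by (simp add: det_mat2)
  qed
qed

definition PSU_vector_stabilizer :: "complex^3 \<Rightarrow> (complex^3^3) set set" where
  "PSU_vector_stabilizer v = {PSU_class A | A. A \<in> carrier SU_h \<and> A *v v = v}"

lemma PSU_vector_stabilizerI: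
  assumes "A \<in> carrier SU_h" "A *v v = \<omega> *s v" "\<omega> ^ 3 = 1"
  shows "PSU_class A \<in> PSU_vector_stabilizer v"
proof -
  have "inverse \<omega> ^ 3 = 1" "\<omega> \<noteq> 0" using assms(3) by (auto simp: power_inverse)
  then have "PSU_class A = PSU_class (mat (inverse \<omega>) ** A)" "mat (inverse \<omega>) ** A \<in> carrier SU_h"
    "(mat (inverse \<omega>) ** A) *v v = v"
    using assms(1,2) by (auto simp: PSU_class_mat_mult SU_h_mult SU_h_cube_root mat_mult_mult_vec)
  then show ?thesis unfolding PSU_vector_stabilizer_def by blast
qed

lemma eigenvalue_cube_eq_if_PSU_class_eq:
  assumes eq: "PSU_class A = PSU_class B" and A: "A *v v = l *s v" and B: "B *v v = m *s v" and v: "v \<noteq> 0"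
  shows "l ^ 3 = m ^ 3"
proof -
  obtain \<omega> where \<omega>: "\<omega> ^ 3 = 1" "A = mat \<omega> ** B" using eq by (auto simp: PSU_class_eq_iff)
  have "l *s v = (\<omega> * m) *s v" using A B unfolding \<omega>(2) by (auto simp: mat_mult_mult_vec)
  then have "l = \<omega> * m" using v by simp
  then show ?thesis using \<omega>(1) by (simp add: power_mult_distrib)
qed

lemma hom_SL2R_preserving_polar_line_fixes_vector:
  assumes \<phi>: "\<phi> \<in> hom SL2R PSU_h" and v: "herm v > 0"
    and pres: "\<And>g. g \<in> \<phi> ` carrier SL2R \<Longrightarrow> act g ` polar_line v = polar_line v"
  shows "\<phi> ` carrier SL2R \<subseteq> PSU_vector_stabilizer v"
proof -
  have "v \<noteq> 0" using herm_nonzero_imp_nonzero[of v] v by simp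
  have "\<exists>A l. A \<in> carrier SU_h \<and> \<phi> X = PSU_class A \<and> A *v v = l *s v" if "det X = 1" for X
  proof -
    have "\<phi> X \<in> carrier PSU_h" using \<phi> that by (auto simp: hom_def carrier_SL2R)
    then obtain A where A: "A \<in> carrier SU_h" "\<phi> X = PSU_class A" by (auto simp: carrier_PSU_h)
    then have "polar_line v = polar_line (A *v v)"
      using pres[OF imageI[of X]] that act_polar_line[OF A(1)] by (simp add: carrier_SL2R)
    then show ?thesis using polar_line_eq_imp_proportional[OF v] A by metis
  qed
  then obtain A l where A: "\<And>X. det X = 1 \<Longrightarrow> A X \<in> carrier SU_h" "\<And>X. det X = 1 \<Longrightarrow> \<phi> X = PSU_class (A X)"
    and l: "\<And>X. det X = 1 \<Longrightarrow> A X *v v = l X *s v" by metis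
  have l_nonzero: "l X \<noteq> 0" if "det X = 1" for X
    using isometry_eigenvalue_nonzero[OF SU_h_isometry[OF A(1)] l \<open>v \<noteq> 0\<close>] that by blast
  have cube: "l X ^ 3 = 1" if "det X = 1" for X
  proof (rule SL2R_character_trivial[of "\<lambda>X. l X ^ 3"])
    fix X Y :: "real^2^2" assume XY: "det X = 1" "det Y = 1"
    then have det_XY: "det (X ** Y) = 1" by (simp add: det_mul)
    have "\<phi> (X ** Y) = \<phi> X \<otimes>\<^bsub>PSU_h\<^esub> \<phi> Y"
      using \<phi> XY by (auto simp: hom_def carrier_SL2R SL2R_mult)
    then have "PSU_class (A (X ** Y)) = PSU_class (A X ** A Y)"
      using A XY det_XY by (simp add: PSU_class_mult)
    moreover have "(A X ** A Y) *v v = (l Y * l X) *s v"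
      using l[OF XY(1)] l[OF XY(2)] by (simp add: vector_scalar_commute flip: matrix_vector_mul_assoc)
    ultimately have "l (X ** Y) ^ 3 = (l Y * l X) ^ 3"
      using eigenvalue_cube_eq_if_PSU_class_eq[OF _ l[OF det_XY] _ \<open>v \<noteq> 0\<close>] by blast
    then show "l (X ** Y) ^ 3 = l X ^ 3 * l Y ^ 3" by (simp add: power_mult_distrib)
  qed (use l_nonzero that in auto)
  show ?thesis
  proof (rule image_subsetI)
    fix X assume "X \<in> carrier SL2R"
    then have "det X = 1" by (simp add: carrier_SL2R)
    then show "\<phi> X \<in> PSU_vector_stabilizer v"
      using PSU_vector_stabilizerI[OF A(1) l cube] A(2) by simp
  qed
qed


subsection \<open>The stabilizer of a positive vector is a copy of \<open>SL\<^sub>2(\<real>)\<close>\<close>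

text \<open>The substitution \<open>z\<^sub>0 = \<i> y\<^sub>0\<close> turns \<open>- 2 Re (z\<^sub>0 cnj z\<^sub>2)\<close> into \<open>2 Im (y\<^sub>0 cnj y\<^sub>2)\<close>, which
  \<open>SL\<^sub>2(\<real>)\<close> preserves.\<close>

definition SL2_embed :: "real^2^2 \<Rightarrow> complex^3^3" where
  "SL2_embed X = vector [vector [of_real (X$1$1), 0, \<i> * of_real (X$1$2)], vector [0, 1, 0],
                   vector [- \<i> * of_real (X$2$1), 0, of_real (X$2$2)]]"

definition SL2_extract :: "complex^3^3 \<Rightarrow> real^2^2" where
  "SL2_extract A = (\<chi> i j. if i = 1 then (if j = 1 then Re (A$1$1) else Im (A$1$3))
                                    else (if j = 1 then - Im (A$3$1) else Re (A$3$3)))"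

lemma SL2_embed_nth [simp]:
  "SL2_embed X $ 1 $ 1 = of_real (X$1$1)" "SL2_embed X $ 1 $ 2 = 0" "SL2_embed X $ 1 $ 3 = \<i> * of_real (X$1$2)"
  "SL2_embed X $ 2 $ 1 = 0" "SL2_embed X $ 2 $ 2 = 1" "SL2_embed X $ 2 $ 3 = 0"
  "SL2_embed X $ 3 $ 1 = - \<i> * of_real (X$2$1)" "SL2_embed X $ 3 $ 2 = 0" "SL2_embed X $ 3 $ 3 = of_real (X$2$2)"
  by (simp_all add: SL2_embed_def)

lemma SL2_extract_embed: "SL2_extract (SL2_embed X) = X"
  by (simp add: mat_2_eq_iff SL2_extract_def)

lemma SL2_embed_mult: "SL2_embed (X ** Y) = SL2_embed X ** SL2_embed Y"
  by (simp add: vec_3_eq_iff matrix_matrix_mult_2 matrix_matrix_mult_3 algebra_simps)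

lemma SL2_embed_axis: "SL2_embed X *v axis 2 1 = axis 2 1"
  by (simp add: vec_3_eq_iff matrix_vector_mult_3 axis_def)

lemma SL2_embed_mem_SU_h: assumes "det X = 1" shows "SL2_embed X \<in> carrier SU_h"
proof -
  obtain p q r s where entries: "X $ 1 $ 1 = p" "X $ 1 $ 2 = q" "X $ 2 $ 1 = r" "X $ 2 $ 2 = s" by auto
  have det: "complex_of_real p * of_real s - of_real q * of_real r = 1"
    using assms entries by (simp add: det_2 flip: of_real_mult of_real_diff)
  then have "det (SL2_embed X) = 1" by (simp add: det_3 entries algebra_simps)
  moreover have "\<langle>SL2_embed X *v z, SL2_embed X *v z\<rangle>
      = (of_real p * of_real s - of_real q * of_real r) * (- (z$1) * cnj (z$3) - (z$3) * cnj (z$1)) + z$2 * cnj (z$2)" for z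
    by (simp add: hprod_def matrix_vector_mult_3 entries algebra_simps)
  then have "\<langle>SL2_embed X *v z, SL2_embed X *v z\<rangle> = \<langle>z, z\<rangle>" for z
    unfolding det by (simp add: hprod_def)
  then have "herm_isometry (SL2_embed X)" by (simp add: herm_isometry_def hprod_self)
  ultimately show ?thesis by (simp add: carrier_SU_h)
qed

lemma SL2_embed_extract:
  assumes A: "A \<in> carrier SU_h" and fixes_axis: "A *v axis 2 1 = axis 2 1"
  shows "A = SL2_embed (SL2_extract A)" "det (SL2_extract A) = 1"
proof -
  have "herm_adjoint A *v axis 2 1 = axis 2 1"
    using isometry_adjoint_eigenvector[OF SU_h_isometry[OF A], of "axis 2 1" 1] fixes_axis by simp
  then have middle: "A$1$2 = 0" "A$2$2 = 1" "A$3$2 = 0" "A$2$1 = 0" "A$2$3 = 0"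
    using fixes_axis by (simp_all add: vec_3_eq_iff matrix_vector_mult_3 herm_adjoint_def axis_def)
  obtain \<alpha> \<beta> \<gamma> \<delta> where corners: "A$1$1 = \<alpha>" "A$1$3 = \<beta>" "A$3$1 = \<gamma>" "A$3$3 = \<delta>" by auto
  have "(herm_adjoint A ** A) $ i $ j = mat 1 $ i $ j" for i j
    using herm_isometry_adjoint(1)[OF SU_h_isometry[OF A]] by simp
  from this[of 1 1] this[of 1 3] this[of 3 1] this[of 3 3]
  have unitary: "cnj \<delta> * \<alpha> + cnj \<beta> * \<gamma> = 1" "cnj \<delta> * \<beta> + cnj \<beta> * \<delta> = 0"
    "cnj \<gamma> * \<alpha> + cnj \<alpha> * \<gamma> = 0" "cnj \<gamma> * \<beta> + cnj \<alpha> * \<delta> = 1"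
    by (simp_all add: matrix_matrix_mult_3 herm_adjoint_def middle corners mat_def)
  have det: "\<alpha> * \<delta> - \<beta> * \<gamma> = 1" using A by (simp add: carrier_SU_h det_3 middle corners)
  have "cnj \<delta> = \<delta>" "cnj \<beta> = - \<beta>" "cnj \<gamma> = - \<gamma>" "cnj \<alpha> = \<alpha>" using unitary det by algebra+
  then have parts: "Im \<alpha> = 0" "Re \<beta> = 0" "Re \<gamma> = 0" "Im \<delta> = 0" by (auto simp: complex_eq_iff)
  then show "A = SL2_embed (SL2_extract A)"
    by (simp add: vec_3_eq_iff middle corners SL2_extract_def complex_eq_iff)
  have "Re \<alpha> * Re \<delta> - Im \<beta> * - Im \<gamma> = Re (\<alpha> * \<delta> - \<beta> * \<gamma>)" using parts by simp
  then show "det (SL2_extract A) = 1" using det by (simp add: SL2_extract_def det_2 corners)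
qed

definition SL2_embed_conj :: "complex^3^3 \<Rightarrow> real^2^2 \<Rightarrow> complex^3^3" where
  "SL2_embed_conj g X = g ** (SL2_embed X ** herm_adjoint g)"

definition SL2_extract_conj :: "complex^3^3 \<Rightarrow> complex^3^3 \<Rightarrow> real^2^2" where
  "SL2_extract_conj g A = SL2_extract (herm_adjoint g ** (A ** g))"

context
  fixes g :: "complex^3^3"
  assumes g: "g \<in> carrier SU_h"
begin

lemma SL2_extract_embed_conj: "SL2_extract_conj g (SL2_embed_conj g X) = X"
proof -
  have "herm_adjoint g ** (SL2_embed_conj g X ** g) = SL2_embed X ** (herm_adjoint g ** g)"
    by (simp add: SL2_embed_conj_def herm_isometry_adjoint_mult_mat[OF SU_h_isometry[OF g]]
        flip: matrix_mul_assoc)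
  then show ?thesis
    using herm_isometry_adjoint(1)[OF SU_h_isometry[OF g]]
    by (simp add: SL2_extract_conj_def SL2_extract_embed)
qed

lemma SL2_embed_conj_mem_SU_h: "det X = 1 \<Longrightarrow> SL2_embed_conj g X \<in> carrier SU_h"
  unfolding SL2_embed_conj_def by (intro SU_h_mult SU_h_adjoint SL2_embed_mem_SU_h g)

lemma SL2_embed_conj_mult: "SL2_embed_conj g (X ** Y) = SL2_embed_conj g X ** SL2_embed_conj g Y"
  by (simp add: SL2_embed_conj_def SL2_embed_mult herm_isometry_adjoint_mult_mat[OF SU_h_isometry[OF g]]
      flip: matrix_mul_assoc)

lemma SL2_embed_conj_fixes: "SL2_embed_conj g X *v (g *v axis 2 1) = g *v axis 2 1"
proof -
  have "SL2_embed_conj g X *v (g *v axis 2 1) = g *v (SL2_embed X *v (herm_adjoint g *v (g *v axis 2 1)))"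
    by (simp add: SL2_embed_conj_def matrix_vector_mul_assoc matrix_mul_assoc)
  then show ?thesis
    by (simp add: herm_isometry_adjoint_mult_vec[OF SU_h_isometry[OF g]] SL2_embed_axis)
qed

lemma SL2_embed_conj_onto:
  assumes A: "A \<in> carrier SU_h" "A *v (g *v axis 2 1) = g *v axis 2 1"
  obtains X where "det X = 1" "A = SL2_embed_conj g X"
proof -
  let ?B = "herm_adjoint g ** (A ** g)"
  have "?B *v axis 2 1 = herm_adjoint g *v (A *v (g *v axis 2 1))"
    by (simp add: matrix_vector_mul_assoc matrix_mul_assoc)
  then have "?B *v axis 2 1 = axis 2 1"
    using A(2) by (simp add: herm_isometry_adjoint_mult_vec[OF SU_h_isometry[OF g]])
  then have B: "?B = SL2_embed (SL2_extract ?B)" "det (SL2_extract ?B) = 1"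
    using A(1) g by (auto intro!: SL2_embed_extract SU_h_mult SU_h_adjoint)
  have "A = g ** (?B ** herm_adjoint g)"
    using herm_isometry_adjoint(2)[OF SU_h_isometry[OF g]]
    by (simp add: herm_isometry_adjoint_mult_mat[OF SU_h_isometry[OF g]] flip: matrix_mul_assoc)
  then have "A = SL2_embed_conj g (SL2_extract ?B)"
    unfolding SL2_embed_conj_def using B(1) by simp
  then show ?thesis using that B(2) by blast
qed

lemma image_SL2_embed_conj:
  assumes "g *v axis 2 1 = \<kappa> *s v" "\<kappa> \<noteq> 0"
  shows "(PSU_class \<circ> SL2_embed_conj g) ` carrier SL2R = PSU_vector_stabilizer v"
proof -
  have fixes_iff: "A *v (g *v axis 2 1) = g *v axis 2 1 \<longleftrightarrow> A *v v = v" for A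
    using assms by (simp add: vector_scalar_commute)
  show ?thesis
    unfolding PSU_vector_stabilizer_def fixes_iff[symmetric]
    using SL2_embed_conj_mem_SU_h SL2_embed_conj_fixes by (auto simp: carrier_SL2R elim: SL2_embed_conj_onto)
qed

lemma continuous_SL2_embed_conj: "continuous_on S (SL2_embed_conj g)"
proof -
  have "continuous_on S (\<lambda>X. (SL2_embed X) $ i $ j)" for i j
    using exhaust_3[of i] exhaust_3[of j] by (elim disjE) (simp_all add: continuous_intros)
  then have "continuous_on S SL2_embed" by (rule continuous_on_matrix_entries)
  then show ?thesis unfolding SL2_embed_conj_def by (intro continuous_intros)
qed

lemma continuous_SL2_extract_conj: "continuous_on S (SL2_extract_conj g)"
proof (rule continuous_on_matrix_entries)
  fix i j
  have "continuous_on S (\<lambda>A. (herm_adjoint g ** (A ** g)) $ k $ l)" for k l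
    by (intro continuous_intros)
  then show "continuous_on S (\<lambda>A. SL2_extract_conj g A $ i $ j)"
    unfolding SL2_extract_conj_def SL2_extract_def
    by (cases "i = 1"; cases "j = 1"; simp; intro continuous_intros)
qed

lemma closed_map_SL2_embed_conj:
  "closed_map (top_of_set (carrier SL2R)) (top_of_set (carrier SU_h)) (SL2_embed_conj g)"
  unfolding closed_map_def
proof (intro allI impI)
  fix C assume C: "closedin (top_of_set (carrier SL2R)) C"
  have "carrier SL2R = (\<lambda>X. det X) -` {1}" by (auto simp: carrier_SL2R)
  moreover have "continuous_on UNIV (\<lambda>X::real^2^2. det X)" unfolding det_2 by (intro continuous_intros)
  ultimately have "closed (carrier SL2R)"
    by (simp add: continuous_closed_vimage continuous_on_eq_continuous_at)
  then have "closed C" "C \<subseteq> carrier SL2R" using C by (auto simp: closedin_closed_eq)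
  have "SL2_embed_conj g ` C
      = {A. SL2_embed_conj g (SL2_extract_conj g A) = A} \<inter> SL2_extract_conj g -` C"
    by (auto simp: SL2_extract_embed_conj intro: rev_image_eqI)
  moreover have "closed {A. SL2_embed_conj g (SL2_extract_conj g A) = A}"
    using continuous_on_compose2[OF continuous_SL2_embed_conj continuous_SL2_extract_conj]
    by (intro closed_Collect_eq) auto
  moreover have "closed (SL2_extract_conj g -` C)"
    using \<open>closed C\<close> continuous_SL2_extract_conj by (intro closed_vimage) auto
  ultimately have "closed (SL2_embed_conj g ` C)" by auto
  moreover have "SL2_embed_conj g ` C \<subseteq> carrier SU_h"
    using \<open>C \<subseteq> carrier SL2R\<close> SL2_embed_conj_mem_SU_h by (auto simp: carrier_SL2R)
  ultimately show "closedin (top_of_set (carrier SU_h)) (SL2_embed_conj g ` C)"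
    by (intro closed_subset)
qed

lemma inj_PSU_class_SL2_embed_conj: "inj (PSU_class \<circ> SL2_embed_conj g)"
proof (rule injI)
  fix X Y assume "(PSU_class \<circ> SL2_embed_conj g) X = (PSU_class \<circ> SL2_embed_conj g) Y"
  then obtain \<omega> where \<omega>: "SL2_embed_conj g X = mat \<omega> ** SL2_embed_conj g Y"
    by (auto simp: PSU_class_eq_iff)
  have "axis 2 1 \<noteq> (0 :: complex^3)" by (simp add: axis_eq_0_iff)
  then have nonzero: "g *v axis 2 1 \<noteq> 0" using isometry_mult_vec_nonzero[OF SU_h_isometry[OF g]] by blast
  have "g *v axis 2 1 = \<omega> *s (g *v axis 2 1)"
    using SL2_embed_conj_fixes[of X] SL2_embed_conj_fixes[of Y] unfolding \<omega> mat_mult_mult_vec by simp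
  then have "\<omega> = 1" using nonzero by (metis vector_mul_rcancel vector_smult_lid)
  then have "SL2_embed_conj g X = SL2_embed_conj g Y" using \<omega> by simp
  then show "X = Y" using SL2_extract_embed_conj by metis
qed

lemma Lie_group_embedding_SL2_embed_conj: "Lie_group_embedding (PSU_class \<circ> SL2_embed_conj g)"
  unfolding Lie_group_embedding_def
proof (intro conjI injective_closed_imp_embedding_map)
  show "PSU_class \<circ> SL2_embed_conj g \<in> hom SL2R PSU_h"
    using SL2_embed_conj_mem_SU_h
    by (intro homI) (auto simp: carrier_SL2R SL2R_mult PSU_class_mem_carrier_iff PSU_class_mult SL2_embed_conj_mult)
  have "continuous_map (top_of_set (carrier SL2R)) (top_of_set (carrier SU_h)) (SL2_embed_conj g)"
    using continuous_SL2_embed_conj SL2_embed_conj_mem_SU_h by (auto simp: carrier_SL2R)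
  then show "continuous_map (top_of_set (carrier SL2R)) PSU_h_topology (PSU_class \<circ> SL2_embed_conj g)"
    using quotient_imp_continuous_map[OF quotient_map_PSU_class] by (rule continuous_map_compose)
  show "closed_map (top_of_set (carrier SL2R)) PSU_h_topology (PSU_class \<circ> SL2_embed_conj g)"
    using closed_map_SL2_embed_conj closed_map_PSU_class by (rule closed_map_compose)
  show "inj_on (PSU_class \<circ> SL2_embed_conj g) (topspace (top_of_set (carrier SL2R)))"
    using inj_PSU_class_SL2_embed_conj by (rule inj_on_subset) simp
qed

end

lemma SU_h_axis_to_positive:
  assumes "herm v > 0"
  obtains g \<kappa> where "g \<in> carrier SU_h" "\<kappa> \<noteq> 0" "g *v axis 2 1 = \<kappa> *s v"
proof -
  define r where "r = complex_of_real (sqrt (herm v))"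
  have r: "r \<noteq> 0" "(cmod r)\<^sup>2 = herm v" using assms by (simp_all add: r_def)
  have axis: "herm (axis 2 1) = 1" by (simp add: herm_def axis_def)
  moreover have "herm (inverse r *s v) = 1"
    using r assms by (simp add: herm_scale norm_inverse power_inverse)
  ultimately have norms: "herm (axis 2 1) = herm (inverse r *s v)" "herm (axis 2 1) \<noteq> 0" by simp_all
  obtain \<epsilon> B where \<epsilon>: "\<epsilon> = 1 \<or> \<epsilon> = -1"
    and B: "herm_isometry B" "B *v axis 2 1 = \<epsilon> *s (inverse r *s v)"
    using isometry_up_to_sign[OF norms] by blast
  obtain c where c: "c \<noteq> 0" "mat c ** B \<in> carrier SU_h" using isometry_scaled_SU_h[OF B(1)] .
  have "(mat c ** B) *v axis 2 1 = (c * \<epsilon> * inverse r) *s v"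
    unfolding mat_mult_mult_vec B(2) by simp
  moreover have "c * \<epsilon> * inverse r \<noteq> 0" using c(1) \<epsilon> r(1) by auto
  ultimately show ?thesis using that c(2) by blast
qed

lemma Lie_group_embedding_onto_PSU_vector_stabilizer:
  assumes "herm v > 0"
  obtains \<phi> where "Lie_group_embedding \<phi>" "\<phi> ` carrier SL2R = PSU_vector_stabilizer v"
proof -
  obtain g \<kappa> where "g \<in> carrier SU_h" "\<kappa> \<noteq> 0" "g *v axis 2 1 = \<kappa> *s v"
    using SU_h_axis_to_positive[OF assms] .
  then show ?thesis using that Lie_group_embedding_SL2_embed_conj image_SL2_embed_conj by blast
qed

section \<open>Stabilizers in the Picard modular group\<close>

lemma (in group) conjugate_by_member:
  assumes A: "subgroup A G" and g: "g \<in> A" shows "conjugate G g A = A"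
proof -
  note carrier = subgroup.subset[OF A] subgroup.mem_carrier[OF A g]
  have "x \<in> conjugate G g A \<longleftrightarrow> x \<in> A" if x: "x \<in> carrier G" for x
  proof
    assume "x \<in> A"
    then show "x \<in> conjugate G g A"
      using g A carrier x by (simp add: mem_conjugate_iff subgroup.m_closed subgroup.m_inv_closed)
  next
    assume "x \<in> conjugate G g A"
    then show "x \<in> A" using g A by (auto simp: conjugate_def subgroup.m_closed subgroup.m_inv_closed)
  qed
  moreover have "conjugate G g A \<subseteq> carrier G"
    using conjugate_subgroup[OF A carrier(2)] by (rule subgroup.subset)
  ultimately show ?thesis using carrier(1) by blast
qed

lemma subgroup_PSU_vector_stabilizer: "subgroup (PSU_vector_stabilizer v) PSU_h"
proof -
  interpret group PSU_h by (rule group_PSU_h)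
  show ?thesis
  proof (rule subgroupI)
    show "PSU_vector_stabilizer v \<subseteq> carrier PSU_h"
      by (auto simp: PSU_vector_stabilizer_def PSU_class_mem_carrier_iff)
    show "PSU_vector_stabilizer v \<noteq> {}"
      using SU_h_one by (auto simp: PSU_vector_stabilizer_def intro!: exI[of _ "mat 1"])
    fix a assume "a \<in> PSU_vector_stabilizer v"
    then obtain A where A: "A \<in> carrier SU_h" "A *v v = v" "a = PSU_class A" by (auto simp: PSU_vector_stabilizer_def)
    have "herm_adjoint A *v v = v" using herm_isometry_adjoint_mult_vec(1)[OF SU_h_isometry[OF A(1)], of v] A(2) by simp
    then show "inv\<^bsub>PSU_h\<^esub> a \<in> PSU_vector_stabilizer v"
      using SU_h_adjoint[OF A(1)] A by (auto simp: PSU_vector_stabilizer_def PSU_class_inv)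
    fix b assume "b \<in> PSU_vector_stabilizer v"
    then obtain B where B: "B \<in> carrier SU_h" "B *v v = v" "b = PSU_class B" by (auto simp: PSU_vector_stabilizer_def)
    have "(A ** B) *v v = v" using A B by (simp flip: matrix_vector_mul_assoc)
    then show "a \<otimes>\<^bsub>PSU_h\<^esub> b \<in> PSU_vector_stabilizer v"
      using A B SU_h_mult by (auto simp: PSU_vector_stabilizer_def PSU_class_mult)
  qed
qed

lemma PSU_vector_stabilizer_scale:
  assumes "c \<noteq> 0" shows "PSU_vector_stabilizer (c *s v) = PSU_vector_stabilizer v"
  using assms by (simp add: PSU_vector_stabilizer_def vector_scalar_commute)

lemma conjugate_PSU_vector_stabilizer:
  assumes g: "g \<in> carrier SU_h"
  shows "conjugate PSU_h (PSU_class g) (PSU_vector_stabilizer v) = PSU_vector_stabilizer (g *v v)"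
proof -
  have conj: "PSU_class g \<otimes>\<^bsub>PSU_h\<^esub> PSU_class A \<otimes>\<^bsub>PSU_h\<^esub> inv\<^bsub>PSU_h\<^esub> PSU_class g = PSU_class (g ** (A ** herm_adjoint g))"
    if "A \<in> carrier SU_h" for A
    using PSU_class_conjugate_scaled[OF SU_h_isometry[OF g], of 1 A] g that by simp
  note adjoint_vec = herm_isometry_adjoint_mult_vec[OF SU_h_isometry[OF g]]
    and adjoint_mat = herm_isometry_adjoint_mult_mat[OF SU_h_isometry[OF g]]
  show ?thesis
  proof
    show "conjugate PSU_h (PSU_class g) (PSU_vector_stabilizer v) \<subseteq> PSU_vector_stabilizer (g *v v)"
    proof
      fix x assume "x \<in> conjugate PSU_h (PSU_class g) (PSU_vector_stabilizer v)"
      then obtain A where A: "A \<in> carrier SU_h" "A *v v = v" "x = PSU_class (g ** (A ** herm_adjoint g))"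
        by (auto simp: conjugate_def PSU_vector_stabilizer_def conj)
      moreover have "(g ** (A ** herm_adjoint g)) *v (g *v v) = g *v v"
        using A(2) by (simp add: adjoint_vec flip: matrix_vector_mul_assoc)
      moreover have "g ** (A ** herm_adjoint g) \<in> carrier SU_h" by (intro SU_h_mult SU_h_adjoint g A(1))
      ultimately show "x \<in> PSU_vector_stabilizer (g *v v)" unfolding PSU_vector_stabilizer_def by blast
    qed
    show "PSU_vector_stabilizer (g *v v) \<subseteq> conjugate PSU_h (PSU_class g) (PSU_vector_stabilizer v)"
    proof
      fix x assume "x \<in> PSU_vector_stabilizer (g *v v)"
      then obtain B where B: "B \<in> carrier SU_h" "B *v (g *v v) = g *v v" "x = PSU_class B"
        by (auto simp: PSU_vector_stabilizer_def)
      let ?A = "herm_adjoint g ** (B ** g)"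
      have A: "?A \<in> carrier SU_h" by (intro SU_h_mult SU_h_adjoint g B(1))
      have "?A *v v = v" using B(2) by (simp add: adjoint_vec flip: matrix_vector_mul_assoc)
      then have "PSU_class ?A \<in> PSU_vector_stabilizer v" using A unfolding PSU_vector_stabilizer_def by blast
      moreover have "g ** (?A ** herm_adjoint g) = B"
        using herm_isometry_adjoint(2)[OF SU_h_isometry[OF g]] by (simp add: adjoint_mat flip: matrix_mul_assoc)
      ultimately show "x \<in> conjugate PSU_h (PSU_class g) (PSU_vector_stabilizer v)"
        using conj[OF A] B(3) unfolding conjugate_def by force
    qed
  qed
qed

definition PSU_line_stabilizer :: "complex^3 \<Rightarrow> (complex^3^3) set set" where
  "PSU_line_stabilizer v = {g \<in> carrier PSU_h. act g (proj v) = proj v}"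

lemma PSU_class_mem_PSU_line_stabilizer:
  assumes "A \<in> carrier SU_h" "v \<noteq> 0"
  shows "PSU_class A \<in> PSU_line_stabilizer v \<longleftrightarrow> (\<exists>c. A *v v = c *s v)"
  using assms by (simp add: PSU_line_stabilizer_def act_PSU_class_fixes_iff PSU_class_mem_carrier_iff)

lemma PSU_vector_stabilizer_subset_line:
  "PSU_vector_stabilizer v \<subseteq> PSU_line_stabilizer v"
  by (auto simp: PSU_vector_stabilizer_def PSU_line_stabilizer_def PSU_class_mem_carrier_iff act_PSU_class)

lemma subgroup_PSU_line_stabilizer:
  assumes v: "v \<noteq> 0" shows "subgroup (PSU_line_stabilizer v) PSU_h"
proof -
  interpret group PSU_h by (rule group_PSU_h)
  have class_rep: "\<exists>A c. A \<in> carrier SU_h \<and> A *v v = c *s v \<and> a = PSU_class A" if a: "a \<in> PSU_line_stabilizer v" for a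
  proof -
    obtain A where A: "A \<in> carrier SU_h" "a = PSU_class A"
      using a by (auto simp: PSU_line_stabilizer_def carrier_PSU_h)
    then show ?thesis using a PSU_class_mem_PSU_line_stabilizer[OF A(1) v] by blast
  qed
  show ?thesis
  proof (rule subgroupI)
    show "PSU_line_stabilizer v \<subseteq> carrier PSU_h" by (auto simp: PSU_line_stabilizer_def)
    show "PSU_line_stabilizer v \<noteq> {}"
      using PSU_vector_stabilizer_subset_line subgroup.one_closed[OF subgroup_PSU_vector_stabilizer] by blast
    fix a assume "a \<in> PSU_line_stabilizer v"
    then obtain A c where A: "A \<in> carrier SU_h" "A *v v = c *s v" "a = PSU_class A" using class_rep by blast
    note isometry = SU_h_isometry[OF A(1)]
    have "herm_adjoint A *v v = inverse c *s v"
      using isometry A(2) isometry_eigenvalue_nonzero[OF isometry A(2) v] by (rule isometry_adjoint_eigenvector)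
    then show "inv\<^bsub>PSU_h\<^esub> a \<in> PSU_line_stabilizer v"
      using A(1,3) v by (auto simp: PSU_class_inv SU_h_adjoint PSU_class_mem_PSU_line_stabilizer)
    fix b assume "b \<in> PSU_line_stabilizer v"
    then obtain B c' where B: "B \<in> carrier SU_h" "B *v v = c' *s v" "b = PSU_class B" using class_rep by blast
    have "(A ** B) *v v = (c' * c) *s v" by (simp add: A(2) B(2) vector_scalar_commute flip: matrix_vector_mul_assoc)
    then show "a \<otimes>\<^bsub>PSU_h\<^esub> b \<in> PSU_line_stabilizer v"
      using A(1,3) B(1,3) v by (auto simp: PSU_class_mult SU_h_mult PSU_class_mem_PSU_line_stabilizer)
  qed
qed

lemma mult_frame_mat: "A ** frame_mat a b c = frame_mat (A *v a) (A *v b) (A *v c)"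
  unfolding matrix_eq
  by (simp add: frame_mat_mult_vec matrix_vector_right_distrib vector_scalar_commute flip: matrix_vector_mul_assoc)

lemma frame_mat_nth [simp]:
  "frame_mat a b c $ i $ 1 = a $ i" "frame_mat a b c $ i $ 2 = b $ i" "frame_mat a b c $ i $ 3 = c $ i"
  by (simp_all add: frame_mat_def transpose_def)

lemma isometry_third_eigenvector:
  assumes frame: "orthogonal_frame a b c" and A: "herm_isometry A" and ab: "A *v a = \<alpha> *s a" "A *v b = \<beta> *s b"
  obtains \<gamma> where "A *v c = \<gamma> *s c"
proof -
  have orth: "\<langle>A *v c, x\<rangle> = 0" if "A *v x = l *s x" "\<langle>c, x\<rangle> = 0" "herm x \<noteq> 0" for x l
  proof -
    have "cnj l * \<langle>A *v c, x\<rangle> = 0" using herm_isometry_hprod[OF A, of c x] that(1,2) by simp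
    moreover have "l \<noteq> 0" using herm_isometry_eigenvalue[OF A that(1,3)] by auto
    ultimately show ?thesis by simp
  qed
  have "\<langle>A *v c, a\<rangle> = 0" "\<langle>A *v c, b\<rangle> = 0"
    using orth[OF ab(1)] orth[OF ab(2)] orthogonal_frameD[OF frame] by auto
  then have "A *v c = (\<langle>A *v c, c\<rangle> / of_real (herm c)) *s c"
    using orthogonal_frame_expansion[OF frame, of "A *v c"] by simp
  then show ?thesis by (rule that)
qed

lemma diagonal_isometry_entry_bound:
  assumes frame: "orthogonal_frame a b c" and A: "herm_isometry A"
    and eigen: "A *v a = \<alpha> *s a" "A *v b = \<beta> *s b" "A *v c = \<gamma> *s c"
  shows "cmod (A $ i $ j) \<le> (\<Sum>k\<in>UNIV. cmod (frame_mat a b c $ i $ k) * cmod (coframe_mat a b c $ k $ j))"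
proof -
  have "A = (A ** frame_mat a b c) ** coframe_mat a b c"
    using coframe_mat_frame_mat(2)[OF frame] by (simp flip: matrix_mul_assoc)
  then have "A $ i $ j = (\<Sum>k\<in>UNIV. (A ** frame_mat a b c) $ i $ k * coframe_mat a b c $ k $ j)"
    by (metis (no_types, lifting) matrix_matrix_mult_def vec_lambda_beta sum.cong)
  moreover have "cmod \<alpha> = 1" "cmod \<beta> = 1" "cmod \<gamma> = 1"
    using herm_isometry_eigenvalue[OF A] eigen orthogonal_frameD[OF frame] by auto
  then have "cmod ((A ** frame_mat a b c) $ i $ k) = cmod (frame_mat a b c $ i $ k)" for k
    using exhaust_3[of k] by (auto simp: mult_frame_mat eigen norm_mult)
  ultimately show ?thesis by (auto intro: sum_norm_le simp: norm_mult)
qed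

context imaginary_quadratic
begin

lemma Picard_eq: "Picard K = PSU_class ` (carrier SU_h \<inter> mats_over \<O>)"
  by (auto simp: Picard_def PSU_class_def mem_mats_over)

lemma subgroup_Picard: "subgroup (Picard K) PSU_h"
proof -
  interpret group PSU_h by (rule group_PSU_h)
  show ?thesis
  proof (rule subgroupI)
    show "Picard K \<subseteq> carrier PSU_h" by (auto simp: Picard_eq PSU_class_mem_carrier_iff)
    show "Picard K \<noteq> {}" using SU_h_one integers.mat_one_mem_mats_over by (auto simp: Picard_eq)
    fix a assume "a \<in> Picard K"
    then obtain A where A: "A \<in> carrier SU_h" "A \<in> mats_over \<O>" "a = PSU_class A" by (auto simp: Picard_eq)
    then show "inv\<^bsub>PSU_h\<^esub> a \<in> Picard K"
      by (simp add: Picard_eq PSU_class_inv SU_h_adjoint integers.herm_adjoint_mem_mats_over)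
    fix b assume "b \<in> Picard K"
    then obtain B where B: "B \<in> carrier SU_h" "B \<in> mats_over \<O>" "b = PSU_class B" by (auto simp: Picard_eq)
    show "a \<otimes>\<^bsub>PSU_h\<^esub> b \<in> Picard K"
      using A B by (simp add: Picard_eq PSU_class_mult SU_h_mult integers.mats_over_mult)
  qed
qed

lemma Picard_subset_carrier: "Picard K \<subseteq> carrier PSU_h"
  by (rule subgroup.subset[OF subgroup_Picard])

lemma Picard_stab_eq: "Picard_stab K n = Picard K \<inter> PSU_line_stabilizer (vector [- of_nat n, 0, 1])"
  using Picard_subset_carrier by (auto simp: Picard_stab_def PSU_line_stabilizer_def)

definition Picard_vector_stabilizer :: "complex^3 \<Rightarrow> (complex^3^3) set set" where
  "Picard_vector_stabilizer v = Picard K \<inter> PSU_vector_stabilizer v"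

lemma subgroup_Picard_vector_stabilizer: "subgroup (Picard_vector_stabilizer v) PSU_h"
  unfolding Picard_vector_stabilizer_def
  by (rule group.subgroups_Inter_pair[OF group_PSU_h subgroup_Picard subgroup_PSU_vector_stabilizer])

lemma conjugate_Picard_vector_stabilizer:
  assumes "g \<in> carrier SU_h" "g \<in> mats_over \<O>"
  shows "conjugate PSU_h (PSU_class g) (Picard_vector_stabilizer v) = Picard_vector_stabilizer (g *v v)"
proof -
  interpret group PSU_h by (rule group_PSU_h)
  have "PSU_class g \<in> Picard K" using assms by (auto simp: Picard_eq)
  moreover have "PSU_class g \<in> carrier PSU_h" using assms(1) by (simp add: PSU_class_mem_carrier_iff)
  ultimately show ?thesis
    unfolding Picard_vector_stabilizer_def
    by (simp add: conjugate_Int[OF Picard_subset_carrier subgroup.subset[OF subgroup_PSU_vector_stabilizer]]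
        conjugate_by_member[OF subgroup_Picard] conjugate_PSU_vector_stabilizer[OF assms(1)])
qed

lemma C_Fuchsian_Picard_vector_stabilizer:
  assumes "herm v > 0" shows "C_Fuchsian K (Picard_vector_stabilizer v)"
proof -
  obtain \<phi> where \<phi>: "Lie_group_embedding \<phi>" "\<phi> ` carrier SL2R = PSU_vector_stabilizer v"
    using Lie_group_embedding_onto_PSU_vector_stabilizer[OF assms] .
  have "act g ` polar_line v = polar_line v" if g: "g \<in> PSU_vector_stabilizer v" for g
  proof -
    obtain A where "A \<in> carrier SU_h" "A *v v = v" "g = PSU_class A"
      using g by (auto simp: PSU_vector_stabilizer_def)
    then show ?thesis using act_polar_line[of A v] by simp
  qed
  then show ?thesis
    unfolding C_Fuchsian_def Picard_vector_stabilizer_def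
    using \<phi> projective_line_polar_line[OF assms] polar_line_meets_H2C[OF assms]
    by (intro exI[of _ \<phi>] exI[of _ "polar_line v"]) simp
qed

lemma C_Fuchsian_subset_Picard_vector_stabilizer:
  assumes "C_Fuchsian K \<Gamma>"
  obtains v where "herm v > 0" "\<Gamma> \<subseteq> Picard_vector_stabilizer v" "subgroup \<Gamma> PSU_h"
proof -
  obtain \<phi> L where \<phi>: "Lie_group_embedding \<phi>" "projective_line L" "L \<inter> H2C \<noteq> {}"
    "\<forall>g \<in> \<phi> ` carrier SL2R. act g ` L = L" "\<Gamma> = Picard K \<inter> \<phi> ` carrier SL2R"
    using assms by (auto simp: C_Fuchsian_def)
  have hom: "\<phi> \<in> hom SL2R PSU_h" using \<phi>(1) by (simp add: Lie_group_embedding_def)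
  obtain v where v: "herm v > 0" "L = polar_line v"
    using projective_line_meeting_H2C_is_polar[OF \<phi>(2,3)] .
  have "\<phi> ` carrier SL2R \<subseteq> PSU_vector_stabilizer v"
    using hom v(1) \<phi>(4) unfolding v(2) by (intro hom_SL2R_preserving_polar_line_fixes_vector) auto
  then have "\<Gamma> \<subseteq> Picard_vector_stabilizer v" unfolding \<phi>(5) Picard_vector_stabilizer_def by blast
  moreover have "group_hom SL2R PSU_h \<phi>"
    using hom group_SL2R group_PSU_h by (simp add: group_hom_def group_hom_axioms_def)
  then have "subgroup (\<phi> ` carrier SL2R) PSU_h" by (rule group_hom.img_is_subgroup)
  then have "subgroup \<Gamma> PSU_h"
    unfolding \<phi>(5) by (rule group.subgroups_Inter_pair[OF group_PSU_h subgroup_Picard])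
  ultimately show ?thesis using that v(1) by blast
qed

lemma finite_Picard_fixing_two_orthogonal_lines:
  assumes frame: "orthogonal_frame a b c"
  shows "finite (Picard K \<inter> PSU_line_stabilizer a \<inter> PSU_line_stabilizer b)"
proof -
  define r where "r i j = (\<Sum>k\<in>UNIV. cmod (frame_mat a b c $ i $ k) * cmod (coframe_mat a b c $ k $ j))" for i j
  define bound where "bound = (\<Sum>i\<in>UNIV. \<Sum>j\<in>UNIV. r i j)"
  have "r i j \<le> bound" for i j
  proof -
    have nonneg: "0 \<le> r i j" for i j unfolding r_def by (intro sum_nonneg) auto
    then have "r i j \<le> (\<Sum>j\<in>UNIV. r i j)" by (intro member_le_sum) auto
    also have "\<dots> \<le> bound" unfolding bound_def using nonneg by (intro member_le_sum) (auto intro: sum_nonneg)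
    finally show ?thesis .
  qed
  note le_bound = order_trans[OF diagonal_isometry_entry_bound[OF frame, folded r_def] this]
  have "Picard K \<inter> PSU_line_stabilizer a \<inter> PSU_line_stabilizer b \<subseteq> PSU_class ` mats_over {x \<in> \<O>. cmod x \<le> bound}"
  proof
    fix g assume g: "g \<in> Picard K \<inter> PSU_line_stabilizer a \<inter> PSU_line_stabilizer b"
    then obtain A where A: "A \<in> carrier SU_h" "A \<in> mats_over \<O>" "g = PSU_class A" by (auto simp: Picard_eq)
    have "a \<noteq> 0" "b \<noteq> 0" using orthogonal_frameD(7,8)[OF frame] by (auto dest: herm_nonzero_imp_nonzero)
    then obtain \<alpha> \<beta> where ab: "A *v a = \<alpha> *s a" "A *v b = \<beta> *s b"
      using g PSU_class_mem_PSU_line_stabilizer[OF A(1)] unfolding A(3) by blast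
    obtain \<gamma> where "A *v c = \<gamma> *s c" using isometry_third_eigenvector[OF frame SU_h_isometry[OF A(1)] ab] .
    then have "cmod (A $ i $ j) \<le> bound" for i j using le_bound[OF SU_h_isometry[OF A(1)] ab] by blast
    then have "A \<in> mats_over {x \<in> \<O>. cmod x \<le> bound}" using A(2) by (simp add: mem_mats_over)
    then show "g \<in> PSU_class ` mats_over {x \<in> \<O>. cmod x \<le> bound}" using A(3) by blast
  qed
  then show ?thesis
    by (rule finite_subset) (intro finite_imageI finite_mats_over finite_integers_disc)
qed

lemma PSU_vector_stabilizer_Int_line_stabilizer_subset:
  assumes "\<langle>v, z\<rangle> \<noteq> 0"
  shows "PSU_vector_stabilizer v \<inter> PSU_line_stabilizer z \<subseteq> PSU_vector_stabilizer z"
proof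
  fix g assume g: "g \<in> PSU_vector_stabilizer v \<inter> PSU_line_stabilizer z"
  then obtain A where A: "A \<in> carrier SU_h" "A *v v = v" "g = PSU_class A"
    by (auto simp: PSU_vector_stabilizer_def)
  have "z \<noteq> 0" using assms by auto
  then obtain c where c: "A *v z = c *s z"
    using g PSU_class_mem_PSU_line_stabilizer[OF A(1)] unfolding A(3) by blast
  have "cnj c * \<langle>v, z\<rangle> = \<langle>v, z\<rangle>" using herm_isometry_hprod[OF SU_h_isometry[OF A(1)], of v z] A(2) c by simp
  then have "A *v z = z" using assms c by simp
  then show "g \<in> PSU_vector_stabilizer z" using A by (auto simp: PSU_vector_stabilizer_def)
qed

text \<open>\<open>\<Gamma>\<close> fixes some positive vector \<open>v\<close>. If \<open>v\<close> were orthogonal to \<open>z\<close>, then \<open>\<Gamma>\<close> would be finite; otherwise the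
  eigenvalues on \<open>z\<close> and \<open>v\<close> agree. Whether \<open>v\<close> and \<open>z\<close> are proportional is immaterial.\<close>

lemma maximal_nonelementary_C_Fuchsian_eq:
  assumes max: "maximal_nonelementary_C_Fuchsian K \<Gamma>" and z: "herm z > 0"
    and fixes_z: "\<And>g. g \<in> \<Gamma> \<Longrightarrow> act g (proj z) = proj z"
  shows "\<Gamma> = Picard_vector_stabilizer z"
proof -
  interpret group PSU_h by (rule group_PSU_h)
  have nonelementary: "C_Fuchsian K \<Gamma>" "\<not> virtually_cyclic PSU_h \<Gamma>"
    using max by (auto simp: maximal_nonelementary_C_Fuchsian_def nonelementary_C_Fuchsian_def)
  obtain v where v: "herm v > 0" "\<Gamma> \<subseteq> Picard_vector_stabilizer v" "subgroup \<Gamma> PSU_h"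
    using C_Fuchsian_subset_Picard_vector_stabilizer[OF nonelementary(1)] .
  have line_z: "\<Gamma> \<subseteq> PSU_line_stabilizer z"
    using fixes_z subgroup.mem_carrier[OF v(3)] by (auto simp: PSU_line_stabilizer_def)
  have "\<langle>v, z\<rangle> \<noteq> 0"
  proof
    assume "\<langle>v, z\<rangle> = 0"
    then have "orthogonal_frame v z (herm_cross v z)" using v(1) z by (intro orthogonal_frame_herm_cross) auto
    then have "finite (Picard K \<inter> PSU_line_stabilizer v \<inter> PSU_line_stabilizer z)"
      by (rule finite_Picard_fixing_two_orthogonal_lines)
    moreover have "\<Gamma> \<subseteq> Picard K \<inter> PSU_line_stabilizer v \<inter> PSU_line_stabilizer z"
      using v(2) line_z PSU_vector_stabilizer_subset_line[of v]
      unfolding Picard_vector_stabilizer_def by blast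
    ultimately have "finite \<Gamma>" by (rule finite_subset[rotated])
    then show False using virtually_cyclic_finite[OF v(3)] nonelementary(2) by blast
  qed
  then have sub: "\<Gamma> \<subseteq> Picard_vector_stabilizer z"
    using v(2) line_z PSU_vector_stabilizer_Int_line_stabilizer_subset[of v z]
    by (auto simp: Picard_vector_stabilizer_def)
  have "\<not> virtually_cyclic PSU_h (Picard_vector_stabilizer z)"
    using virtually_cyclic_subgroup[OF _ subgroup_Picard_vector_stabilizer v(3) sub] nonelementary(2) by blast
  then have "nonelementary_C_Fuchsian K (Picard_vector_stabilizer z)"
    using C_Fuchsian_Picard_vector_stabilizer[OF z] by (simp add: nonelementary_C_Fuchsian_def)
  then show ?thesis using max sub by (auto simp: maximal_nonelementary_C_Fuchsian_def)
qed

lemma max_C_Fuchsian_of_discriminantE: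
  assumes "\<Gamma> \<in> max_C_Fuchsian_of_discriminant K D" "D > 0"
  obtains z where "z \<in> vecs_over \<O>" "herm z = real D" "\<Gamma> = Picard_vector_stabilizer z"
proof -
  obtain z where z: "\<forall>i. z $ i \<in> \<O>" "{p \<in> P2 K. \<forall>g\<in>\<Gamma>. act g p = p} = {proj z}" "herm z = real D"
    using assms(1) by (auto simp: max_C_Fuchsian_of_discriminant_def has_discriminant_def)
  have "act g (proj z) = proj z" if "g \<in> \<Gamma>" for g using z(2) that by blast
  moreover have "maximal_nonelementary_C_Fuchsian K \<Gamma>" using assms(1) by (simp add: max_C_Fuchsian_of_discriminant_def)
  ultimately have "\<Gamma> = Picard_vector_stabilizer z"
    using z(3) assms(2) by (intro maximal_nonelementary_C_Fuchsian_eq) auto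
  then show ?thesis using that z by (auto simp: vecs_over_def)
qed

end

section \<open>Commensurability\<close>

lemma matrix_add_rdistrib:
  fixes A B :: "'a::semiring_1^'n^'m"
  shows "(A + B) ** C = A ** C + B ** C"
  by (simp add: vec_eq_iff matrix_matrix_mult_def sum.distrib distrib_right)

context imaginary_quadratic
begin

lemma matrix_common_denominator:
  fixes A :: "complex^3^3"
  assumes "A \<in> mats_over K"
  obtains N :: nat where "N > 0" "mat (of_nat N) ** A \<in> mats_over \<O>"
proof -
  have "finite (range (\<lambda>(i, j). A $ i $ j))" by simp
  moreover have "range (\<lambda>(i, j). A $ i $ j) \<subseteq> K" using assms by (auto simp: mem_mats_over)
  ultimately obtain N :: nat where "N > 0" "\<forall>x\<in>range (\<lambda>(i, j). A $ i $ j). of_nat N * x \<in> quadratic_order"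
    using common_denominator_exists by blast
  then have "mat (of_nat N) ** A \<in> mats_over \<O>"
    using quadratic_order_subset_integers by (auto simp: mem_mats_over mat_mult_nth)
  then show ?thesis using that \<open>N > 0\<close> by blast
qed

definition mats_cong :: "nat \<Rightarrow> complex^3^3 \<Rightarrow> complex^3^3 \<Rightarrow> bool" where
  "mats_cong m A B \<longleftrightarrow> (\<exists>W\<in>mats_over \<O>. A = B + mat (of_nat m) ** W)"

lemma finitely_many_matrix_residues:
  assumes "m > 0" shows "finitely_many_classes (mats_over \<O>) (mats_cong m)"
proof (rule finitely_many_classes_mono)
  show "finitely_many_classes (mats_over \<O> :: (complex^3^3) set) (\<lambda>A B. \<forall>i j. integers_cong m (A $ i $ j) (B $ i $ j))"
    by (rule finitely_many_classes_mats_over[OF finitely_many_integers_residues[OF assms]])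
  fix A B :: "complex^3^3" assume "\<forall>i j. integers_cong m (A $ i $ j) (B $ i $ j)"
  then obtain w where w: "\<And>i j. w i j \<in> \<O> \<and> A $ i $ j - B $ i $ j = of_nat m * w i j"
    unfolding integers_cong_def by metis
  have "A $ i $ j = B $ i $ j + of_nat m * w i j" for i j using w[of i j] by (simp add: algebra_simps)
  then have "A = B + mat (of_nat m) ** (\<chi> i j. w i j)" by (simp add: vec_eq_iff mat_mult_nth)
  moreover have "(\<chi> i j. w i j) \<in> mats_over \<O>" using w by (simp add: mem_mats_over)
  ultimately show "mats_cong m A B" unfolding mats_cong_def by blast
qed

lemma conjugate_quotient_integral_if_cong:
  fixes P Q :: "complex^3^3"
  assumes B: "B \<in> carrier SU_h" "B \<in> mats_over \<O>" and cong: "mats_cong (N * N) A B"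
    and P: "mat (of_nat N) ** P \<in> mats_over \<O>" and Q: "mat (of_nat N) ** Q \<in> mats_over \<O>" and PQ: "P ** Q = mat 1"
  shows "P ** ((A ** herm_adjoint B) ** Q) \<in> mats_over \<O>"
proof -
  obtain W where W: "W \<in> mats_over \<O>" "A = B + mat (of_nat (N * N)) ** W"
    using cong unfolding mats_cong_def by blast
  define V where "V = W ** herm_adjoint B"
  have "A ** herm_adjoint B = mat 1 + mat (of_nat (N * N)) ** V"
    using herm_isometry_adjoint(2)[OF SU_h_isometry[OF B(1)]]
    by (simp add: W(2) V_def matrix_add_rdistrib matrix_mul_assoc)
  moreover have "P ** ((mat 1 + mat (of_nat (N * N)) ** V) ** Q)
      = P ** Q + P ** ((mat (of_nat (N * N)) ** V) ** Q)"
    by (simp add: matrix_add_ldistrib matrix_add_rdistrib)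
  moreover have "P ** ((mat (of_nat (N * N)) ** V) ** Q) = (mat (of_nat N) ** P) ** (V ** (mat (of_nat N) ** Q))"
    by (simp add: mult_mat_mult[of P] mult_mat_mult[of V] mat_mult_mat_mult flip: matrix_mul_assoc)
  ultimately have "P ** ((A ** herm_adjoint B) ** Q) = mat 1 + (mat (of_nat N) ** P) ** (V ** (mat (of_nat N) ** Q))"
    by (simp only: PQ)
  then show ?thesis
    using W(1) B(2) P Q unfolding V_def
    by (simp add: integers.mats_over_add integers.mat_one_mem_mats_over integers.mats_over_mult
        integers.herm_adjoint_mem_mats_over)
qed

text \<open>The classes of multiples of isometries with entries in \<open>K\<close>: scaling an isometry into \<open>SU\<^sub>h\<close>
  may require a scalar outside \<open>K\<close>.\<close>

definition rational_classes :: "(complex^3^3) set set" where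
  "rational_classes = {PSU_class (mat c ** T) | c T.
     mat c ** T \<in> carrier SU_h \<and> herm_isometry T \<and> T \<in> mats_over K}"

lemma rational_classes_subset_carrier: "rational_classes \<subseteq> carrier PSU_h"
  by (auto simp: rational_classes_def PSU_class_mem_carrier_iff)

lemma inv_mem_rational_classes:
  assumes "g \<in> rational_classes" shows "inv\<^bsub>PSU_h\<^esub> g \<in> rational_classes"
proof -
  obtain c T where T: "mat c ** T \<in> carrier SU_h" "herm_isometry T" "T \<in> mats_over K" "g = PSU_class (mat c ** T)"
    using assms by (auto simp: rational_classes_def)
  then have "inv\<^bsub>PSU_h\<^esub> g = PSU_class (mat (cnj c) ** herm_adjoint T)"
    by (simp add: PSU_class_inv herm_adjoint_mat_mult)
  moreover have "mat (cnj c) ** herm_adjoint T \<in> carrier SU_h"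
    using SU_h_adjoint[OF T(1)] by (simp add: herm_adjoint_mat_mult)
  ultimately show ?thesis
    unfolding rational_classes_def
    using herm_isometry_adjoint(3)[OF T(2)] K.herm_adjoint_mem_mats_over[OF T(3)] by blast
qed

lemma matrix_adjoint_common_denominator:
  assumes "T \<in> mats_over K"
  obtains N :: nat where "N > 0" "mat (of_nat N) ** T \<in> mats_over \<O>" "mat (of_nat N) ** herm_adjoint T \<in> mats_over \<O>"
proof -
  obtain M M' :: nat where M: "M > 0" "mat (of_nat M) ** T \<in> mats_over \<O>"
    and M': "M' > 0" "mat (of_nat M') ** herm_adjoint T \<in> mats_over \<O>"
    using matrix_common_denominator[OF assms] matrix_common_denominator[OF K.herm_adjoint_mem_mats_over[OF assms]]
    by metis
  have "mat (of_nat (M * M')) ** T = mat (of_nat M') ** (mat (of_nat M) ** T)"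
    "mat (of_nat (M * M')) ** herm_adjoint T = mat (of_nat M) ** (mat (of_nat M') ** herm_adjoint T)"
    by (simp_all add: mat_mult_mat_mult mult.commute)
  then show ?thesis using that[of "M * M'"] M M' by (simp add: integers.mats_over_scale)
qed

text \<open>Conjugation by \<open>T\<close> preserves integrality on a congruence subgroup.\<close>

lemma rational_class_commensurates_Picard:
  assumes "g \<in> rational_classes"
  shows "finitely_many_classes (Picard K)
    (\<lambda>x y. g \<otimes>\<^bsub>PSU_h\<^esub> (x \<otimes>\<^bsub>PSU_h\<^esub> inv\<^bsub>PSU_h\<^esub> y) \<otimes>\<^bsub>PSU_h\<^esub> inv\<^bsub>PSU_h\<^esub> g \<in> Picard K)"
proof -
  obtain c T where T: "mat c ** T \<in> carrier SU_h" "herm_isometry T" "T \<in> mats_over K" "g = PSU_class (mat c ** T)"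
    using assms by (auto simp: rational_classes_def)
  obtain N where "N > 0" and N: "mat (of_nat N) ** T \<in> mats_over \<O>" "mat (of_nat N) ** herm_adjoint T \<in> mats_over \<O>"
    using matrix_adjoint_common_denominator[OF T(3)] .
  have "finitely_many_classes (mats_over \<O>) (mats_cong (N * N))"
    using \<open>N > 0\<close> by (intro finitely_many_matrix_residues) simp
  then show ?thesis
    unfolding Picard_eq
  proof (intro finitely_many_classes_image, elim finitely_many_classes_map[where f = "\<lambda>X. X"])
    fix X Y
    assume X: "X \<in> carrier SU_h \<inter> mats_over \<O>" and Y: "Y \<in> carrier SU_h \<inter> mats_over \<O>" and "mats_cong (N * N) X Y"
    let ?Q = "X ** herm_adjoint Y"
    have integral: "T ** (?Q ** herm_adjoint T) \<in> mats_over \<O>"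
      using Y \<open>mats_cong (N * N) X Y\<close> N herm_isometry_adjoint(2)[OF T(2)]
      by (intro conjugate_quotient_integral_if_cong) auto
    have Q: "?Q \<in> carrier SU_h" using X Y by (simp add: SU_h_mult SU_h_adjoint)
    have "PSU_class X \<otimes>\<^bsub>PSU_h\<^esub> inv\<^bsub>PSU_h\<^esub> PSU_class Y = PSU_class ?Q"
      using X Y by (simp add: PSU_class_inv PSU_class_mult SU_h_adjoint)
    then have conj: "g \<otimes>\<^bsub>PSU_h\<^esub> (PSU_class X \<otimes>\<^bsub>PSU_h\<^esub> inv\<^bsub>PSU_h\<^esub> PSU_class Y) \<otimes>\<^bsub>PSU_h\<^esub> inv\<^bsub>PSU_h\<^esub> g
        = PSU_class (T ** (?Q ** herm_adjoint T))"
      unfolding T(4) by (simp only: PSU_class_conjugate_scaled[OF T(2,1) Q])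
    have "det T * det (herm_adjoint T) = 1" using herm_isometry_adjoint(2)[OF T(2)] by (metis det_I det_mul)
    then have "T ** (?Q ** herm_adjoint T) \<in> carrier SU_h"
      using Q T(2) by (simp add: carrier_SU_h det_mul herm_isometry_mult herm_isometry_adjoint mult.commute)
    then show "g \<otimes>\<^bsub>PSU_h\<^esub> (PSU_class X \<otimes>\<^bsub>PSU_h\<^esub> inv\<^bsub>PSU_h\<^esub> PSU_class Y) \<otimes>\<^bsub>PSU_h\<^esub> inv\<^bsub>PSU_h\<^esub> g
        \<in> PSU_class ` (carrier SU_h \<inter> mats_over \<O>)"
      unfolding conj using integral by blast
  qed auto
qed

lemma finitely_many_Picard_classes_conjugate:
  assumes "g \<in> rational_classes"
  shows "finitely_many_classes (Picard K) (\<lambda>x y. x \<otimes>\<^bsub>PSU_h\<^esub> inv\<^bsub>PSU_h\<^esub> y \<in> conjugate PSU_h g (Picard K))"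
proof (rule finitely_many_classes_mono[OF rational_class_commensurates_Picard[OF inv_mem_rational_classes[OF assms]]])
  interpret group PSU_h by (rule group_PSU_h)
  have g: "g \<in> carrier PSU_h" using assms rational_classes_subset_carrier by blast
  fix x y assume xy: "x \<in> Picard K" "y \<in> Picard K"
    and conj: "inv\<^bsub>PSU_h\<^esub> g \<otimes>\<^bsub>PSU_h\<^esub> (x \<otimes>\<^bsub>PSU_h\<^esub> inv\<^bsub>PSU_h\<^esub> y) \<otimes>\<^bsub>PSU_h\<^esub> inv\<^bsub>PSU_h\<^esub> (inv\<^bsub>PSU_h\<^esub> g) \<in> Picard K"
  have "x \<in> carrier PSU_h" "y \<in> carrier PSU_h" using xy Picard_subset_carrier by auto
  then show "x \<otimes>\<^bsub>PSU_h\<^esub> inv\<^bsub>PSU_h\<^esub> y \<in> conjugate PSU_h g (Picard K)"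
    using conj g by (simp add: mem_conjugate_iff[OF Picard_subset_carrier])
qed

lemma finite_index_Picard_Int_conjugate:
  assumes "g \<in> rational_classes"
  shows "finite_index PSU_h (Picard K \<inter> conjugate PSU_h g (Picard K)) (conjugate PSU_h g (Picard K))"
proof -
  interpret group PSU_h by (rule group_PSU_h)
  have g: "g \<in> carrier PSU_h" using assms rational_classes_subset_carrier by blast
  have sub: "subgroup (conjugate PSU_h g (Picard K)) PSU_h" using subgroup_Picard g by (rule conjugate_subgroup)
  have "finitely_many_classes (conjugate PSU_h g (Picard K))
      (\<lambda>x y. x \<otimes>\<^bsub>PSU_h\<^esub> inv\<^bsub>PSU_h\<^esub> y \<in> Picard K \<inter> conjugate PSU_h g (Picard K))"
    unfolding conjugate_def
  proof (rule finitely_many_classes_image,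
      rule finitely_many_classes_mono[OF rational_class_commensurates_Picard[OF assms]])
    fix x y assume xy: "x \<in> Picard K" "y \<in> Picard K"
      and conj: "g \<otimes>\<^bsub>PSU_h\<^esub> (x \<otimes>\<^bsub>PSU_h\<^esub> inv\<^bsub>PSU_h\<^esub> y) \<otimes>\<^bsub>PSU_h\<^esub> inv\<^bsub>PSU_h\<^esub> g \<in> Picard K"
    have "x \<in> carrier PSU_h" "y \<in> carrier PSU_h" using xy Picard_subset_carrier by auto
    then have "(g \<otimes>\<^bsub>PSU_h\<^esub> x \<otimes>\<^bsub>PSU_h\<^esub> inv\<^bsub>PSU_h\<^esub> g) \<otimes>\<^bsub>PSU_h\<^esub> inv\<^bsub>PSU_h\<^esub> (g \<otimes>\<^bsub>PSU_h\<^esub> y \<otimes>\<^bsub>PSU_h\<^esub> inv\<^bsub>PSU_h\<^esub> g)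
        = g \<otimes>\<^bsub>PSU_h\<^esub> x \<otimes>\<^bsub>PSU_h\<^esub> (inv\<^bsub>PSU_h\<^esub> g \<otimes>\<^bsub>PSU_h\<^esub> g) \<otimes>\<^bsub>PSU_h\<^esub> (inv\<^bsub>PSU_h\<^esub> y \<otimes>\<^bsub>PSU_h\<^esub> inv\<^bsub>PSU_h\<^esub> g)"
      using g by (simp only: inv_mult_group inv_inv m_assoc m_closed inv_closed)
    also have "\<dots> = g \<otimes>\<^bsub>PSU_h\<^esub> (x \<otimes>\<^bsub>PSU_h\<^esub> inv\<^bsub>PSU_h\<^esub> y) \<otimes>\<^bsub>PSU_h\<^esub> inv\<^bsub>PSU_h\<^esub> g"
      using g \<open>x \<in> carrier PSU_h\<close> \<open>y \<in> carrier PSU_h\<close> by (simp add: m_assoc)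
    finally have quotient: "(g \<otimes>\<^bsub>PSU_h\<^esub> x \<otimes>\<^bsub>PSU_h\<^esub> inv\<^bsub>PSU_h\<^esub> g) \<otimes>\<^bsub>PSU_h\<^esub> inv\<^bsub>PSU_h\<^esub> (g \<otimes>\<^bsub>PSU_h\<^esub> y \<otimes>\<^bsub>PSU_h\<^esub> inv\<^bsub>PSU_h\<^esub> g)
        = g \<otimes>\<^bsub>PSU_h\<^esub> (x \<otimes>\<^bsub>PSU_h\<^esub> inv\<^bsub>PSU_h\<^esub> y) \<otimes>\<^bsub>PSU_h\<^esub> inv\<^bsub>PSU_h\<^esub> g" .
    have "x \<otimes>\<^bsub>PSU_h\<^esub> inv\<^bsub>PSU_h\<^esub> y \<in> Picard K"
      using xy subgroup_Picard by (simp add: subgroup.m_closed subgroup.m_inv_closed)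
    then show "(g \<otimes>\<^bsub>PSU_h\<^esub> x \<otimes>\<^bsub>PSU_h\<^esub> inv\<^bsub>PSU_h\<^esub> g) \<otimes>\<^bsub>PSU_h\<^esub> inv\<^bsub>PSU_h\<^esub> (g \<otimes>\<^bsub>PSU_h\<^esub> y \<otimes>\<^bsub>PSU_h\<^esub> inv\<^bsub>PSU_h\<^esub> g)
        \<in> Picard K \<inter> (\<lambda>x. g \<otimes>\<^bsub>PSU_h\<^esub> x \<otimes>\<^bsub>PSU_h\<^esub> inv\<^bsub>PSU_h\<^esub> g) ` Picard K"
      unfolding quotient using conj by blast
  qed
  then show ?thesis
    using finite_index_iff_finitely_many_classes[OF subgroups_Inter_pair[OF subgroup_Picard sub] sub] by blast
qed

lemma finitely_many_eigenvalues_on_integral_vector: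
  assumes z: "z \<in> vecs_over \<O>" "herm z \<noteq> 0"
  shows "finitely_many_classes (Picard K \<inter> PSU_line_stabilizer z)
    (\<lambda>x y. x \<otimes>\<^bsub>PSU_h\<^esub> inv\<^bsub>PSU_h\<^esub> y \<in> PSU_vector_stabilizer z)"
proof -
  define S where "S = {A \<in> carrier SU_h \<inter> mats_over \<O>. \<exists>c. A *v z = c *s z}"
  have S: "Picard K \<inter> PSU_line_stabilizer z = PSU_class ` S"
    using PSU_class_mem_PSU_line_stabilizer[OF _ herm_nonzero_imp_nonzero[OF z(2)]] by (auto simp: Picard_eq S_def)
  have "finitely_many_classes S (\<lambda>A B. PSU_class A \<otimes>\<^bsub>PSU_h\<^esub> inv\<^bsub>PSU_h\<^esub> PSU_class B \<in> PSU_vector_stabilizer z)"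
  proof (rule finitely_many_classesI[where f = "\<lambda>A. A *v z"])
    define r where "r = (\<Sum>i\<in>UNIV. cmod (z $ i))"
    have "cmod (z $ i) \<le> r" for i unfolding r_def by (intro member_le_sum) auto
    then have "A *v z \<in> vecs_over {x \<in> \<O>. cmod x \<le> r}" if "A \<in> S" for A
      using that integers.mats_over_mult_vec[OF _ z(1)] herm_isometry_eigenvalue[OF SU_h_isometry _ z(2)]
      by (auto simp: S_def vecs_over_def norm_mult)
    then show "finite ((\<lambda>A. A *v z) ` S)"
      using finite_vecs_over[OF finite_integers_disc] by (auto intro: finite_subset)
    fix A B assume "A \<in> S" "B \<in> S" and eq: "A *v z = B *v z"
    then obtain c where A: "A \<in> carrier SU_h" and B: "B \<in> carrier SU_h" "B *v z = c *s z" by (auto simp: S_def)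
    note isometry = SU_h_isometry[OF B(1)]
    have "c \<noteq> 0" using isometry_eigenvalue_nonzero[OF isometry B(2) herm_nonzero_imp_nonzero[OF z(2)]] .
    then have "(A ** herm_adjoint B) *v z = z"
      using isometry_adjoint_eigenvector[OF isometry B(2)] eq B(2)
      by (simp add: vector_scalar_commute flip: matrix_vector_mul_assoc)
    moreover have "A ** herm_adjoint B \<in> carrier SU_h" using A B(1) by (simp add: SU_h_mult SU_h_adjoint)
    ultimately show "PSU_class A \<otimes>\<^bsub>PSU_h\<^esub> inv\<^bsub>PSU_h\<^esub> PSU_class B \<in> PSU_vector_stabilizer z"
      using A B(1) by (auto simp: PSU_class_inv PSU_class_mult SU_h_adjoint PSU_vector_stabilizer_def)
  qed
  then show ?thesis unfolding S by (rule finitely_many_classes_image)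
qed

lemma finite_index_vector_stabilizer_in_Picard_line_stabilizer:
  assumes g: "g \<in> rational_classes" and z: "z \<in> vecs_over \<O>" "herm z \<noteq> 0"
  shows "finite_index PSU_h ((Picard K \<inter> conjugate PSU_h g (Picard K)) \<inter> PSU_vector_stabilizer z)
    (Picard K \<inter> PSU_line_stabilizer z)" (is "finite_index _ ((?P \<inter> ?gP) \<inter> ?V) (?P \<inter> ?L)")
proof -
  interpret group PSU_h by (rule group_PSU_h)
  have "g \<in> carrier PSU_h" using g rational_classes_subset_carrier by blast
  then have subgroups: "subgroup ?P PSU_h" "subgroup ?gP PSU_h" "subgroup ?V PSU_h" "subgroup ?L PSU_h"
    using conjugate_subgroup[OF subgroup_Picard] herm_nonzero_imp_nonzero[OF z(2)]
    by (auto intro: subgroup_Picard subgroup_PSU_vector_stabilizer subgroup_PSU_line_stabilizer)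
  have "finitely_many_classes (?P \<inter> ?L) (\<lambda>x y. x \<otimes>\<^bsub>PSU_h\<^esub> inv\<^bsub>PSU_h\<^esub> y \<in> ?gP)"
    by (rule finitely_many_classes_map[OF finitely_many_Picard_classes_conjugate[OF g], where f = "\<lambda>x. x"]) auto
  then have "finitely_many_classes (?P \<inter> ?L) (\<lambda>x y. x \<otimes>\<^bsub>PSU_h\<^esub> inv\<^bsub>PSU_h\<^esub> y \<in> ?gP \<and> x \<otimes>\<^bsub>PSU_h\<^esub> inv\<^bsub>PSU_h\<^esub> y \<in> ?V)"
    using finitely_many_eigenvalues_on_integral_vector[OF z] by (rule finitely_many_classes_conj)
  then have "finitely_many_classes (?P \<inter> ?L) (\<lambda>x y. x \<otimes>\<^bsub>PSU_h\<^esub> inv\<^bsub>PSU_h\<^esub> y \<in> (?P \<inter> ?gP) \<inter> ?V)"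
    by (rule finitely_many_classes_mono)
       (use subgroups(1) in \<open>auto simp: subgroup.m_closed subgroup.m_inv_closed\<close>)
  then show ?thesis
    using subgroups subgroups_Inter_pair PSU_vector_stabilizer_subset_line[of z]
    by (subst finite_index_iff_finitely_many_classes) auto
qed

lemma rational_class_between_vectors:
  assumes x: "x \<in> vecs_over K" and y: "y \<in> vecs_over K" and norms: "herm x = herm y" "herm x \<noteq> 0"
  obtains g where "g \<in> rational_classes"
    "conjugate PSU_h g (PSU_vector_stabilizer x) = PSU_vector_stabilizer y"
proof -
  obtain \<epsilon> where \<epsilon>: "\<epsilon> = 1 \<or> \<epsilon> = -1"
    and isometry: "herm_isometry (quasi_reflection (x - \<epsilon> *s y) \<langle>x, x - \<epsilon> *s y\<rangle>)"
    and maps: "quasi_reflection (x - \<epsilon> *s y) \<langle>x, x - \<epsilon> *s y\<rangle> *v x = \<epsilon> *s y"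
    using isometry_up_to_sign[OF norms] by blast
  let ?T = "quasi_reflection (x - \<epsilon> *s y) \<langle>x, x - \<epsilon> *s y\<rangle>"
  have "\<epsilon> \<in> K" using \<epsilon> by auto
  then have "x - \<epsilon> *s y \<in> vecs_over K" using x y by (intro K.vecs_over_diff K.vecs_over_scale)
  then have "?T \<in> mats_over K"
    using x by (intro K.quasi_reflection_mem_mats_over inverse_mem_K K.hprod_mem)
  moreover obtain c where c: "c \<noteq> 0" "mat c ** ?T \<in> carrier SU_h" using isometry_scaled_SU_h[OF isometry] .
  ultimately have "PSU_class (mat c ** ?T) \<in> rational_classes"
    using isometry unfolding rational_classes_def by blast
  moreover have "(mat c ** ?T) *v x = (c * \<epsilon>) *s y" by (simp only: mat_mult_mult_vec maps vector_smult_assoc)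
  then have "conjugate PSU_h (PSU_class (mat c ** ?T)) (PSU_vector_stabilizer x) = PSU_vector_stabilizer ((c * \<epsilon>) *s y)"
    by (simp only: conjugate_PSU_vector_stabilizer[OF c(2)])
  then have "conjugate PSU_h (PSU_class (mat c ** ?T)) (PSU_vector_stabilizer x) = PSU_vector_stabilizer y"
    using c(1) \<epsilon> by (subst (asm) PSU_vector_stabilizer_scale) auto
  ultimately show ?thesis by (rule that)
qed

proposition Picard_vector_stabilizer_commensurable:
  assumes z: "z \<in> vecs_over \<O>" and z': "z' \<in> vecs_over \<O>" and norms: "herm (of_nat n *s z) = herm z'" "herm z' \<noteq> 0"
  shows "commensurable_up_to_conjugacy PSU_h (Picard_vector_stabilizer z) (Picard K \<inter> PSU_line_stabilizer z')"
proof -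
  interpret group PSU_h by (rule group_PSU_h)
  have "of_nat n *s z \<in> vecs_over K" "z' \<in> vecs_over K"
    using z z' integers_subset_K by (auto simp: vecs_over_def)
  then obtain g where g: "g \<in> rational_classes"
    and "conjugate PSU_h g (PSU_vector_stabilizer (of_nat n *s z)) = PSU_vector_stabilizer z'"
    using rational_class_between_vectors[OF _ _ norms(1)] norms by metis
  moreover have "complex_of_nat n \<noteq> 0" using norms by (auto simp: herm_scale intro!: gr0I)
  ultimately have maps: "conjugate PSU_h g (PSU_vector_stabilizer z) = PSU_vector_stabilizer z'"
    by (simp add: PSU_vector_stabilizer_scale)
  have g_carrier: "g \<in> carrier PSU_h" using g rational_classes_subset_carrier by blast
  let ?P = "Picard K" and ?V = "PSU_vector_stabilizer z'" and ?L = "PSU_line_stabilizer z'"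
  let ?gP = "conjugate PSU_h g ?P"
  have subgroups: "subgroup ?P PSU_h" "subgroup ?gP PSU_h" "subgroup ?V PSU_h" "subgroup ?L PSU_h"
    using conjugate_subgroup[OF subgroup_Picard g_carrier] herm_nonzero_imp_nonzero[OF norms(2)]
    by (auto intro: subgroup_Picard subgroup_PSU_vector_stabilizer subgroup_PSU_line_stabilizer)
  have conj: "conjugate PSU_h g (Picard_vector_stabilizer z) = ?gP \<inter> ?V"
    unfolding Picard_vector_stabilizer_def maps[symmetric]
    using Picard_subset_carrier subgroup.subset[OF subgroup_PSU_vector_stabilizer] g_carrier by (rule conjugate_Int)
  have Int: "(?gP \<inter> ?V) \<inter> (?P \<inter> ?L) = (?P \<inter> ?gP) \<inter> ?V"
    using PSU_vector_stabilizer_subset_line[of z'] by blast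
  have "finite_index PSU_h ((?P \<inter> ?gP) \<inter> ?V) (?gP \<inter> ?V)"
    by (rule finite_index_Int_subgroup[OF finite_index_Picard_Int_conjugate[OF g]])
       (use subgroups subgroups_Inter_pair in auto)
  moreover have "finite_index PSU_h ((?P \<inter> ?gP) \<inter> ?V) (?P \<inter> ?L)"
    using g z' norms(2) by (rule finite_index_vector_stabilizer_in_Picard_line_stabilizer)
  ultimately have "commensurable PSU_h (conjugate PSU_h g (Picard_vector_stabilizer z)) (?P \<inter> ?L)"
    unfolding commensurable_def conj Int by simp
  then show ?thesis using g_carrier unfolding commensurable_up_to_conjugacy_def by blast
qed

end

section \<open>Pell's equation\<close>

definition pell_norm :: "nat \<Rightarrow> int \<times> int \<Rightarrow> int" where
  "pell_norm M = (\<lambda>(p, q). p\<^sup>2 - int M * q\<^sup>2)"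

lemma sqrt_nat_irrational:
  assumes "\<nexists>k::nat. k\<^sup>2 = M" shows "sqrt (real M) \<notin> \<rat>"
proof
  assume rational: "sqrt (real M) \<in> \<rat>"
  have "algebraic_int (sqrt (real M))" by (intro algebraic_int_sqrt int_imp_algebraic_int) auto
  then have "sqrt (real M) \<in> \<int>" using rational by (rule rational_algebraic_int_is_int)
  then have "sqrt (real M) \<in> \<nat>" by (simp add: Nats_altdef2)
  then obtain k :: nat where "sqrt (real M) = real k" by (auto elim: Nats_cases)
  then have "real (k\<^sup>2) = real M" by (metis of_nat_0_le_iff of_nat_power real_sqrt_pow2)
  then show False using assms by (simp only: of_nat_eq_iff) blast
qed

lemma pell_norm_nonzero:
  assumes "sqrt (real M) \<notin> \<rat>" "q > 0" shows "pell_norm M (p, q) \<noteq> 0"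
proof
  assume "pell_norm M (p, q) = 0"
  then have "real_of_int (p\<^sup>2) = real_of_int (int M * q\<^sup>2)" by (simp add: pell_norm_def)
  then have "(of_int \<bar>p\<bar>)\<^sup>2 = (sqrt (real M) * of_int q)\<^sup>2" by (simp add: power_mult_distrib)
  then have "of_int \<bar>p\<bar> = sqrt (real M) * of_int q" using assms(2) by (subst (asm) power2_eq_iff_nonneg) auto
  then have "sqrt (real M) = of_int \<bar>p\<bar> / of_int q" using assms(2) by (simp add: field_simps)
  then show False using assms(1) by simp
qed

lemma pell_norm_approx_set_le:
  assumes "pq \<in> approx_set (sqrt (real M))"
  shows "\<bar>pell_norm M pq\<bar> \<le> \<lceil>1 + 2 * sqrt (real M)\<rceil>"
proof -
  obtain p q where pq: "pq = (p, q)" by fastforce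
  let ?\<theta> = "sqrt (real M)" and ?q = "real_of_int q"
  have q: "q > 0" and approx: "\<bar>?\<theta> - of_int p / ?q\<bar> < 1 / ?q\<^sup>2" using assms by (auto simp: approx_set_def pq)
  have "\<bar>?\<theta> * ?q - of_int p\<bar> = \<bar>?\<theta> - of_int p / ?q\<bar> * ?q" using q by (simp add: abs_mult_pos field_simps)
  also have "\<dots> \<le> 1 / ?q\<^sup>2 * ?q" using approx q by (intro mult_right_mono) auto
  finally have diff: "\<bar>?\<theta> * ?q - of_int p\<bar> \<le> 1 / ?q" using q by (simp add: power2_eq_square)
  have "0 \<le> ?\<theta> * ?q" using q by simp
  then have sum: "\<bar>of_int p + ?\<theta> * ?q\<bar> \<le> 1 / ?q + 2 * (?\<theta> * ?q)" using diff by linarith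
  have "real_of_int (pell_norm M pq) = (of_int p - ?\<theta> * ?q) * (of_int p + ?\<theta> * ?q)"
    by (simp add: pell_norm_def pq power2_eq_square algebra_simps flip: real_sqrt_mult)
  then have "\<bar>real_of_int (pell_norm M pq)\<bar> = \<bar>?\<theta> * ?q - of_int p\<bar> * \<bar>of_int p + ?\<theta> * ?q\<bar>"
    by (simp add: abs_mult abs_minus_commute)
  also have "\<dots> \<le> (1 / ?q) * (1 / ?q + 2 * (?\<theta> * ?q))" using diff sum q by (intro mult_mono) auto
  also have "\<dots> = (1 / ?q) * (1 / ?q) + 2 * ?\<theta>" using q by (simp add: algebra_simps)
  also have "\<dots> \<le> 1 + 2 * ?\<theta>" using mult_mono[of "1 / ?q" 1 "1 / ?q" 1] q by simp
  finally have "real_of_int \<bar>pell_norm M pq\<bar> \<le> 1 + 2 * ?\<theta>" by simp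
  also have "\<dots> \<le> of_int \<lceil>1 + 2 * ?\<theta>\<rceil>" by simp
  finally show ?thesis by (simp only: of_int_le_iff)
qed

text \<open>Two distinct solutions of \<open>p\<^sup>2 - M q\<^sup>2 = k\<close> that agree modulo \<open>k\<close> have a quotient of norm one.\<close>

lemma pell_solution_of_congruent:
  assumes norm: "pell_norm M (p, q) = k" "pell_norm M (p', q') = k" "k \<noteq> 0"
    and cong: "k dvd p' - p" "k dvd q' - q" and ne: "(p, q) \<noteq> (p', q')" "q > 0" "q' > 0"
  obtains X Y where "Y \<noteq> 0" "X\<^sup>2 - int M * Y\<^sup>2 = 1"
proof -
  obtain i j where "p' - p = k * i" "q' - q = k * j" using cong by (auto simp: dvd_def)
  then have ij: "p' = p + k * i" "q' = q + k * j" by auto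
  have k: "p\<^sup>2 - int M * q\<^sup>2 = k" "p'\<^sup>2 - int M * q'\<^sup>2 = k" using norm by (auto simp: pell_norm_def)
  define X Y where "X = 1 + p * i - int M * q * j" and "Y = p * j - q * i"
  have X: "p * p' - int M * q * q' = k * X"
    using k(1) unfolding X_def ij by (simp add: algebra_simps power2_eq_square)
  have Y: "p * q' - q * p' = k * Y" unfolding Y_def ij by (simp add: algebra_simps)
  have "k\<^sup>2 * (X\<^sup>2 - int M * Y\<^sup>2) = (k * X)\<^sup>2 - int M * (k * Y)\<^sup>2"
    by (simp add: algebra_simps power_mult_distrib)
  also have "\<dots> = (p\<^sup>2 - int M * q\<^sup>2) * (p'\<^sup>2 - int M * q'\<^sup>2)"
    unfolding X[symmetric] Y[symmetric] by (simp add: algebra_simps power2_eq_square)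
  also have "\<dots> = k\<^sup>2 * 1" using k by (simp add: power2_eq_square)
  finally have "X\<^sup>2 - int M * Y\<^sup>2 = 1" using norm(3) by simp
  moreover have "Y \<noteq> 0"
  proof
    assume "Y = 0"
    then have cross: "p * q' = q * p'" using Y by simp
    have "k * q'\<^sup>2 = (p * q')\<^sup>2 - int M * q\<^sup>2 * q'\<^sup>2"
      unfolding k(1)[symmetric] by (simp add: algebra_simps power_mult_distrib)
    also have "\<dots> = k * q\<^sup>2" unfolding cross k(2)[symmetric] by (simp add: algebra_simps power_mult_distrib)
    finally have "q' = q" using norm(3) ne(2,3) power2_eq_iff_nonneg[of q' q] by simp
    then show False using cross ne by simp
  qed
  ultimately show ?thesis using that by blast
qed

lemma pell_solution:
  assumes irrational: "sqrt (real M) \<notin> \<rat>"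
  obtains x y :: nat where "y > 0" "x\<^sup>2 = 1 + M * y\<^sup>2"
proof -
  define b where "b = \<lceil>1 + 2 * sqrt (real M)\<rceil>"
  define label where "label pq = (let k = pell_norm M pq in (k, fst pq mod k, snd pq mod k))" for pq
  have "label ` approx_set (sqrt (real M)) \<subseteq> {-b..b} \<times> {-b..b} \<times> {-b..b}"
  proof (rule image_subsetI)
    fix pq assume pq: "pq \<in> approx_set (sqrt (real M))"
    have le: "\<bar>pell_norm M pq\<bar> \<le> b" using pell_norm_approx_set_le[OF pq] by (simp add: b_def)
    have "pell_norm M pq \<noteq> 0" using pq pell_norm_nonzero[OF irrational] by (auto simp: approx_set_def)
    then have "\<bar>x mod pell_norm M pq\<bar> \<le> b" for x using abs_mod_less[of "pell_norm M pq" x] le by linarith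
    then show "label pq \<in> {-b..b} \<times> {-b..b} \<times> {-b..b}"
      using le by (auto simp: label_def Let_def abs_le_iff minus_le_iff)
  qed
  then have "finite (label ` approx_set (sqrt (real M)))" by (rule finite_subset) simp
  moreover have "infinite (approx_set (sqrt (real M)))" using irrational rational_iff_finite_approx_set by blast
  ultimately have "\<not> inj_on label (approx_set (sqrt (real M)))" using finite_imageD by blast
  then obtain u v where uv: "u \<in> approx_set (sqrt (real M))" "v \<in> approx_set (sqrt (real M))" "u \<noteq> v" "label u = label v"
    unfolding inj_on_def by blast
  obtain p q p' q' where "u = (p, q)" "v = (p', q')" by fastforce
  then have pq: "(p, q) \<in> approx_set (sqrt (real M))" "(p', q') \<in> approx_set (sqrt (real M))"
    and ne: "(p, q) \<noteq> (p', q')" and same: "label (p, q) = label (p', q')"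
    using uv by auto
  have pos: "q > 0" "q' > 0" using pq by (auto simp: approx_set_def)
  define k where "k = pell_norm M (p, q)"
  have k: "k \<noteq> 0" unfolding k_def using irrational pos(1) by (rule pell_norm_nonzero)
  have cong: "pell_norm M (p', q') = k" "k dvd p' - p" "k dvd q' - q"
    using same by (auto simp: label_def Let_def k_def mod_eq_dvd_iff dvd_diff_commute)
  obtain X Y where XY: "Y \<noteq> 0" "X\<^sup>2 - int M * Y\<^sup>2 = 1"
    using pell_solution_of_congruent[OF k_def[symmetric] cong(1) k cong(2,3) ne pos] .
  have "int ((nat \<bar>X\<bar>)\<^sup>2) = int (1 + M * (nat \<bar>Y\<bar>)\<^sup>2)" using XY(2) by simp
  then have "(nat \<bar>X\<bar>)\<^sup>2 = 1 + M * (nat \<bar>Y\<bar>)\<^sup>2" by (simp only: of_nat_eq_iff)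
  then show ?thesis using that[of "nat \<bar>Y\<bar>" "nat \<bar>X\<bar>"] XY(1) by simp
qed

lemma pell_solution_divisible:
  assumes "\<nexists>k::nat. k\<^sup>2 = M" "m > 0"
  obtains x y :: nat where "y > 0" "x\<^sup>2 = 1 + M * (m * y)\<^sup>2"
proof -
  have "sqrt (real (M * m\<^sup>2)) \<notin> \<rat>"
  proof
    assume "sqrt (real (M * m\<^sup>2)) \<in> \<rat>"
    then have "sqrt (real M) * real m / real m \<in> \<rat>"
      by (intro Rats_divide Rats_of_nat) (simp add: real_sqrt_mult)
    then have "sqrt (real M) \<in> \<rat>" using assms(2) by simp
    then show False using sqrt_nat_irrational[OF assms(1)] by blast
  qed
  then obtain x y :: nat where "y > 0" "x\<^sup>2 = 1 + M * m\<^sup>2 * y\<^sup>2" using pell_solution by blast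
  then show ?thesis using that by (simp add: power_mult_distrib mult.assoc)
qed


section \<open>A nonelementary subgroup of every discriminant\<close>

lemma mult_cnj_mem_Reals_iff: "x * cnj y \<in> \<real> \<longleftrightarrow> x * cnj y = y * cnj x"
  by (auto simp: Reals_cnj_iff mult.commute)

lemma of_real_mult_mem_Reals_iff: "complex_of_real r * z \<in> \<real> \<longleftrightarrow> r = 0 \<or> z \<in> \<real>"
  by (simp add: complex_is_Real_iff)

text \<open>An integral orthogonal frame of norms \<open>1, - D, D\<close> whose last vector is primitive.\<close>

definition norm_one_vec :: "nat \<Rightarrow> complex^3" where
  "norm_one_vec D = vector [of_nat (D mod 2), 1, 0]"

definition norm_neg_vec :: "nat \<Rightarrow> complex^3" where
  "norm_neg_vec D = vector [of_nat (D mod 2 + D div 2), of_nat (D mod 2), 1]"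

definition norm_disc_vec :: "nat \<Rightarrow> complex^3" where
  "norm_disc_vec D = vector [- of_nat (D div 2), of_nat (D mod 2), 1]"

lemma norm_disc_vec_3 [simp]: "norm_disc_vec D $ 3 = 1"
  by (simp add: norm_disc_vec_def)

lemma norm_disc_frame_herm:
  "herm (norm_one_vec D) = 1" "herm (norm_neg_vec D) = - real D" "herm (norm_disc_vec D) = real D"
proof -
  obtain e q where eq: "D mod 2 = e" "D div 2 = q" by blast
  have "e = 0 \<or> e = 1" "D = e + 2 * q" using eq by auto
  then show "herm (norm_one_vec D) = 1" "herm (norm_neg_vec D) = - real D" "herm (norm_disc_vec D) = real D"
    unfolding norm_one_vec_def norm_neg_vec_def norm_disc_vec_def eq by (auto simp: herm_def)
qed

lemma orthogonal_norm_disc_frame: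
  assumes "D > 0" shows "orthogonal_frame (norm_one_vec D) (norm_neg_vec D) (norm_disc_vec D)"
proof -
  obtain e q where eq: "D mod 2 = e" "D div 2 = q" by blast
  have "e = 0 \<or> e = 1" using eq by auto
  then show ?thesis
    using assms unfolding orthogonal_frame_def norm_disc_frame_herm
    unfolding norm_one_vec_def norm_neg_vec_def norm_disc_vec_def eq
    by (elim disjE) (simp_all add: hprod_def)
qed

abbreviation disc_frame_mat :: "nat \<Rightarrow> complex^3^3" where
  "disc_frame_mat D \<equiv> frame_mat (norm_one_vec D) (norm_neg_vec D) (norm_disc_vec D)"

abbreviation disc_coframe_mat :: "nat \<Rightarrow> complex^3^3" where
  "disc_coframe_mat D \<equiv> coframe_mat (norm_one_vec D) (norm_neg_vec D) (norm_disc_vec D)"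

lemma disc_coframe_mat_frame_mat:
  assumes "D > 0"
  shows "disc_coframe_mat D ** disc_frame_mat D = mat 1" "disc_frame_mat D ** disc_coframe_mat D = mat 1"
    "disc_coframe_mat D ** (disc_frame_mat D ** B) = B"
  using coframe_mat_frame_mat[OF orthogonal_norm_disc_frame[OF assms]] by (simp_all add: matrix_mul_assoc)

text \<open>Elements of \<open>SU(1,1)\<close> with real diagonal, in the coordinates of this frame, and their conjugates.\<close>

definition hyperbolic_block :: "nat \<Rightarrow> real \<Rightarrow> complex \<Rightarrow> complex^3^3" where
  "hyperbolic_block D a b = vector [vector [of_real a, of_nat D * cnj b, 0], vector [b, of_real a, 0], vector [0, 0, 1]]"

definition in_disc_frame :: "nat \<Rightarrow> complex^3^3 \<Rightarrow> complex^3^3" where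
  "in_disc_frame D B = disc_frame_mat D ** (B ** disc_coframe_mat D)"

abbreviation disc_hyperbolic :: "nat \<Rightarrow> real \<Rightarrow> complex \<Rightarrow> complex^3^3" where
  "disc_hyperbolic D a b \<equiv> in_disc_frame D (hyperbolic_block D a b)"

lemma in_disc_frame_mult:
  "D > 0 \<Longrightarrow> in_disc_frame D B ** in_disc_frame D B' = in_disc_frame D (B ** B')"
  by (simp add: in_disc_frame_def disc_coframe_mat_frame_mat flip: matrix_mul_assoc)

lemma in_disc_frame_eq_iff:
  assumes "D > 0" shows "in_disc_frame D B = in_disc_frame D B' \<longleftrightarrow> B = B'"
proof
  have "B = disc_coframe_mat D ** (in_disc_frame D B ** disc_frame_mat D)" for B
    using assms by (simp add: in_disc_frame_def disc_coframe_mat_frame_mat flip: matrix_mul_assoc)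
  then show "in_disc_frame D B = in_disc_frame D B' \<Longrightarrow> B = B'" by metis
qed simp

lemma in_disc_frame_mult_vec:
  "D > 0 \<Longrightarrow> in_disc_frame D B *v (disc_frame_mat D *v y) = disc_frame_mat D *v (B *v y)"
  by (simp add: in_disc_frame_def matrix_vector_mul_assoc disc_coframe_mat_frame_mat flip: matrix_mul_assoc)

lemma hyperbolic_block_mult_vec:
  "hyperbolic_block D a b *v y = vector [of_real a * y $ 1 + of_nat D * cnj b * y $ 2,
     b * y $ 1 + of_real a * y $ 2, y $ 3]"
  by (simp add: vec_3_eq_iff hyperbolic_block_def matrix_vector_mult_3)

lemma disc_hyperbolic_fixes_norm_disc_vec:
  assumes "D > 0"
  shows "disc_hyperbolic D a b *v norm_disc_vec D = norm_disc_vec D"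
proof -
  have "disc_frame_mat D *v axis 3 1 = norm_disc_vec D" by (simp add: frame_mat_mult_vec axis_def)
  moreover have "hyperbolic_block D a b *v axis 3 1 = axis 3 1"
    by (simp add: hyperbolic_block_mult_vec vec_3_eq_iff axis_def)
  ultimately show ?thesis using in_disc_frame_mult_vec[OF assms] by metis
qed

lemma hyperbolic_block_mult_collinear:
  "hyperbolic_block D a' (of_real y * b) ** hyperbolic_block D a b
    = hyperbolic_block D (a' * a + real D * y * (cmod b)\<^sup>2) (of_real (y * a + a') * b)"
  by (simp add: vec_3_eq_iff matrix_matrix_mult_3)
     (simp add: hyperbolic_block_def complex_norm_square algebra_simps del: of_real_power)

lemma hyperbolic_block_commute_imp:
  assumes "D > 0" "hyperbolic_block D a b ** hyperbolic_block D a' b' = hyperbolic_block D a' b' ** hyperbolic_block D a b"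
  shows "b * cnj b' \<in> \<real>"
proof -
  have "(hyperbolic_block D a b ** hyperbolic_block D a' b') $ 1 $ 1
      = (hyperbolic_block D a' b' ** hyperbolic_block D a b) $ 1 $ 1" by (simp only: assms(2))
  then have "of_nat D * (cnj b * b') = of_nat D * (cnj b' * b)"
    by (simp add: matrix_matrix_mult_3 hyperbolic_block_def mult_ac)
  then show ?thesis using assms(1) by (simp add: mult_cnj_mem_Reals_iff mult.commute)
qed

lemma hyperbolic_block_common_eigenvector:
  assumes D: "D > 0" and a: "a\<^sup>2 - real D * (cmod b)\<^sup>2 = 1"
    and noncollinear: "b * cnj b' \<notin> \<real>"
    and eigen: "hyperbolic_block D a b *v y = l *s y" and eigen': "hyperbolic_block D a' b' *v y = l' *s y"
  shows "y $ 1 = 0" "y $ 2 = 0"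
proof -
  have b: "b \<noteq> 0" using noncollinear by auto
  have eqs: "of_real a * y $ 1 + of_nat D * cnj b * y $ 2 = l * y $ 1" "b * y $ 1 + of_real a * y $ 2 = l * y $ 2"
    "y $ 3 = l * y $ 3"
    using eigen by (simp_all add: hyperbolic_block_mult_vec vec_3_eq_iff)
  have eqs': "of_real a' * y $ 1 + of_nat D * cnj b' * y $ 2 = l' * y $ 1" "b' * y $ 1 + of_real a' * y $ 2 = l' * y $ 2"
    using eigen' by (simp_all add: hyperbolic_block_mult_vec vec_3_eq_iff)
  have "y $ 2 = 0"
  proof (cases "y $ 3 = 0")
    case False
    then have l: "l = 1" using eqs(3) by simp
    have "of_real a * of_real a - of_nat D * (b * cnj b) = complex_of_real (a\<^sup>2 - real D * (cmod b)\<^sup>2)"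
      unfolding complex_norm_square[symmetric] by (simp add: power2_eq_square)
    then have "of_real a * of_real a - of_nat D * (b * cnj b) = 1" by (simp only: a of_real_1)
    then have "(2 * (of_real a - 1)) * y $ 2 = 0" using eqs(1,2) unfolding l by algebra
    moreover have "a \<noteq> 1" using a D b by auto
    ultimately show ?thesis by simp
  next
    case True
    have "of_nat D * cnj b * (y $ 2 * y $ 2) = b * (y $ 1 * y $ 1)" using eqs(1,2) by algebra
    moreover have "of_nat D * cnj b' * (y $ 2 * y $ 2) = b' * (y $ 1 * y $ 1)" using eqs' by algebra
    ultimately have "(b * cnj b' - b' * cnj b) * (of_nat D * (y $ 2 * y $ 2)) = 0" by algebra
    then show ?thesis using noncollinear D by (simp add: mult_cnj_mem_Reals_iff)
  qed
  then show "y $ 2 = 0" "y $ 1 = 0" using eqs(2) b by auto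
qed

lemma hyperbolic_common_eigenvector:
  assumes D: "D > 0" and a: "a\<^sup>2 - real D * (cmod b)\<^sup>2 = 1" and noncollinear: "b * cnj b' \<notin> \<real>"
    and eigen: "disc_hyperbolic D a b *v x = l *s x" "disc_hyperbolic D a' b' *v x = l' *s x"
  obtains c where "x = c *s norm_disc_vec D"
proof -
  define y where "y = disc_coframe_mat D *v x"
  have x: "x = disc_frame_mat D *v y"
    using D by (simp add: y_def matrix_vector_mul_assoc disc_coframe_mat_frame_mat)
  have "disc_coframe_mat D *v (in_disc_frame D B *v x) = B *v y" for B
    using D unfolding x in_disc_frame_mult_vec[OF D] by (simp add: matrix_vector_mul_assoc disc_coframe_mat_frame_mat)
  then have "hyperbolic_block D a b *v y = l *s y" "hyperbolic_block D a' b' *v y = l' *s y"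
    using eigen by (metis vector_scalar_commute y_def)+
  then have "y $ 1 = 0" "y $ 2 = 0" using hyperbolic_block_common_eigenvector[OF D a noncollinear] by auto
  then have "x = y $ 3 *s norm_disc_vec D" unfolding x by (simp add: frame_mat_mult_vec)
  then show ?thesis by (rule that)
qed

lemma hyperbolic_class_power:
  assumes D: "D > 0" and S: "disc_hyperbolic D a b \<in> carrier SU_h" and a: "a > 0"
  shows "\<exists>a' y. a' > 0 \<and> y > 0 \<and> disc_hyperbolic D a' (of_real y * b) \<in> carrier SU_h
     \<and> PSU_class (disc_hyperbolic D a b) [^]\<^bsub>PSU_h\<^esub> (Suc m)
         = PSU_class (disc_hyperbolic D a' (of_real y * b))"
proof (induction m)
  case 0
  interpret group PSU_h by (rule group_PSU_h)
  show ?case using S a by (intro exI[of _ a] exI[of _ 1]) (simp add: PSU_class_mem_carrier_iff)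
next
  case (Suc m)
  interpret group PSU_h by (rule group_PSU_h)
  obtain a' y where y: "a' > 0" "y > 0" "disc_hyperbolic D a' (of_real y * b) \<in> carrier SU_h"
    "PSU_class (disc_hyperbolic D a b) [^]\<^bsub>PSU_h\<^esub> (Suc m)
       = PSU_class (disc_hyperbolic D a' (of_real y * b))" using Suc by blast
  let ?a = "a' * a + real D * y * (cmod b)\<^sup>2" and ?y = "y * a + a'"
  have prod: "disc_hyperbolic D a' (of_real y * b) ** disc_hyperbolic D a b
      = disc_hyperbolic D ?a (of_real ?y * b)"
    by (simp only: in_disc_frame_mult[OF D] hyperbolic_block_mult_collinear)
  then have "disc_hyperbolic D ?a (of_real ?y * b) \<in> carrier SU_h"
    using SU_h_mult[OF y(3) S] by simp
  moreover have "PSU_class (disc_hyperbolic D a b) [^]\<^bsub>PSU_h\<^esub> (Suc (Suc m))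
      = PSU_class (disc_hyperbolic D ?a (of_real ?y * b))"
    unfolding nat_pow_Suc[of _ "Suc m"] y(4) PSU_class_mult[OF y(3) S] prod ..
  moreover have "?a > 0" "?y > 0" using y(1,2) a by (simp_all add: add_pos_nonneg add_pos_pos)
  ultimately show ?case by blast
qed

lemma hyperbolic_classes_commute_imp:
  assumes D: "D > 0"
    and S: "disc_hyperbolic D a b \<in> carrier SU_h" "disc_hyperbolic D a' b' \<in> carrier SU_h"
    and commute: "PSU_class (disc_hyperbolic D a b) \<otimes>\<^bsub>PSU_h\<^esub> PSU_class (disc_hyperbolic D a' b')
      = PSU_class (disc_hyperbolic D a' b') \<otimes>\<^bsub>PSU_h\<^esub> PSU_class (disc_hyperbolic D a b)"
  shows "b * cnj b' \<in> \<real>"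
proof -
  let ?S = "disc_hyperbolic D a b" and ?S' = "disc_hyperbolic D a' b'"
  have "PSU_class (?S ** ?S') = PSU_class (?S' ** ?S)" using commute S by (simp add: PSU_class_mult)
  then obtain \<omega> where \<omega>: "?S ** ?S' = mat \<omega> ** (?S' ** ?S)" by (auto simp: PSU_class_eq_iff)
  let ?z = "norm_disc_vec D"
  have "(?S ** ?S') *v ?z = ?z" "(?S' ** ?S) *v ?z = ?z"
    using disc_hyperbolic_fixes_norm_disc_vec[OF D] by (simp_all flip: matrix_vector_mul_assoc)
  then have "?z $ 3 = \<omega> * ?z $ 3" unfolding \<omega> mat_mult_mult_vec by (metis vector_smult_component)
  then have "\<omega> = 1" by simp
  then have "hyperbolic_block D a b ** hyperbolic_block D a' b' = hyperbolic_block D a' b' ** hyperbolic_block D a b"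
    using \<omega> D by (simp add: in_disc_frame_mult in_disc_frame_eq_iff)
  then show ?thesis by (rule hyperbolic_block_commute_imp[OF D])
qed

text \<open>Hyperbolic elements are integral when they are products of two reflections in integral vectors of norm one.\<close>

lemma hyperbolic_eq_reflections:
  fixes \<alpha> \<beta> :: complex and D :: nat
  assumes D: "D > 0" and norm: "(cmod \<alpha>)\<^sup>2 = 1 + real D * (cmod \<beta>)\<^sup>2"
  defines "e \<equiv> \<alpha> *s norm_one_vec D + \<beta> *s norm_neg_vec D"
  shows "quasi_reflection (norm_one_vec D) (1/2) ** quasi_reflection e (1/2)
    = disc_hyperbolic D (1 + 2 * real D * (cmod \<beta>)\<^sup>2) (- 2 * cnj \<alpha> * \<beta>)" (is "?R = ?S")
proof -
  note frame = orthogonal_frameD[OF orthogonal_norm_disc_frame[OF D]]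
  have "?R *v (disc_frame_mat D *v y) = ?S *v (disc_frame_mat D *v y)" for y
  proof -
    define t where "t = 2 * (y $ 1 * cnj \<alpha> - of_nat D * (y $ 2 * cnj \<beta>))"
    have "\<langle>disc_frame_mat D *v y, e\<rangle> / (1/2) = t"
      using frame by (simp add: t_def e_def frame_mat_mult_vec hprod_self norm_disc_frame_herm algebra_simps)
    then have "quasi_reflection e (1/2) *v (disc_frame_mat D *v y)
        = disc_frame_mat D *v vector [y $ 1 - t * \<alpha>, y $ 2 - t * \<beta>, y $ 3]"
      by (simp only: quasi_reflection_mult_vec) (simp add: e_def frame_mat_mult_vec vec_eq_iff algebra_simps)
    moreover have "quasi_reflection (norm_one_vec D) (1/2) *v (disc_frame_mat D *v u)
        = disc_frame_mat D *v vector [- (u $ 1), u $ 2, u $ 3]" for u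
      using frame by (simp add: quasi_reflection_mult_vec frame_mat_mult_vec hprod_self norm_disc_frame_herm vec_eq_iff
          algebra_simps)
    ultimately have R: "?R *v (disc_frame_mat D *v y) = disc_frame_mat D *v vector [t * \<alpha> - y $ 1, y $ 2 - t * \<beta>, y $ 3]"
      by (simp flip: matrix_vector_mul_assoc)
    have "of_real ((cmod \<alpha>)\<^sup>2) = 1 + of_nat D * complex_of_real ((cmod \<beta>)\<^sup>2)"
      unfolding norm by simp
    then have "\<alpha> * cnj \<alpha> = 1 + of_nat D * (\<beta> * cnj \<beta>)" by (simp only: complex_norm_square)
    then have t_\<alpha>: "t * \<alpha> = 2 * (1 + of_nat D * (\<beta> * cnj \<beta>)) * y $ 1 - 2 * of_nat D * (\<alpha> * cnj \<beta>) * y $ 2"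
      unfolding t_def by algebra
    have diagonal: "complex_of_real (1 + 2 * real D * (cmod \<beta>)\<^sup>2) = 1 + 2 * of_nat D * (\<beta> * cnj \<beta>)"
      unfolding complex_norm_square[symmetric] by simp
    have "vector [t * \<alpha> - y $ 1, y $ 2 - t * \<beta>, y $ 3]
        = hyperbolic_block D (1 + 2 * real D * (cmod \<beta>)\<^sup>2) (- 2 * cnj \<alpha> * \<beta>) *v y"
      unfolding hyperbolic_block_mult_vec diagonal t_\<alpha> by (simp add: vec_3_eq_iff t_def algebra_simps)
    then show ?thesis unfolding R by (simp only: in_disc_frame_mult_vec[OF D])
  qed
  from this[of "disc_coframe_mat D *v _"] have "?R *v u = ?S *v u" for u
    by (simp only: matrix_vector_mul_assoc[of "disc_frame_mat D"] disc_coframe_mat_frame_mat(2)[OF D] matrix_vector_mul_lid)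
  then show ?thesis unfolding matrix_eq by blast
qed

context imaginary_quadratic
begin

lemma norm_disc_frame_integral:
  "norm_one_vec D \<in> vecs_over \<O>" "norm_neg_vec D \<in> vecs_over \<O>" "norm_disc_vec D \<in> vecs_over \<O>"
  by (simp_all add: vecs_over_def forall_3 norm_one_vec_def norm_neg_vec_def norm_disc_vec_def)

definition norm_solution :: "nat \<Rightarrow> complex \<Rightarrow> complex \<Rightarrow> bool" where
  "norm_solution D \<alpha> \<beta> \<longleftrightarrow> \<alpha> \<in> \<O> \<and> \<beta> \<in> \<O> \<and> (cmod \<alpha>)\<^sup>2 = 1 + real D * (cmod \<beta>)\<^sup>2"

lemma hyperbolic_integral:
  assumes D: "D > 0" and solution: "norm_solution D \<alpha> \<beta>"
  shows "disc_hyperbolic D (1 + 2 * real D * (cmod \<beta>)\<^sup>2) (- 2 * cnj \<alpha> * \<beta>) \<in> carrier SU_h \<inter> mats_over \<O>"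
proof -
  have integral: "\<alpha> \<in> \<O>" "\<beta> \<in> \<O>" and norm: "(cmod \<alpha>)\<^sup>2 = 1 + real D * (cmod \<beta>)\<^sup>2"
    using solution by (auto simp: norm_solution_def)
  define e where "e = \<alpha> *s norm_one_vec D + \<beta> *s norm_neg_vec D"
  have e: "e \<in> vecs_over \<O>" unfolding e_def by (intro integers.vecs_over_closed norm_disc_frame_integral integral)
  have "e = disc_frame_mat D *v vector [\<alpha>, \<beta>, 0]" by (simp add: e_def frame_mat_mult_vec)
  then have "herm e = 1"
    using norm herm_frame_mat_mult_vec[OF orthogonal_norm_disc_frame[OF D]] by (simp add: norm_disc_frame_herm)
  have reflection: "herm_isometry (quasi_reflection v (1/2))" "det (quasi_reflection v (1/2)) = -1"
    "quasi_reflection v (1/2) \<in> mats_over \<O>" if "herm v = 1" "v \<in> vecs_over \<O>" for v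
    using that by (auto intro!: herm_isometry_quasi_reflection integers.quasi_reflection_mem_mats_over
        simp: det_quasi_reflection hprod_self)
  note x = reflection[OF norm_disc_frame_herm(1) norm_disc_frame_integral(1)]
    and e = reflection[OF \<open>herm e = 1\<close> e]
  have "quasi_reflection (norm_one_vec D) (1/2) ** quasi_reflection e (1/2) \<in> carrier SU_h \<inter> mats_over \<O>"
    using x e by (simp add: carrier_SU_h det_mul herm_isometry_mult integers.mats_over_mult)
  then show ?thesis using hyperbolic_eq_reflections[OF D norm] by (simp add: e_def)
qed

lemma norm_add_multiple_s: "(cmod (of_nat a + of_nat b * s))\<^sup>2 = real (a\<^sup>2 + d * b\<^sup>2)"
proof -
  have "(of_nat a + of_nat b * s) * cnj (of_nat a + of_nat b * s) = of_nat a * of_nat a - of_nat b * of_nat b * (s * s)"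
    by (simp add: cnj_s algebra_simps)
  then have "complex_of_real ((cmod (of_nat a + of_nat b * s))\<^sup>2) = of_real (real (a\<^sup>2 + d * b\<^sup>2))"
    unfolding complex_norm_square s_square by (simp add: power2_eq_square)
  then show ?thesis by (simp only: of_real_eq_iff)
qed

lemma noncollinear_norm_solutions_of_square:
  assumes k: "D = k\<^sup>2" "k > 0"
  obtains \<alpha> \<beta> \<alpha>' \<beta>' where "norm_solution D \<alpha> \<beta>" "norm_solution D \<alpha>' \<beta>'"
    "(cnj \<alpha> * \<beta>) * cnj (cnj \<alpha>' * \<beta>') \<notin> \<real>"
proof -
  define \<alpha> \<beta> where "\<alpha> t = of_nat 1 + of_nat (k * t) * s" and "\<beta> t = of_nat 0 + of_nat t * s" for t
  have "(cmod (\<alpha> t))\<^sup>2 = 1 + real D * (cmod (\<beta> t))\<^sup>2" for t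
    unfolding \<alpha>_def \<beta>_def norm_add_multiple_s by (simp add: k(1) power_mult_distrib)
  then have solution: "norm_solution D (\<alpha> t) (\<beta> t)" for t
    unfolding norm_solution_def using s_mem_integers by (auto simp: \<alpha>_def \<beta>_def)
  have "(cnj (\<alpha> 1) * \<beta> 1) * cnj (cnj (\<alpha> 2) * \<beta> 2) - (cnj (\<alpha> 2) * \<beta> 2) * cnj (cnj (\<alpha> 1) * \<beta> 1)
      = - 4 * of_nat k * (s * s) * s"
    by (simp add: \<alpha>_def \<beta>_def cnj_s algebra_simps)
  also have "\<dots> \<noteq> 0" using k(2) d_pos s_nonzero by (simp add: s_square)
  finally have "(cnj (\<alpha> 1) * \<beta> 1) * cnj (cnj (\<alpha> 2) * \<beta> 2) \<notin> \<real>" unfolding mult_cnj_mem_Reals_iff by simp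
  then show ?thesis using that solution by blast
qed

lemma noncollinear_norm_solutions_of_nonsquare:
  assumes "\<nexists>k::nat. k\<^sup>2 = D"
  obtains \<alpha> \<beta> \<alpha>' \<beta>' where "norm_solution D \<alpha> \<beta>" "norm_solution D \<alpha>' \<beta>'"
    "(cnj \<alpha> * \<beta>) * cnj (cnj \<alpha>' * \<beta>') \<notin> \<real>"
proof -
  obtain n y :: nat where y: "y > 0" "n\<^sup>2 = 1 + D * ((1 + d) * y)\<^sup>2"
    using pell_solution_divisible[OF assms, of "1 + d"] by (metis zero_less_Suc plus_1_eq_Suc)
  define \<beta> \<beta>' where "\<beta> = complex_of_nat ((1 + d) * y)" and "\<beta>' = (1 + s)\<^sup>2 * of_nat y"
  have "(cmod (1 + s))\<^sup>2 = real (1 + d)" using norm_add_multiple_s[of 1 1] by simp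
  then have "cmod \<beta>' = real ((1 + d) * y)"
    unfolding \<beta>'_def norm_mult norm_power norm_of_nat of_nat_mult by simp
  moreover have "cmod \<beta> = real ((1 + d) * y)" unfolding \<beta>_def norm_of_nat ..
  moreover have "(cmod (of_nat n))\<^sup>2 = 1 + real D * (real ((1 + d) * y))\<^sup>2"
    unfolding norm_of_nat of_nat_power[symmetric] y(2) by (simp only: of_nat_add of_nat_mult of_nat_1)
  ultimately have solutions: "norm_solution D (of_nat n) \<beta>" "norm_solution D (of_nat n) \<beta>'"
    using s_mem_integers unfolding norm_solution_def
    by (auto simp: \<beta>_def \<beta>'_def simp del: of_nat_mult of_nat_add of_nat_Suc)
  have "n \<noteq> 0" using y(2) by (intro notI) simp
  have "(cnj (of_nat n) * \<beta>) * cnj (cnj (of_nat n) * \<beta>') - (cnj (of_nat n) * \<beta>') * cnj (cnj (of_nat n) * \<beta>)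
      = of_nat n * of_nat n * of_nat ((1 + d) * y) * of_nat y * (cnj ((1 + s)\<^sup>2) - (1 + s)\<^sup>2)"
    by (simp add: \<beta>_def \<beta>'_def algebra_simps)
  also have "cnj ((1 + s)\<^sup>2) - (1 + s)\<^sup>2 = - 4 * s" by (simp add: cnj_s power2_eq_square algebra_simps)
  also have "of_nat n * of_nat n * of_nat ((1 + d) * y) * of_nat y * (- 4 * s) \<noteq> 0"
    using \<open>n \<noteq> 0\<close> y(1) s_nonzero by (simp del: of_nat_Suc of_nat_add)
  finally have "(cnj (of_nat n) * \<beta>) * cnj (cnj (of_nat n) * \<beta>') \<notin> \<real>" unfolding mult_cnj_mem_Reals_iff by simp
  then show ?thesis using that solutions by blast
qed

lemma noncollinear_disc_hyperbolic_elements: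
  assumes D: "D > 0"
  obtains a b a' b' where "disc_hyperbolic D a b \<in> carrier SU_h \<inter> mats_over \<O>" "a > 0" "a\<^sup>2 - real D * (cmod b)\<^sup>2 = 1"
    "disc_hyperbolic D a' b' \<in> carrier SU_h \<inter> mats_over \<O>" "a' > 0" "b * cnj b' \<notin> \<real>"
proof -
  obtain \<alpha> \<beta> \<alpha>' \<beta>' where solutions: "norm_solution D \<alpha> \<beta>" "norm_solution D \<alpha>' \<beta>'"
    and noncollinear: "(cnj \<alpha> * \<beta>) * cnj (cnj \<alpha>' * \<beta>') \<notin> \<real>"
    using noncollinear_norm_solutions_of_square noncollinear_norm_solutions_of_nonsquare[of D] D
    by (metis gr0I power_zero_numeral less_irrefl)
  define a b where "a \<beta> = 1 + 2 * real D * (cmod \<beta>)\<^sup>2" and "b \<alpha> \<beta> = - 2 * cnj \<alpha> * \<beta>" for \<alpha> \<beta> :: complex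
  have pos: "a \<beta> > 0" for \<beta> unfolding a_def by (simp add: add_pos_nonneg)
  have "(cmod (b \<alpha> \<beta>))\<^sup>2 = 4 * ((1 + real D * (cmod \<beta>)\<^sup>2) * (cmod \<beta>)\<^sup>2)"
    using solutions(1) by (simp add: b_def norm_mult power_mult_distrib norm_solution_def)
  then have norm: "(a \<beta>)\<^sup>2 - real D * (cmod (b \<alpha> \<beta>))\<^sup>2 = 1"
    unfolding a_def by (simp add: power2_eq_square algebra_simps)
  have "b \<alpha> \<beta> * cnj (b \<alpha>' \<beta>') = of_real 4 * ((cnj \<alpha> * \<beta>) * cnj (cnj \<alpha>' * \<beta>'))"
    by (simp add: b_def)
  then have "b \<alpha> \<beta> * cnj (b \<alpha>' \<beta>') \<notin> \<real>" using noncollinear by (simp only: of_real_mult_mem_Reals_iff) simp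
  then show ?thesis
    using that hyperbolic_integral[OF D solutions(1), folded a_def b_def]
      hyperbolic_integral[OF D solutions(2), folded a_def b_def] norm pos by blast
qed

lemma hyperbolic_powers_not_commute:
  assumes D: "D > 0" and S: "disc_hyperbolic D a b \<in> carrier SU_h" "a > 0"
    and S': "disc_hyperbolic D a' b' \<in> carrier SU_h" "a' > 0" and noncollinear: "b * cnj b' \<notin> \<real>"
    and mn: "m > 0" "n > 0"
  defines "g \<equiv> PSU_class (disc_hyperbolic D a b)" and "g' \<equiv> PSU_class (disc_hyperbolic D a' b')"
  shows "g [^]\<^bsub>PSU_h\<^esub> (m::nat) \<otimes>\<^bsub>PSU_h\<^esub> g' [^]\<^bsub>PSU_h\<^esub> (n::nat) \<noteq> g' [^]\<^bsub>PSU_h\<^esub> n \<otimes>\<^bsub>PSU_h\<^esub> g [^]\<^bsub>PSU_h\<^esub> m"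
proof
  assume commute: "g [^]\<^bsub>PSU_h\<^esub> m \<otimes>\<^bsub>PSU_h\<^esub> g' [^]\<^bsub>PSU_h\<^esub> n = g' [^]\<^bsub>PSU_h\<^esub> n \<otimes>\<^bsub>PSU_h\<^esub> g [^]\<^bsub>PSU_h\<^esub> m"
  obtain r y where r: "y > 0" "disc_hyperbolic D r (of_real y * b) \<in> carrier SU_h"
    "g [^]\<^bsub>PSU_h\<^esub> m = PSU_class (disc_hyperbolic D r (of_real y * b))"
    using hyperbolic_class_power[OF D S, of "m - 1"] mn(1) unfolding g_def by auto
  obtain r' y' where r': "y' > 0" "disc_hyperbolic D r' (of_real y' * b') \<in> carrier SU_h"
    "g' [^]\<^bsub>PSU_h\<^esub> n = PSU_class (disc_hyperbolic D r' (of_real y' * b'))"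
    using hyperbolic_class_power[OF D S', of "n - 1"] mn(2) unfolding g'_def by auto
  have "(of_real y * b) * cnj (of_real y' * b') \<in> \<real>"
    using hyperbolic_classes_commute_imp[OF D r(2) r'(2)] commute unfolding r(3) r'(3) by blast
  moreover have "(of_real y * b) * cnj (of_real y' * b') = of_real (y * y') * (b * cnj b')" by simp
  ultimately show False using noncollinear r(1) r'(1) by (simp only: of_real_mult_mem_Reals_iff) simp
qed

text \<open>Being the only fixed line, \<open>z\<close> is determined by its stabilizer: this gives both maximality and the discriminant.\<close>

definition unique_fixed_line :: "(complex^3^3) set set \<Rightarrow> complex^3 \<Rightarrow> bool" where
  "unique_fixed_line \<Gamma> z \<longleftrightarrow> (\<forall>x. x \<noteq> 0 \<and> (\<forall>g\<in>\<Gamma>. act g (proj x) = proj x) \<longrightarrow> proj x = proj z)"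

lemma maximal_nonelementary_C_Fuchsian_if_unique_fixed_line:
  assumes z: "herm z > 0" and nonelementary: "\<not> virtually_cyclic PSU_h (Picard_vector_stabilizer z)"
    and unique: "unique_fixed_line (Picard_vector_stabilizer z) z"
  shows "maximal_nonelementary_C_Fuchsian K (Picard_vector_stabilizer z)"
  unfolding maximal_nonelementary_C_Fuchsian_def
proof (intro conjI allI impI)
  show "nonelementary_C_Fuchsian K (Picard_vector_stabilizer z)"
    using nonelementary C_Fuchsian_Picard_vector_stabilizer[OF z] by (simp add: nonelementary_C_Fuchsian_def)
  fix \<Gamma> assume \<Gamma>: "nonelementary_C_Fuchsian K \<Gamma> \<and> Picard_vector_stabilizer z \<subseteq> \<Gamma>"
  then obtain v where v: "herm v > 0" "\<Gamma> \<subseteq> Picard_vector_stabilizer v"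
    using C_Fuchsian_subset_Picard_vector_stabilizer unfolding nonelementary_C_Fuchsian_def by metis
  have "act g (proj v) = proj v" if "g \<in> Picard_vector_stabilizer z" for g
  proof -
    have "g \<in> PSU_line_stabilizer v"
      using that \<Gamma> v(2) PSU_vector_stabilizer_subset_line unfolding Picard_vector_stabilizer_def by blast
    then show ?thesis by (simp add: PSU_line_stabilizer_def)
  qed
  moreover have "v \<noteq> 0" using v(1) herm_nonzero_imp_nonzero[of v] by simp
  ultimately have "proj v = proj z" using unique unfolding unique_fixed_line_def by blast
  then obtain c where "c \<noteq> 0" "v = c *s z" by (auto simp: proj_eq_iff)
  then show "\<Gamma> = Picard_vector_stabilizer z"
    using \<Gamma> v(2) by (auto simp: Picard_vector_stabilizer_def PSU_vector_stabilizer_scale)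
qed

lemma has_discriminant_if_unique_fixed_line:
  assumes z: "z \<in> vecs_over \<O>" "z $ i = 1" "herm z = real D" "D > 0"
    and unique: "unique_fixed_line (Picard_vector_stabilizer z) z"
  shows "has_discriminant K (Picard_vector_stabilizer z) D"
proof -
  have "z \<noteq> 0" using z(3,4) herm_nonzero_imp_nonzero[of z] by simp
  have "relatively_prime K z"
    unfolding relatively_prime_def using z(2) by metis
  moreover have "{p \<in> P2 K. \<forall>g\<in>Picard_vector_stabilizer z. act g p = p} = {proj z}"
  proof
    have "act g (proj z) = proj z" if "g \<in> Picard_vector_stabilizer z" for g
      using that PSU_vector_stabilizer_subset_line
      unfolding Picard_vector_stabilizer_def PSU_line_stabilizer_def by blast
    then show "{proj z} \<subseteq> {p \<in> P2 K. \<forall>g\<in>Picard_vector_stabilizer z. act g p = p}"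
      using z(1) \<open>z \<noteq> 0\<close> integers_subset_K by (auto simp: P2_def vecs_over_def intro!: exI[of _ z])
    show "{p \<in> P2 K. \<forall>g\<in>Picard_vector_stabilizer z. act g p = p} \<subseteq> {proj z}"
      using unique by (auto simp: P2_def unique_fixed_line_def)
  qed
  ultimately show ?thesis
    unfolding has_discriminant_def using z(1,3) by (auto simp: vecs_over_def)
qed

proposition Picard_stabilizer_norm_disc_vec_maximal:
  assumes D: "D > 0"
  shows "Picard_vector_stabilizer (norm_disc_vec D) \<in> max_C_Fuchsian_of_discriminant K D"
proof -
  interpret group PSU_h by (rule group_PSU_h)
  let ?\<Gamma> = "Picard_vector_stabilizer (norm_disc_vec D)"
  obtain a b a' b' where S: "disc_hyperbolic D a b \<in> carrier SU_h \<inter> mats_over \<O>" "a > 0" "a\<^sup>2 - real D * (cmod b)\<^sup>2 = 1"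
    and S': "disc_hyperbolic D a' b' \<in> carrier SU_h \<inter> mats_over \<O>" "a' > 0" and noncollinear: "b * cnj b' \<notin> \<real>"
    using noncollinear_disc_hyperbolic_elements[OF D] .
  let ?g = "PSU_class (disc_hyperbolic D a b)" and ?g' = "PSU_class (disc_hyperbolic D a' b')"
  have mem: "?g \<in> ?\<Gamma>" "?g' \<in> ?\<Gamma>"
    using S(1) S'(1) disc_hyperbolic_fixes_norm_disc_vec[OF D]
    by (auto simp: Picard_vector_stabilizer_def Picard_eq PSU_vector_stabilizer_def)
  have unique: "unique_fixed_line ?\<Gamma> (norm_disc_vec D)"
    unfolding unique_fixed_line_def
  proof (intro allI impI, elim conjE)
    fix x :: "complex^3" assume "x \<noteq> 0" and fixed: "\<forall>g\<in>?\<Gamma>. act g (proj x) = proj x"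
    then obtain l l' where "disc_hyperbolic D a b *v x = l *s x" "disc_hyperbolic D a' b' *v x = l' *s x"
      using mem S(1) S'(1) by (metis IntD1 act_PSU_class_fixes_iff)
    then obtain c where "x = c *s norm_disc_vec D" using hyperbolic_common_eigenvector[OF D S(3) noncollinear] by blast
    then show "proj x = proj (norm_disc_vec D)" using \<open>x \<noteq> 0\<close> proj_scale by auto
  qed
  have "\<not> virtually_cyclic PSU_h ?\<Gamma>"
  proof
    assume "virtually_cyclic PSU_h ?\<Gamma>"
    then obtain m n :: nat where mn: "m > 0" "n > 0"
      "?g [^]\<^bsub>PSU_h\<^esub> m \<otimes>\<^bsub>PSU_h\<^esub> ?g' [^]\<^bsub>PSU_h\<^esub> n = ?g' [^]\<^bsub>PSU_h\<^esub> n \<otimes>\<^bsub>PSU_h\<^esub> ?g [^]\<^bsub>PSU_h\<^esub> m"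
      using virtually_cyclic_powers_commute[OF _ subgroup_Picard_vector_stabilizer mem] by blast
    then show False
      using hyperbolic_powers_not_commute[OF D _ S(2) _ S'(2) noncollinear mn(1,2)] S(1) S'(1) by blast
  qed
  then show ?thesis
    unfolding max_C_Fuchsian_of_discriminant_def using D unique norm_disc_frame_integral(3)
    by (auto intro!: maximal_nonelementary_C_Fuchsian_if_unique_fixed_line
        has_discriminant_if_unique_fixed_line[where i = 3]
        simp: norm_disc_frame_herm)
qed

end

section \<open>Finiteness of the number of conjugacy classes\<close>

context imaginary_quadratic
begin

text \<open>The argument proving that the class number is finite, with Dirichlet's approximation theorem in place
  of Minkowski's theorem.\<close>

lemma ideal_almost_principal:
  assumes I: "I \<subseteq> \<O>" "\<And>x y. x \<in> I \<Longrightarrow> y \<in> I \<Longrightarrow> x - y \<in> I" "\<And>r x. r \<in> \<O> \<Longrightarrow> x \<in> I \<Longrightarrow> r * x \<in> I"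
    and nontrivial: "\<exists>x\<in>I. x \<noteq> 0"
  obtains \<mu> where "\<mu> \<in> I" "\<mu> \<noteq> 0" "\<And>x. x \<in> I \<Longrightarrow> of_nat (fact dirichlet_bound) / \<mu> * x \<in> \<O>"
proof -
  define norm where "norm x = nat \<lfloor>(cmod x)\<^sup>2\<rfloor>" for x
  have norm: "real (norm x) = (cmod x)\<^sup>2" if x: "x \<in> I" for x
  proof -
    obtain n where "(cmod x)\<^sup>2 = real n" using integers_norm_nat[OF subsetD[OF I(1) x]] .
    then show ?thesis by (simp add: norm_def)
  qed
  obtain \<mu> where \<mu>: "\<mu> \<in> I" "\<mu> \<noteq> 0" and least: "\<And>x. x \<in> I \<Longrightarrow> x \<noteq> 0 \<Longrightarrow> norm \<mu> \<le> norm x"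
    using nontrivial ex_has_least_nat[of "\<lambda>x. x \<in> I \<and> x \<noteq> 0" _ norm] by blast
  have "of_nat (fact dirichlet_bound) / \<mu> * x \<in> \<O>" if x: "x \<in> I" for x
  proof -
    obtain j \<beta> where j: "j \<in> {1..dirichlet_bound}" "\<beta> \<in> \<O>" "cmod (of_nat j * (x / \<mu>) - \<beta>) \<le> 1/2"
      using dirichlet_approximation .
    define v where "v = of_nat j * x - \<beta> * \<mu>"
    have v: "v \<in> I" unfolding v_def using I(2,3) x \<mu>(1) j(2) by simp
    have "v = (of_nat j * (x / \<mu>) - \<beta>) * \<mu>" using \<mu>(2) by (simp add: v_def field_simps)
    then have "cmod v \<le> 1/2 * cmod \<mu>" using mult_right_mono[OF j(3), of "cmod \<mu>"] by (simp add: norm_mult)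
    also have "\<dots> < cmod \<mu>" using \<mu>(2) by simp
    finally have "(cmod v)\<^sup>2 < (cmod \<mu>)\<^sup>2" by (intro power_strict_mono) auto
    then have "norm v < norm \<mu>" using norm[OF v] norm[OF \<mu>(1)] by linarith
    then have "v = 0" using least[OF v] by force
    then have jx: "of_nat j * x = \<beta> * \<mu>" by (simp add: v_def)
    have "j dvd fact dirichlet_bound" using j(1) by (intro dvd_fact) auto
    then obtain k where k: "fact dirichlet_bound = j * k" by (auto simp: dvd_def)
    have "of_nat (fact dirichlet_bound) / \<mu> * x = of_nat k * (of_nat j * x) / \<mu>" by (simp add: k)
    also have "\<dots> = of_nat k * \<beta>" using \<mu>(2) unfolding jx by simp
    finally show ?thesis using j(2) by simp
  qed
  then show ?thesis using that \<mu> by blast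
qed

lemma rescaled_functional:
  assumes y: "y \<in> vecs_over \<O>" "y \<noteq> 0"
  obtains w c where "w \<in> vecs_over \<O>" "c \<noteq> 0" "c *s y \<in> vecs_over \<O>" "\<langle>w, c *s y\<rangle> = of_nat (fact dirichlet_bound)"
proof -
  define I where "I = (\<lambda>w. \<langle>w, y\<rangle>) ` vecs_over \<O>"
  have subset: "I \<subseteq> \<O>" using integers.hprod_mem[OF _ y(1)] by (auto simp: I_def)
  have diff: "u - v \<in> I" if "u \<in> I" "v \<in> I" for u v
    using that unfolding I_def image_iff by (metis integers.vecs_over_diff hprod_left_simps(2))
  have scale: "r * u \<in> I" if "r \<in> \<O>" "u \<in> I" for r u
    using that unfolding I_def image_iff by (metis integers.vecs_over_scale hprod_left_simps(3))
  have nontrivial: "\<exists>x\<in>I. x \<noteq> 0"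
  proof (rule ccontr)
    assume "\<not> (\<exists>x\<in>I. x \<noteq> 0)"
    then have "\<langle>axis i 1, y\<rangle> = 0" for i using integers.axis_mem_vecs_over by (auto simp: I_def)
    then have "y = 0" using hprod_axis[of y] by (simp add: vec_3_eq_iff)
    then show False using y(2) by simp
  qed
  obtain \<mu> where \<mu>: "\<mu> \<in> I" "\<mu> \<noteq> 0" "\<And>x. x \<in> I \<Longrightarrow> of_nat (fact dirichlet_bound) / \<mu> * x \<in> \<O>"
    using ideal_almost_principal[OF subset diff scale nontrivial] by blast
  obtain w where w: "w \<in> vecs_over \<O>" "\<mu> = \<langle>w, y\<rangle>" using \<mu>(1) by (auto simp: I_def)
  define c where "c = cnj (of_nat (fact dirichlet_bound) / \<mu>)"
  have c: "\<langle>v, c *s y\<rangle> = of_nat (fact dirichlet_bound) / \<mu> * \<langle>v, y\<rangle>" for v by (simp add: c_def)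
  have "\<langle>axis i 1, c *s y\<rangle> \<in> \<O>" for i
    unfolding c by (intro \<mu>(3)) (simp add: I_def integers.axis_mem_vecs_over)
  then have "c *s y \<in> vecs_over \<O>" by (rule integers.vecs_over_if_hprod_axis)
  moreover have "\<langle>w, c *s y\<rangle> = of_nat (fact dirichlet_bound)" unfolding c w(2)[symmetric] using \<mu>(2) by simp
  moreover have "c \<noteq> 0" using \<mu>(2) by (simp add: c_def)
  ultimately show ?thesis using that w(1) by blast
qed

lemma herm_integral_Ints:
  assumes "x \<in> vecs_over \<O>" shows "herm x \<in> \<int>"
proof -
  have integral: "complex_of_real (herm x) \<in> \<O>" using integers.hprod_mem[OF assms assms] by (simp add: hprod_self)
  then have "complex_of_real (herm x) + cnj (complex_of_real (herm x)) \<in> \<rat>"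
    using integers_subset_K by (intro K_trace_norm_Rats) auto
  then have "(complex_of_real (herm x) + cnj (complex_of_real (herm x))) / 2 \<in> \<rat>" by (rule Rats_divide) simp
  then have "complex_of_real (herm x) \<in> \<rat>" by simp
  then have "complex_of_real (herm x) \<in> \<int>" using integral by (intro integers_Rats_imp_Ints)
  then show ?thesis by (simp only: of_real_in_Ints_iff)
qed

definition orthogonal_lattice :: "complex^3 \<Rightarrow> (complex^3) set" where
  "orthogonal_lattice z = {x \<in> vecs_over \<O>. \<langle>x, z\<rangle> = 0}"

lemma projection_mem_orthogonal_lattice:
  assumes "z \<in> vecs_over \<O>" "herm z = real D" "w \<in> vecs_over \<O>"
  shows "of_nat D *s w - \<langle>w, z\<rangle> *s z \<in> orthogonal_lattice z"
  using assms herm_orthogonal_projection(1)[OF assms(2)]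
  by (simp add: orthogonal_lattice_def integers.vecs_over_diff integers.vecs_over_scale integers.hprod_mem)

definition short_vector_bound :: "nat \<Rightarrow> nat" where
  "short_vector_bound D = 2 * D * D * fact dirichlet_bound + 2 * (dirichlet_bound * D * fact dirichlet_bound)\<^sup>2"

text \<open>Adding multiples of a rescaled isotropic vector changes the norm by the multiples of a bounded number.\<close>

lemma short_orthogonal_vector_isotropic:
  assumes z: "z \<in> vecs_over \<O>" "herm z = real D" "D > 0"
    and n: "n \<in> orthogonal_lattice z" "n \<noteq> 0" "herm n = 0"
  obtains x where "x \<in> orthogonal_lattice z" "herm x \<noteq> 0" "\<bar>herm x\<bar> \<le> real (short_vector_bound D)"
proof -
  define N :: nat where "N = fact dirichlet_bound"
  have n': "n \<in> vecs_over \<O>" "\<langle>n, z\<rangle> = 0" using n(1) by (auto simp: orthogonal_lattice_def)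
  obtain w c where w: "w \<in> vecs_over \<O>" "c *s n \<in> vecs_over \<O>" "\<langle>w, c *s n\<rangle> = of_nat N"
    using rescaled_functional[OF n'(1) n(2)] unfolding N_def by metis
  define t where "t = real D * herm w - (cmod \<langle>w, z\<rangle>)\<^sup>2"
  define m where "m = 2 * real D * real N"
  have m: "m > 0" using z(3) by (simp add: m_def N_def)
  define k where "k = \<lfloor>- t / m\<rfloor> + 1"
  have "- t / m < of_int k" "of_int k \<le> - t / m + 1" unfolding k_def by linarith+
  then have bounds: "0 < t + m * of_int k" "t + m * of_int k \<le> m" using m by (simp_all add: field_simps)
  define v where "v = w + of_int k *s (c *s n)"
  have v: "v \<in> vecs_over \<O>" unfolding v_def by
    (intro integers.vecs_over_add integers.vecs_over_scale w integers.of_int_closed)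
  let ?x = "of_nat D *s v - \<langle>v, z\<rangle> *s z"
  have "herm v = herm w + 2 * of_int k * real N"
    unfolding v_def herm_add_scale w(3) by (simp add: herm_scale n(3))
  moreover have "\<langle>v, z\<rangle> = \<langle>w, z\<rangle>" by (simp add: v_def n'(2))
  ultimately have "real D * herm v - (cmod \<langle>v, z\<rangle>)\<^sup>2 = t + m * of_int k" by (simp add: t_def m_def algebra_simps)
  then have herm_x: "herm ?x = real D * (t + m * of_int k)" by (simp only: herm_orthogonal_projection(2)[OF z(2)])
  have "0 < herm ?x" unfolding herm_x using z(3) bounds(1) by simp
  moreover have "herm ?x \<le> real D * m" unfolding herm_x using bounds(2) by (intro mult_left_mono) auto
  moreover have "real D * m = real (2 * D * D * N)" by (simp add: m_def)
  moreover have "real (2 * D * D * N) \<le> real (short_vector_bound D)"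
    unfolding short_vector_bound_def N_def of_nat_le_iff by simp
  ultimately have "herm ?x \<noteq> 0" "\<bar>herm ?x\<bar> \<le> real (short_vector_bound D)" by linarith+
  then show ?thesis using that projection_mem_orthogonal_lattice[OF z(1,2) v] by blast
qed

lemma orthogonal_lattice_nontrivial:
  assumes "z \<in> vecs_over \<O>" "herm z > 0"
  obtains x where "x \<in> orthogonal_lattice z" "x \<noteq> 0"
proof -
  define a :: "complex^3" where "a = vector [1, 0, 1]"
  have "herm a = -2" by (simp add: a_def herm_def)
  then have "herm (herm_cross z a) > 0" using assms(2) by (simp add: herm_herm_cross add_nonneg_pos)
  then have "herm_cross z a \<noteq> 0" using herm_nonzero_imp_nonzero[of "herm_cross z a"] by simp
  moreover have "a \<in> vecs_over \<O>" by (simp add: vecs_over_def forall_3 a_def)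
  then have "herm_cross z a \<in> vecs_over \<O>" by (rule integers.herm_cross_mem_vecs_over[OF assms(1)])
  moreover have "\<langle>herm_cross z a, z\<rangle> = 0" using hprod_herm_cross_self(1) hprod_eq_0_commute by blast
  ultimately have "herm_cross z a \<in> orthogonal_lattice z" "herm_cross z a \<noteq> 0"
    by (simp_all add: orthogonal_lattice_def)
  then show ?thesis using that by blast
qed

lemma minimal_norm_vector_exists:
  assumes "S \<subseteq> vecs_over \<O>" "S \<noteq> {}"
  obtains x where "x \<in> S" "\<And>y. y \<in> S \<Longrightarrow> \<bar>herm x\<bar> \<le> \<bar>herm y\<bar>"
proof -
  define norm where "norm x = nat \<lfloor>\<bar>herm x\<bar>\<rfloor>" for x
  have norm: "real (norm x) = \<bar>herm x\<bar>" if "x \<in> S" for x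
  proof -
    have "herm x \<in> \<int>" using herm_integral_Ints that assms(1) by blast
    then show ?thesis by (auto simp: norm_def elim!: Ints_cases)
  qed
  obtain x where x: "x \<in> S" "\<And>y. y \<in> S \<Longrightarrow> norm x \<le> norm y"
    using assms(2) ex_has_least_nat[of "\<lambda>x. x \<in> S" _ norm] by blast
  have "\<bar>herm x\<bar> \<le> \<bar>herm y\<bar>" if "y \<in> S" for y
    using x(2)[OF that] norm[OF x(1)] norm[OF that] by linarith
  then show ?thesis using that x(1) by blast
qed

lemma orthogonal_lattice_dual_vector:
  assumes z: "z \<in> vecs_over \<O>" "herm z = real D" "D > 0" and x: "x \<in> orthogonal_lattice z" "herm x \<noteq> 0"
  obtains y u where "orthogonal_frame z x y" "y \<in> orthogonal_lattice z - {0}" "u \<in> orthogonal_lattice z"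
    "\<langle>u, y\<rangle> = of_nat (D * fact dirichlet_bound)"
proof -
  have x_integral: "x \<in> vecs_over \<O>" using x(1) by (simp add: orthogonal_lattice_def)
  have frame: "orthogonal_frame z x (herm_cross z x)"
    using z(2,3) x by (intro orthogonal_frame_herm_cross) (auto simp: orthogonal_lattice_def hprod_eq_0_commute[of z])
  obtain w c where w: "w \<in> vecs_over \<O>" "c \<noteq> 0" "c *s herm_cross z x \<in> vecs_over \<O>"
    "\<langle>w, c *s herm_cross z x\<rangle> = of_nat (fact dirichlet_bound)"
    using rescaled_functional[OF integers.herm_cross_mem_vecs_over[OF z(1) x_integral]
        herm_nonzero_imp_nonzero[OF orthogonal_frameD(9)[OF frame]]] by metis
  define y where "y = c *s herm_cross z x"
  have frame: "orthogonal_frame z x y"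
    using frame w(2) by (simp add: orthogonal_frame_def y_def herm_scale)
  moreover have "y \<in> orthogonal_lattice z - {0}"
    using w(3) orthogonal_frameD(5,9)[OF frame] herm_nonzero_imp_nonzero
    by (auto simp: orthogonal_lattice_def simp flip: y_def)
  moreover have "of_nat D *s w - \<langle>w, z\<rangle> *s z \<in> orthogonal_lattice z"
    by (rule projection_mem_orthogonal_lattice[OF z(1,2) w(1)])
  moreover have "\<langle>of_nat D *s w - \<langle>w, z\<rangle> *s z, y\<rangle> = of_nat (D * fact dirichlet_bound)"
    using w(4) orthogonal_frameD(2)[OF frame] by (simp flip: y_def)
  ultimately show ?thesis by (rule that)
qed

lemma reduced_orthogonal_frame_bound:
  assumes frame: "orthogonal_frame z x y" and v: "\<langle>v, z\<rangle> = 0" "cmod \<langle>v, x\<rangle> \<le> \<bar>herm x\<bar> / 2"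
    and "1 \<le> \<bar>herm x\<bar>" "\<bar>herm x\<bar> \<le> \<bar>herm y\<bar>" "\<bar>herm x\<bar> \<le> \<bar>herm v\<bar>"
  shows "\<bar>herm x\<bar> \<le> 2 * (cmod \<langle>v, y\<rangle>)\<^sup>2"
proof -
  define m where "m = \<bar>herm x\<bar>"
  have m: "1 \<le> m" "m \<le> \<bar>herm y\<bar>" using assms(4,5) by (auto simp: m_def)
  have "m \<le> \<bar>(cmod \<langle>v, x\<rangle>)\<^sup>2 / herm x + (cmod \<langle>v, y\<rangle>)\<^sup>2 / herm y\<bar>"
    using assms(6) herm_orthogonal_frame_expansion[OF frame, of v] v(1) by (simp add: m_def)
  also have "\<dots> \<le> \<bar>(cmod \<langle>v, x\<rangle>)\<^sup>2 / herm x\<bar> + \<bar>(cmod \<langle>v, y\<rangle>)\<^sup>2 / herm y\<bar>" by (rule abs_triangle_ineq)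
  also have "\<dots> = (cmod \<langle>v, x\<rangle>)\<^sup>2 / m + (cmod \<langle>v, y\<rangle>)\<^sup>2 / \<bar>herm y\<bar>" by (simp add: m_def)
  also have "(cmod \<langle>v, x\<rangle>)\<^sup>2 / m \<le> (m / 2)\<^sup>2 / m"
    using v(2) m(1) by (intro divide_right_mono power_mono) (auto simp: m_def)
  also have "(m / 2)\<^sup>2 / m = m / 4" using m(1) by (simp add: power2_eq_square)
  also have "(cmod \<langle>v, y\<rangle>)\<^sup>2 / \<bar>herm y\<bar> \<le> (cmod \<langle>v, y\<rangle>)\<^sup>2 / 1" using m by (intro divide_left_mono) auto
  finally show ?thesis using m(1) unfolding m_def[symmetric] by simp
qed

text \<open>As in Hermite reduction, a vector \<open>x\<close> of minimal norm is compared with a combination \<open>v\<close> of \<open>x\<close> and a vector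
  outside its span, Dirichlet's approximation theorem replacing Euclidean division.\<close>

lemma short_orthogonal_vector_anisotropic:
  assumes z: "z \<in> vecs_over \<O>" "herm z = real D" "D > 0"
    and anisotropic: "\<And>x. x \<in> orthogonal_lattice z \<Longrightarrow> x \<noteq> 0 \<Longrightarrow> herm x \<noteq> 0"
  obtains x where "x \<in> orthogonal_lattice z" "herm x \<noteq> 0" "\<bar>herm x\<bar> \<le> real (short_vector_bound D)"
proof -
  define N :: nat where "N = fact dirichlet_bound"
  have nonempty: "orthogonal_lattice z - {0} \<noteq> {}"
    by (rule orthogonal_lattice_nontrivial[OF z(1)]) (use z(2,3) in auto)
  have integral: "orthogonal_lattice z - {0} \<subseteq> vecs_over \<O>" by (auto simp: orthogonal_lattice_def)
  obtain x where x: "x \<in> orthogonal_lattice z - {0}"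
    and least: "\<And>y. y \<in> orthogonal_lattice z - {0} \<Longrightarrow> \<bar>herm x\<bar> \<le> \<bar>herm y\<bar>"
    using minimal_norm_vector_exists[OF integral nonempty] by metis
  have x': "x \<in> vecs_over \<O>" "\<langle>x, z\<rangle> = 0" "herm x \<noteq> 0" using x anisotropic by (auto simp: orthogonal_lattice_def)
  obtain y u where frame: "orthogonal_frame z x y" and y: "y \<in> orthogonal_lattice z - {0}"
    and u: "u \<in> orthogonal_lattice z" "\<langle>u, y\<rangle> = of_nat (D * N)"
    using orthogonal_lattice_dual_vector[OF z _ x'(3)] x unfolding N_def by auto
  obtain j \<beta> where j: "j \<in> {1..dirichlet_bound}" "\<beta> \<in> \<O>" "cmod (of_nat j * (\<langle>u, x\<rangle> / of_real (herm x)) - \<beta>) \<le> 1/2"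
    using dirichlet_approximation .
  define v where "v = of_nat j *s u - \<beta> *s x"
  have v: "v \<in> orthogonal_lattice z"
    using u(1) x j(2) by (auto simp: v_def orthogonal_lattice_def intro!: integers.vecs_over_diff integers.vecs_over_scale)
  have vy: "cmod \<langle>v, y\<rangle> = real (j * D * N)"
    using u(2) orthogonal_frameD(3)[OF frame] by (simp add: v_def norm_mult)
  then have "v \<noteq> 0" using j(1) z(3) by (auto simp: N_def)
  have "\<langle>v, x\<rangle> = (of_nat j * (\<langle>u, x\<rangle> / of_real (herm x)) - \<beta>) * of_real (herm x)"
    using x'(3) by (simp add: v_def hprod_self field_simps)
  then have "cmod \<langle>v, x\<rangle> \<le> \<bar>herm x\<bar> / 2"
    using j(3) mult_right_mono[of _ "1/2" "\<bar>herm x\<bar>"] by (simp add: norm_mult)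
  then have "\<bar>herm x\<bar> \<le> 2 * (cmod \<langle>v, y\<rangle>)\<^sup>2"
    using v least[of v] \<open>v \<noteq> 0\<close> least[OF y] Ints_nonzero_abs_ge1[OF herm_integral_Ints[OF x'(1)] x'(3)]
    by (intro reduced_orthogonal_frame_bound[OF frame]) (auto simp: orthogonal_lattice_def)
  also have "\<dots> = real (2 * (j * D * N)\<^sup>2)" unfolding vy by simp
  also have "\<dots> \<le> real (2 * (dirichlet_bound * D * N)\<^sup>2)"
    unfolding of_nat_le_iff using j(1) by (intro mult_left_mono power_mono mult_right_mono) auto
  also have "\<dots> \<le> real (short_vector_bound D)" unfolding short_vector_bound_def N_def of_nat_le_iff by simp
  finally show ?thesis using that x(1) x'(3) by blast
qed

lemma short_orthogonal_vector:
  assumes z: "z \<in> vecs_over \<O>" "herm z = real D" "D > 0"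
  obtains x where "x \<in> orthogonal_lattice z" "herm x \<noteq> 0" "\<bar>herm x\<bar> \<le> real (short_vector_bound D)"
  using short_orthogonal_vector_isotropic[OF z] short_orthogonal_vector_anisotropic[OF z] by metis


subsection \<open>Orbits of integral vectors\<close>

lemma fact_divide_Ints:
  assumes "r \<in> \<int>" "r \<noteq> 0" "\<bar>r\<bar> \<le> real n"
  shows "complex_of_nat (fact n) / of_real r \<in> \<int>"
proof -
  obtain i :: int where i: "r = of_int i" using assms(1) by (auto elim: Ints_cases)
  have "nat \<bar>i\<bar> dvd fact n" using assms(2,3) unfolding i by (intro dvd_fact) linarith+
  then have "i dvd int (fact n)" by (metis abs_dvd_iff int_dvd_int_iff nat_0_le abs_ge_zero)
  then obtain k where k: "int (fact n) = i * k" by (auto simp: dvd_def)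
  have "complex_of_nat (fact n) = of_int (i * k)" unfolding k[symmetric] by simp
  then show ?thesis using assms(2) by (simp add: i del: of_nat_fact)
qed

lemma multiple_of_coframe_integral:
  assumes "a \<in> vecs_over \<O>" "b \<in> vecs_over \<O>" "c \<in> vecs_over \<O>"
    and "of_nat M / of_real (herm a) \<in> \<O>" "of_nat M / of_real (herm b) \<in> \<O>" "of_nat M / of_real (herm c) \<in> \<O>"
  shows "mat (of_nat M) ** coframe_mat a b c \<in> mats_over \<O>"
proof -
  have row: "of_nat M * (\<langle>axis j 1, v\<rangle> / of_real (herm v)) \<in> \<O>"
    if "v \<in> vecs_over \<O>" "of_nat M / of_real (herm v) \<in> \<O>" for v j
    using integers.mult_closed[OF that(2) integers.hprod_mem[OF integers.axis_mem_vecs_over[of j] that(1)]] by simp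
  show ?thesis
    unfolding mem_mats_over mat_mult_nth forall_3[of "\<lambda>i. \<forall>j. _ i j"]
    using row assms by (simp add: coframe_mat_def)
qed

lemma frame_change_integral_if_cong:
  assumes "orthogonal_frame a b c" "mats_cong M (frame_mat a' b' c') (frame_mat a b c)"
    and coframe: "mat (of_nat M) ** coframe_mat a b c \<in> mats_over \<O>"
  shows "frame_mat a' b' c' ** coframe_mat a b c \<in> mats_over \<O>"
proof -
  obtain W where W: "W \<in> mats_over \<O>" "frame_mat a' b' c' = frame_mat a b c + mat (of_nat M) ** W"
    using assms(2) unfolding mats_cong_def by blast
  have "frame_mat a' b' c' ** coframe_mat a b c = mat 1 + W ** (mat (of_nat M) ** coframe_mat a b c)"
    unfolding W(2) matrix_add_rdistrib coframe_mat_frame_mat(2)[OF assms(1)]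
    by (simp add: mult_mat_mult[of W] flip: matrix_mul_assoc)
  then show ?thesis
    using W(1) coframe by (simp add: integers.mats_over_add integers.mat_one_mem_mats_over integers.mats_over_mult)
qed

lemma multiple_of_herm_cross_coframe_integral:
  assumes z: "z \<in> vecs_over \<O>" "herm z = real D" "D > 0"
    and x: "x \<in> orthogonal_lattice z" "herm x \<noteq> 0" "\<bar>herm x\<bar> \<le> real C"
  shows "mat (of_nat (D * fact C)) ** coframe_mat z x (herm_cross z x) \<in> mats_over \<O>"
proof (rule multiple_of_coframe_integral)
  have x': "x \<in> vecs_over \<O>" "\<langle>z, x\<rangle> = 0" using x(1) by (auto simp: orthogonal_lattice_def hprod_eq_0_commute[of z])
  show "z \<in> vecs_over \<O>" "x \<in> vecs_over \<O>" "herm_cross z x \<in> vecs_over \<O>"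
    using z(1) x'(1) integers.herm_cross_mem_vecs_over by auto
  have quotient: "complex_of_nat (fact C) / of_real (herm x) \<in> \<O>"
    using fact_divide_Ints[OF herm_integral_Ints[OF x'(1)] x(2,3)] integers.Ints_closed by blast
  show "of_nat (D * fact C) / of_real (herm z) \<in> \<O>"
    using z(2,3) integers.of_nat_closed[of "fact C"] by (simp del: of_nat_fact)
  have "of_nat (D * fact C) / of_real (herm x) = of_nat D * (complex_of_nat (fact C) / of_real (herm x))" by simp
  then show "of_nat (D * fact C) / of_real (herm x) \<in> \<O>"
    using quotient by (metis integers.mult_closed integers.of_nat_closed)
  have "herm (herm_cross z x) = - real D * herm x" using x'(2) z(2) by (simp add: herm_herm_cross)
  then have "of_nat (D * fact C) / of_real (herm (herm_cross z x)) = - (complex_of_nat (fact C) / of_real (herm x))"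
    using z(3) by (simp del: of_nat_fact)
  then show "of_nat (D * fact C) / of_real (herm (herm_cross z x)) \<in> \<O>" using quotient by (metis integers.minus_closed)
qed

lemma congruent_frames_same_orbit:
  assumes z: "z \<in> vecs_over \<O>" "herm z = real D" "D > 0"
    and x: "x \<in> orthogonal_lattice z" "herm x \<noteq> 0" "\<bar>herm x\<bar> \<le> real C"
    and z': "herm z' = real D" and x': "x' \<in> orthogonal_lattice z'" "herm x' = herm x"
    and cong: "mats_cong (D * fact C) (frame_mat z' x' (herm_cross z' x')) (frame_mat z x (herm_cross z x))"
  obtains g where "g \<in> carrier SU_h \<inter> mats_over \<O>" "g *v z = z'"
proof -
  let ?y = "herm_cross z x" and ?y' = "herm_cross z' x'"
  have frame: "orthogonal_frame z x ?y"
    using z(2,3) x by (intro orthogonal_frame_herm_cross) (auto simp: orthogonal_lattice_def hprod_eq_0_commute[of z])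
  have frame': "orthogonal_frame z' x' ?y'"
    using z(3) z' x' x(2) by (intro orthogonal_frame_herm_cross)
      (auto simp: orthogonal_lattice_def hprod_eq_0_commute[of z'])
  have norms: "herm ?y = - real D * herm x" "herm ?y' = - real D * herm x"
    using orthogonal_frameD(1)[OF frame] orthogonal_frameD(1)[OF frame'] z(2) z' x'(2) by (simp_all add: herm_herm_cross)
  let ?B = "frame_mat z x ?y" and ?B' = "frame_mat z' x' ?y'" and ?E = "coframe_mat z x ?y"
  have "mat (of_nat (D * fact C)) ** ?E \<in> mats_over \<O>" by (rule multiple_of_herm_cross_coframe_integral[OF z x])
  then have "?B' ** ?E \<in> mats_over \<O>" using frame cong by (intro frame_change_integral_if_cong)
  moreover have "herm_isometry (?B' ** ?E)"
    using norms z(2) z' x'(2) by (intro frame_change_isometry[OF frame frame']) auto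
  moreover have "det (?B' ** ?E) = 1"
  proof -
    have "det ?B' = det ?B" by (simp only: det_frame_mat_herm_cross norms)
    moreover have "det ?B * det ?E = 1" using coframe_mat_frame_mat(2)[OF frame] by (metis det_I det_mul)
    ultimately show ?thesis by (simp add: det_mul)
  qed
  moreover have "(?B' ** ?E) *v z = z'"
  proof -
    have "?B *v axis 1 1 = z" "?B' *v axis 1 1 = z'" by (simp_all add: frame_mat_mult_vec axis_def)
    moreover have "?E *v (?B *v axis 1 1) = axis 1 1"
      using coframe_mat_frame_mat(1)[OF frame] by (simp add: matrix_vector_mul_assoc)
    ultimately show ?thesis by (metis matrix_vector_mul_assoc)
  qed
  ultimately show ?thesis using that by (simp add: carrier_SU_h)
qed

lemma finitely_many_orbits_of_norm:
  assumes D: "D > 0"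
  shows "finitely_many_classes {z \<in> vecs_over \<O>. herm z = real D}
    (\<lambda>z' z. \<exists>g\<in>carrier SU_h \<inter> mats_over \<O>. g *v z = z')" (is "finitely_many_classes ?Z _")
proof -
  define C where "C = short_vector_bound D"
  have "\<forall>z\<in>?Z. \<exists>x. x \<in> orthogonal_lattice z \<and> herm x \<noteq> 0 \<and> \<bar>herm x\<bar> \<le> real C"
    using short_orthogonal_vector D unfolding C_def by blast
  then obtain x where x: "\<And>z. z \<in> ?Z \<Longrightarrow> x z \<in> orthogonal_lattice z \<and> herm (x z) \<noteq> 0 \<and> \<bar>herm (x z)\<bar> \<le> real C"
    by metis
  define B where "B z = frame_mat z (x z) (herm_cross z (x z))" for z
  have x_integral: "x z \<in> vecs_over \<O>" if "z \<in> ?Z" for z using x[OF that] by (simp add: orthogonal_lattice_def)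
  have "finitely_many_classes ?Z (\<lambda>z' z. mats_cong (D * fact C) (B z') (B z))"
    using D x_integral unfolding B_def
    by (intro finitely_many_classes_map[OF finitely_many_matrix_residues, where f = B, unfolded B_def])
       (auto intro!: integers.frame_mat_mem_mats_over integers.herm_cross_mem_vecs_over)
  moreover have "finitely_many_classes ?Z (\<lambda>z' z. herm (x z') = herm (x z))"
    unfolding finite_image_iff_finitely_many_classes[symmetric]
  proof (rule finite_subset)
    show "(\<lambda>z. herm (x z)) ` ?Z \<subseteq> real_of_int ` {- int C..int C}"
    proof (rule image_subsetI)
      fix z assume z: "z \<in> ?Z"
      obtain i :: int where i: "herm (x z) = of_int i"
        using herm_integral_Ints[OF x_integral[OF z]] by (auto elim: Ints_cases)
      have "\<bar>i\<bar> \<le> int C" using x[OF z] unfolding i by linarith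
      then show "herm (x z) \<in> real_of_int ` {- int C..int C}" unfolding i by (intro imageI) (auto simp: abs_le_iff)
    qed
  qed simp
  ultimately have "finitely_many_classes ?Z
      (\<lambda>z' z. mats_cong (D * fact C) (B z') (B z) \<and> herm (x z') = herm (x z))"
    by (rule finitely_many_classes_conj)
  then show ?thesis
  proof (rule finitely_many_classes_mono)
    fix z' z assume z: "z' \<in> ?Z" "z \<in> ?Z" and "mats_cong (D * fact C) (B z') (B z) \<and> herm (x z') = herm (x z)"
    then show "\<exists>g\<in>carrier SU_h \<inter> mats_over \<O>. g *v z = z'"
      using congruent_frames_same_orbit[of z D "x z" C z' "x z'"] x[OF z(1)] x[OF z(2)] D unfolding B_def by blast
  qed
qed

lemma Picard_conjugacy_class_eq:
  assumes "A \<subseteq> carrier PSU_h" "h \<in> Picard K"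
  shows "Picard_conjugacy K `` {conjugate PSU_h h A} = Picard_conjugacy K `` {A}"
proof -
  interpret group PSU_h by (rule group_PSU_h)
  note carrier = subsetD[OF Picard_subset_carrier]
  have h_inv: "inv\<^bsub>PSU_h\<^esub> h \<in> Picard K" using subgroup_Picard assms(2) by (rule subgroup.m_inv_closed)
  have compose: "conjugate PSU_h g (conjugate PSU_h h A) \<in> Picard_conjugacy K `` {A}"
    if "A \<subseteq> carrier PSU_h" "g \<in> Picard K" "h \<in> Picard K" for g h A
    using conjugate_conjugate[OF that(1) carrier[OF that(2)] carrier[OF that(3)]]
      subgroup.m_closed[OF subgroup_Picard that(2,3)] by (auto simp: Picard_conjugacy_def)
  have "conjugate PSU_h g (conjugate PSU_h h A) \<in> Picard_conjugacy K `` {A}" if "g \<in> Picard K" for g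
    using compose[OF assms(1) that assms(2)] .
  moreover have "conjugate PSU_h g A \<in> Picard_conjugacy K `` {conjugate PSU_h h A}" if "g \<in> Picard K" for g
  proof -
    have gh: "g \<otimes>\<^bsub>PSU_h\<^esub> inv\<^bsub>PSU_h\<^esub> h \<in> Picard K"
      using subgroup.m_closed[OF subgroup_Picard that h_inv] .
    have "conjugate PSU_h (g \<otimes>\<^bsub>PSU_h\<^esub> inv\<^bsub>PSU_h\<^esub> h) (conjugate PSU_h h A) = conjugate PSU_h g A"
      using conjugate_conjugate[OF assms(1) carrier[OF gh] carrier[OF assms(2)]] carrier[OF that] carrier[OF assms(2)]
      by (simp add: m_assoc)
    then show ?thesis using gh by (auto simp: Picard_conjugacy_def)
  qed
  ultimately show ?thesis by (auto simp: Picard_conjugacy_def)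
qed

proposition finite_conjugacy_classes:
  assumes D: "D > 0"
  shows "finite (max_C_Fuchsian_of_discriminant K D // Picard_conjugacy K)"
proof (rule finite_subset)
  let ?Z = "{z \<in> vecs_over \<O>. herm z = real D}"
  let ?class = "\<lambda>z. Picard_conjugacy K `` {Picard_vector_stabilizer z}"
  show "max_C_Fuchsian_of_discriminant K D // Picard_conjugacy K \<subseteq> ?class ` ?Z"
  proof
    fix c assume "c \<in> max_C_Fuchsian_of_discriminant K D // Picard_conjugacy K"
    then obtain \<Gamma> where \<Gamma>: "\<Gamma> \<in> max_C_Fuchsian_of_discriminant K D" "c = Picard_conjugacy K `` {\<Gamma>}"
      by (rule quotientE)
    obtain z where "z \<in> vecs_over \<O>" "herm z = real D" "\<Gamma> = Picard_vector_stabilizer z"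
      using max_C_Fuchsian_of_discriminantE[OF \<Gamma>(1) D] .
    then show "c \<in> ?class ` ?Z" using \<Gamma>(2) by blast
  qed
  have "finitely_many_classes ?Z (\<lambda>z' z. ?class z' = ?class z)"
  proof (rule finitely_many_classes_mono[OF finitely_many_orbits_of_norm[OF D]])
    fix z' z assume "\<exists>g\<in>carrier SU_h \<inter> mats_over \<O>. g *v z = z'"
    then obtain g where g: "g \<in> carrier SU_h" "g \<in> mats_over \<O>" "g *v z = z'" by blast
    then have "Picard_vector_stabilizer z' = conjugate PSU_h (PSU_class g) (Picard_vector_stabilizer z)"
      using conjugate_Picard_vector_stabilizer by blast
    moreover have "PSU_class g \<in> Picard K" using g(1,2) by (auto simp: Picard_eq)
    ultimately show "?class z' = ?class z"
      using Picard_conjugacy_class_eq[OF subgroup.subset[OF subgroup_Picard_vector_stabilizer]] by metis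
  qed
  then show "finite (?class ` ?Z)" by (simp only: finite_image_iff_finitely_many_classes)
qed

end

theorem theorem1p1:
  fixes K :: "complex set" and D :: nat
  assumes "imaginary_quadratic_field K" and "D > 0"
  shows "finite (max_C_Fuchsian_of_discriminant K D // Picard_conjugacy K) \<and>
         max_C_Fuchsian_of_discriminant K D // Picard_conjugacy K \<noteq> {} \<and>
         (\<forall>\<Gamma> \<in> max_C_Fuchsian_of_discriminant K D.
            commensurable_up_to_conjugacy PSU_h \<Gamma> (Picard_stab K (2 * D)))"
proof -
  obtain s d where "imaginary_quadratic K s d" using imaginary_quadratic_field_generator[OF assms(1)] .
  then interpret imaginary_quadratic K s d .
  have "max_C_Fuchsian_of_discriminant K D // Picard_conjugacy K \<noteq> {}"
    using Picard_stabilizer_norm_disc_vec_maximal[OF assms(2)] by (auto simp: quotient_def)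
  moreover have "commensurable_up_to_conjugacy PSU_h \<Gamma> (Picard_stab K (2 * D))"
    if \<Gamma>: "\<Gamma> \<in> max_C_Fuchsian_of_discriminant K D" for \<Gamma>
  proof -
    obtain z where z: "z \<in> vecs_over \<O>" "herm z = real D" "\<Gamma> = Picard_vector_stabilizer z"
      using max_C_Fuchsian_of_discriminantE[OF \<Gamma> assms(2)] .
    let ?z' = "vector [- of_nat (2 * D), 0, 1] :: complex^3"
    have "?z' \<in> vecs_over \<O>" by (simp add: vecs_over_def forall_3)
    moreover have "herm (of_nat 2 *s z) = herm ?z'" "herm ?z' \<noteq> 0"
      using assms(2) z(2) by (simp_all add: herm_scale) (simp_all add: herm_def)
    ultimately show ?thesis
      unfolding z(3) Picard_stab_eq using z(1) by (intro Picard_vector_stabilizer_commensurable)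
  qed
  ultimately show ?thesis using finite_conjugacy_classes[OF assms(2)] by blast
qed

end
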